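(* Let $\epsilon\in\{1,-1\}$, $\tau\neq0$ and $\kappa=4\tau^2+\epsilon>0$. Let $\Sigma$ be a simply connected surface. Suppose that there exists an isometric minimal immersion of $\Sigma$ in $\mathbb{S}^3_b(\kappa,\tau)$. Then there is a correspondence in the sister immersions (the minimal immersion of $\Sigma$ in $\mathbb{S}^3_b(\kappa,\tau)$ and its sister constant mean curvature $\tau$ immersion in $M^2(\epsilon)\times\mathbb{R}$) between the following symmetries of the surface $\Sigma$: (a) a reflection around a horizontal geodesic of $\mathbb{S}^3_b(\kappa,\tau)$, and (b) a reflection with respect to a vertical plane of $M^2(\epsilon)\times\mathbb{R}$.
   Context: Let $\mathbb{S}^3=\{(z,w)\in\mathbb{C}^2:|z|^2+|w|^2=1\}$ with round metric $\langle\,,\,\rangle$ and $V_{(z,w)}=(iz,iw)$. For $\kappa>0$, $\tau\neq0$, the Berger sphere $\mathbb{S}^3_b(\kappa,\tau)$ is $\mathbb{S}^3$ with the metric $g(X,Y)=\frac4\kappa\left[\langle X,Y\rangle+\left(\frac{4\tau^2}{\kappa}-1\right)\langle X,V\rangle\langle Y,V\rangle\right]$; its unit vertical Killing field is $\xi=\frac{\kappa}{4\tau}V$. A geodesic is horizontal if its tangent vector is orthogonal to $V$. The geodesic reflection across (around) a geodesic $\gamma$ sends a point $p$ to $\alpha(-s_0)$, where $\alpha$ is a geodesic meeting $\gamma$ orthogonally at $s=0$ with $\alpha(s_0)=p$; across a horizontal geodesic it is an isometry of $\mathbb{S}^3_b(\kappa,\tau)$. $M^2(1)=\mathbb{S}^2$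 and $M^2(-1)=\mathbb{H}^2$ are the 2-sphere and the hyperbolic plane of constant curvature $1$ and $-1$, viewed in $\mathbb{R}^3$, respectively in Minkowski space $\mathbb{R}^3_1$. A vertical plane of $M^2(\epsilon)\times\mathbb{R}$ is a set $\{(p,t)\in M^2(\epsilon)\times\mathbb{R}:\langle p,v\rangle=0\}$ with $v$ a unit (spacelike) vector, i.e. the product of a complete geodesic of $M^2(\epsilon)$ with $\mathbb{R}$; the reflection with respect to it is the isometry that reflects the $M^2(\epsilon)$ factor across that geodesic and fixes the $\mathbb{R}$ coordinate. Sister immersion (Daniel correspondence): to each minimal isometric immersion of a simply connected surface $\Sigma$ in $\mathbb{S}^3_b(4\tau^2+\epsilon,\tau)$ there corresponds an isometric immersion of $\Sigma$ in $M^2(\epsilon)\times\mathbb{R}$ with constant mean curvature $H=\tau$. If $N$ is the unit normal and $S$ the shape operator of the minimal immersion, $\xi=T+\nu N$ with $T$ tangent to $\Sigma$, and $J$ is the rotation by $\pi/2$ in the tangent plane of $\Sigma$, then the sister immersion, with unit normal $N^*$, has shape operator $S^*=-JS+\tau\,\mathrm{Id}$, and the vertical field of $M^2(\epsilon)\times\mathbb{R}$ is $(0,1)=-JT+\nu N^*$.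
   Formalization: The symmetry of Σ is required to be a nontrivial isometry fixing a regular curve of Σ pointwise; without this the claim fails, e.g. for a horizontal geodesic meeting a minimal great sphere orthogonally, whose reflection does not correspond to a vertical plane. *)

theory Defs
  imports "HOL-Analysis.Analysis"
begin

section \<open>Smooth functions on open sets\<close>

primrec Ck_on :: "nat \<Rightarrow> ('u::real_normed_vector \<Rightarrow> 'v::real_normed_vector) \<Rightarrow> 'u set \<Rightarrow> bool" where
  "Ck_on 0 f U \<longleftrightarrow> continuous_on U f"
| "Ck_on (Suc k) f U \<longleftrightarrow>
     (\<forall>u\<in>U. f differentiable (at u)) \<and> (\<forall>v. Ck_on k (\<lambda>u. frechet_derivative f (at u) v) U)"

text \<open>Meant for open \<open>U\<close> in a finite-dimensional space, where continuity of all iterated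
  directional derivatives is the usual notion of smoothness.\<close>

definition smooth_on :: "'u set \<Rightarrow> ('u::real_normed_vector \<Rightarrow> 'v::real_normed_vector) \<Rightarrow> bool" where
  "smooth_on U f \<longleftrightarrow> (\<forall>k. Ck_on k f U)"

abbreviation differential ::
    "('u::real_normed_vector \<Rightarrow> 'v::real_normed_vector) \<Rightarrow> 'u \<Rightarrow> 'u \<Rightarrow> 'v" where
  "differential f u \<equiv> frechet_derivative f (at u)"

section \<open>Riemannian submanifolds of a Euclidean space\<close>

text \<open>A Riemannian manifold is a submanifold \<open>Q\<close> of a Euclidean space together with a field \<open>g\<close>
  of symmetric bilinear forms on the ambient space, depending smoothly on the point and positive
  definite on the tangent spaces of \<open>Q\<close>. (For hyperbolic space \<open>g\<close> is indefinite on
  the ambient space.)\<close>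

type_synonym 'e metric = "'e \<Rightarrow> 'e \<Rightarrow> 'e \<Rightarrow> real"

definition tangent_space :: "'e::euclidean_space set \<Rightarrow> 'e \<Rightarrow> 'e set" where
  "tangent_space Q p =
     {v. \<exists>c. (\<forall>s::real. c s \<in> Q) \<and> c 0 = p \<and> (c has_vector_derivative v) (at 0)}"

definition christoffel :: "'e::euclidean_space metric \<Rightarrow> 'e \<Rightarrow> 'e \<Rightarrow> 'e \<Rightarrow> 'e \<Rightarrow> real" where
  "christoffel g p X Y Z =
     (deriv (\<lambda>s. g (p + s *\<^sub>R X) Y Z) 0 + deriv (\<lambda>s. g (p + s *\<^sub>R Y) X Z) 0
        - deriv (\<lambda>s. g (p + s *\<^sub>R Z) X Y) 0) / 2"

text \<open>\<open>W\<close> is the covariant derivative at \<open>u\<close>, in direction \<open>v\<close>, of the vector field \<open>Y\<close> along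
  the map \<open>f\<close> into \<open>Q\<close>, for the Levi-Civita connection of \<open>(Q, g)\<close>. Writing \<open>D\<close> for the flat
  derivative of the ambient space, the Koszul formula for vector fields tangent to \<open>Q\<close> reduces to
  \<open>g (\<nabla>\<^sub>X Y) Z = g (D\<^sub>X Y) Z + christoffel g p X Y Z\<close> for all tangent \<open>Z\<close>, because the bracket
  terms cancel the terms coming from derivatives of the fields. The right-hand side depends only
  on the restriction of \<open>g\<close> to the tangent bundle of \<open>Q\<close>; if \<open>g\<close> is constant, then
  \<open>\<nabla>\<^sub>X Y\<close> is the tangential part of \<open>D\<^sub>X Y\<close>.\<close>

definition has_covariant_derivative ::
    "'e::euclidean_space set \<Rightarrow> 'e metric \<Rightarrow> ('u::real_normed_vector \<Rightarrow> 'e) \<Rightarrow> ('u \<Rightarrow> 'e)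
       \<Rightarrow> 'u \<Rightarrow> 'u \<Rightarrow> 'e \<Rightarrow> bool" where
  "has_covariant_derivative Q g f Y u v W \<longleftrightarrow>
     W \<in> tangent_space Q (f u) \<and>
     (\<forall>Z\<in>tangent_space Q (f u).
        g (f u) W Z
          = g (f u) (differential Y u v) Z + christoffel g (f u) (differential f u v) (Y u) Z)"

abbreviation velocity :: "(real \<Rightarrow> 'e::real_normed_vector) \<Rightarrow> real \<Rightarrow> 'e" where
  "velocity c t \<equiv> vector_derivative c (at t)"

text \<open>Complete nonconstant geodesics.\<close>

definition geodesic :: "'e::euclidean_space set \<Rightarrow> 'e metric \<Rightarrow> (real \<Rightarrow> 'e) \<Rightarrow> bool" where
  "geodesic Q g c \<longleftrightarrow>
     smooth_on UNIV c \<and>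
     (\<forall>t. c t \<in> Q \<and> velocity c t \<noteq> 0 \<and> has_covariant_derivative Q g c (velocity c) t 1 0)"

definition geodesic_reflection ::
    "'e::euclidean_space set \<Rightarrow> 'e metric \<Rightarrow> (real \<Rightarrow> 'e) \<Rightarrow> ('e \<Rightarrow> 'e) \<Rightarrow> bool" where
  "geodesic_reflection Q g \<gamma> \<rho> \<longleftrightarrow>
     (\<forall>p\<in>Q. \<exists>\<alpha> s\<^sub>0 t. geodesic Q g \<alpha> \<and> \<alpha> 0 = \<gamma> t \<and> g (\<gamma> t) (velocity \<alpha> 0) (velocity \<gamma> t) = 0 \<and>
        \<alpha> s\<^sub>0 = p \<and> \<rho> p = \<alpha> (- s\<^sub>0))"

section \<open>Berger spheres\<close>

abbreviation S3 :: "(complex \<times> complex) set" where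
  "S3 \<equiv> sphere 0 1"

definition hopf_field :: "complex \<times> complex \<Rightarrow> complex \<times> complex" where
  "hopf_field p = (\<i> * fst p, \<i> * snd p)"

definition berger_metric :: "real \<Rightarrow> real \<Rightarrow> (complex \<times> complex) metric" where
  "berger_metric \<kappa> \<tau> p X Y =
     4 / \<kappa> * (X \<bullet> Y + (4 * \<tau>\<^sup>2 / \<kappa> - 1) * (X \<bullet> hopf_field p) * (Y \<bullet> hopf_field p))"

definition berger_vertical :: "real \<Rightarrow> real \<Rightarrow> complex \<times> complex \<Rightarrow> complex \<times> complex" where
  "berger_vertical \<kappa> \<tau> p = (\<kappa> / (4 * \<tau>)) *\<^sub>R hopf_field p"

definition horizontal_geodesic :: "real \<Rightarrow> real \<Rightarrow> (real \<Rightarrow> complex \<times> complex) \<Rightarrow> bool" where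
  "horizontal_geodesic \<kappa> \<tau> \<gamma> \<longleftrightarrow>
     geodesic S3 (berger_metric \<kappa> \<tau>) \<gamma> \<and>
     (\<forall>t. berger_metric \<kappa> \<tau> (\<gamma> t) (velocity \<gamma> t) (hopf_field (\<gamma> t)) = 0)"

section \<open>The product of the sphere or the hyperbolic plane with the line\<close>

text \<open>For \<open>\<epsilon> = 1\<close> this is the Euclidean inner product, for \<open>\<epsilon> = -1\<close> the Minkowski one.\<close>

definition mink :: "real \<Rightarrow> real^3 \<Rightarrow> real^3 \<Rightarrow> real" where
  "mink \<epsilon> x y = x$1 * y$1 + x$2 * y$2 + \<epsilon> * (x$3 * y$3)"

definition M2 :: "real \<Rightarrow> (real^3) set" where
  "M2 \<epsilon> = {x. mink \<epsilon> x x = \<epsilon> \<and> (\<epsilon> = -1 \<longrightarrow> x$3 > 0)}"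

definition M2R :: "real \<Rightarrow> ((real^3) \<times> real) set" where
  "M2R \<epsilon> = M2 \<epsilon> \<times> UNIV"

definition M2R_metric :: "real \<Rightarrow> ((real^3) \<times> real) metric" where
  "M2R_metric \<epsilon> p X Y = mink \<epsilon> (fst X) (fst Y) + snd X * snd Y"

definition vertical_plane :: "real \<Rightarrow> real^3 \<Rightarrow> ((real^3) \<times> real) set" where
  "vertical_plane \<epsilon> v = {q \<in> M2R \<epsilon>. mink \<epsilon> (fst q) v = 0}"

definition vertical_reflection :: "real \<Rightarrow> real^3 \<Rightarrow> (real^3) \<times> real \<Rightarrow> (real^3) \<times> real" where
  "vertical_reflection \<epsilon> v q = (fst q - (2 * mink \<epsilon> (fst q) v) *\<^sub>R v, snd q)"

lemma vertical_reflection_isometry: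
  assumes "mink \<epsilon> v v = 1"
  shows "M2R_metric \<epsilon> p (vertical_reflection \<epsilon> v X) (vertical_reflection \<epsilon> v Y) = M2R_metric \<epsilon> p X Y"
proof -
  have "mink \<epsilon> (x - (2 * mink \<epsilon> x v) *\<^sub>R v) (y - (2 * mink \<epsilon> y v) *\<^sub>R v)
      = mink \<epsilon> x y + 4 * mink \<epsilon> x v * mink \<epsilon> y v * (mink \<epsilon> v v - 1)" for x y
    by (simp add: mink_def algebra_simps)
  with assms show ?thesis
    by (simp add: M2R_metric_def vertical_reflection_def)
qed

lemma vertical_reflection_fixed_iff:
  assumes "mink \<epsilon> v v = 1" and "q \<in> M2R \<epsilon>"
  shows "vertical_reflection \<epsilon> v q = q \<longleftrightarrow> q \<in> vertical_plane \<epsilon> v"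
proof -
  have "v \<noteq> 0"
    using assms(1) by (auto simp: mink_def)
  then show ?thesis
    using assms(2) by (auto simp: vertical_reflection_def vertical_plane_def prod_eq_iff)
qed

section \<open>Riemannian surfaces\<close>

text \<open>A chart is a local parametrization \<open>x\<close> of the surface, defined on an open set \<open>U\<close> of the
  plane. Tensor fields on the surface are given by their coordinate expressions in all charts of
  the atlas, subject to the transformation rule for changes of charts.\<close>

type_synonym 'a chart = "(real^2) set \<times> (real^2 \<Rightarrow> 'a)"
type_synonym 'a surface_metric = "'a chart \<Rightarrow> real^2 \<Rightarrow> real^2 \<Rightarrow> real^2 \<Rightarrow> real"
type_synonym 'a endomorphism_field = "'a chart \<Rightarrow> real^2 \<Rightarrow> real^2 \<Rightarrow> real^2"

definition coord_dom :: "'a chart \<Rightarrow> 'a chart \<Rightarrow> ('a \<Rightarrow> 'a) \<Rightarrow> (real^2) set" where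
  "coord_dom c d F = {u \<in> fst c. F (snd c u) \<in> snd d ` fst d}"

definition coord_rep :: "'a chart \<Rightarrow> 'a chart \<Rightarrow> ('a \<Rightarrow> 'a) \<Rightarrow> real^2 \<Rightarrow> real^2" where
  "coord_rep c d F = inv_into (fst d) (snd d) \<circ> F \<circ> snd c"

definition smooth_surface ::
    "'a::{t2_space,second_countable_topology} set \<Rightarrow> 'a chart set \<Rightarrow> bool" where
  "smooth_surface M A \<longleftrightarrow>
     (\<forall>(U, x)\<in>A. open U \<and> openin (top_of_set M) (x ` U) \<and> (\<exists>y. homeomorphism U (x ` U) x y)) \<and>
     M = (\<Union>(U, x)\<in>A. x ` U) \<and>
     (\<forall>c\<in>A. \<forall>d\<in>A. smooth_on (coord_dom c d id) (coord_rep c d id))"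

text \<open>\<open>F\<close> preserves the metric; for \<open>F = id\<close> this is the transformation rule of the metric under
  changes of charts.\<close>

definition preserves_metric :: "'a chart set \<Rightarrow> 'a surface_metric \<Rightarrow> ('a \<Rightarrow> 'a) \<Rightarrow> bool" where
  "preserves_metric A h F \<longleftrightarrow>
     (\<forall>c\<in>A. \<forall>d\<in>A. \<forall>u\<in>coord_dom c d F. \<forall>v w.
        h d (coord_rep c d F u) (differential (coord_rep c d F) u v) (differential (coord_rep c d F) u w)
          = h c u v w)"

definition riemannian_metric :: "'a chart set \<Rightarrow> 'a surface_metric \<Rightarrow> bool" where
  "riemannian_metric A h \<longleftrightarrow>
     (\<forall>c\<in>A. (\<forall>v w. smooth_on (fst c) (\<lambda>u. h c u v w)) \<and>
        (\<forall>u\<in>fst c. bilinear (h c u) \<and> (\<forall>v w. h c u v w = h c u w v) \<and>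
           (\<forall>v. v \<noteq> 0 \<longrightarrow> h c u v v > 0))) \<and>
     preserves_metric A h id"

text \<open>A field of rotations by \<open>\<pi>/2\<close> in the tangent planes, i.e. an orientation of the surface.\<close>

definition rotation_field ::
    "'a chart set \<Rightarrow> 'a surface_metric \<Rightarrow> 'a endomorphism_field \<Rightarrow> bool" where
  "rotation_field A h J \<longleftrightarrow>
     (\<forall>c\<in>A. (\<forall>v. smooth_on (fst c) (\<lambda>u. J c u v)) \<and>
        (\<forall>u\<in>fst c. linear (J c u) \<and>
           (\<forall>v. h c u (J c u v) (J c u v) = h c u v v \<and> h c u (J c u v) v = 0))) \<and>
     (\<forall>c\<in>A. \<forall>d\<in>A. \<forall>u\<in>coord_dom c d id. \<forall>v.
        differential (coord_rep c d id) u (J c u v)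
          = J d (coord_rep c d id u) (differential (coord_rep c d id) u v))"

definition surface_isometry ::
    "'a::{t2_space,second_countable_topology} set \<Rightarrow> 'a chart set \<Rightarrow> 'a surface_metric
       \<Rightarrow> ('a \<Rightarrow> 'a) \<Rightarrow> bool" where
  "surface_isometry M A h F \<longleftrightarrow>
     bij_betw F M M \<and> continuous_on M F \<and>
     (\<forall>c\<in>A. \<forall>d\<in>A. smooth_on (coord_dom c d F) (coord_rep c d F)) \<and>
     preserves_metric A h F"

text \<open>A reflection of the surface is a nontrivial isometry that fixes a regular curve pointwise.\<close>

definition surface_reflection ::
    "'a::{t2_space,second_countable_topology} set \<Rightarrow> 'a chart set \<Rightarrow> 'a surface_metric
       \<Rightarrow> ('a \<Rightarrow> 'a) \<Rightarrow> bool" where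
  "surface_reflection M A h F \<longleftrightarrow>
     surface_isometry M A h F \<and> (\<exists>p\<in>M. F p \<noteq> p) \<and>
     (\<exists>(U, x)\<in>A. \<exists>c. smooth_on {0<..<1} c \<and>
        (\<forall>t\<in>{0<..<1}. c t \<in> U \<and> velocity c t \<noteq> 0 \<and> F (x (c t)) = x (c t)))"

section \<open>Immersed surfaces\<close>

definition isometric_immersion ::
    "'a chart set \<Rightarrow> 'a surface_metric \<Rightarrow> 'e::euclidean_space set \<Rightarrow> 'e metric \<Rightarrow> ('a \<Rightarrow> 'e) \<Rightarrow> bool" where
  "isometric_immersion A h Q g \<phi> \<longleftrightarrow>
     (\<forall>(U, x)\<in>A. smooth_on U (\<phi> \<circ> x) \<and>
        (\<forall>u\<in>U. \<phi> (x u) \<in> Q \<and> inj (differential (\<phi> \<circ> x) u) \<and>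
           (\<forall>v w. g (\<phi> (x u)) (differential (\<phi> \<circ> x) u v) (differential (\<phi> \<circ> x) u w) = h (U, x) u v w)))"

definition unit_normal ::
    "'a chart set \<Rightarrow> 'e::euclidean_space set \<Rightarrow> 'e metric \<Rightarrow> ('a \<Rightarrow> 'e) \<Rightarrow> ('a \<Rightarrow> 'e) \<Rightarrow> bool" where
  "unit_normal A Q g \<phi> N \<longleftrightarrow>
     (\<forall>(U, x)\<in>A. smooth_on U (N \<circ> x) \<and>
        (\<forall>u\<in>U. N (x u) \<in> tangent_space Q (\<phi> (x u)) \<and> g (\<phi> (x u)) (N (x u)) (N (x u)) = 1 \<and>
           (\<forall>v. g (\<phi> (x u)) (differential (\<phi> \<circ> x) u v) (N (x u)) = 0)))"

text \<open>\<open>S\<close> is the coordinate expression at \<open>u\<close> of the shape operator \<open>S v = - \<nabla>\<^sub>v N\<close>.\<close>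

definition shape_operator ::
    "'e::euclidean_space set \<Rightarrow> 'e metric \<Rightarrow> ('a \<Rightarrow> 'e) \<Rightarrow> ('a \<Rightarrow> 'e) \<Rightarrow> (real^2 \<Rightarrow> 'a) \<Rightarrow> real^2
       \<Rightarrow> (real^2 \<Rightarrow> real^2) \<Rightarrow> bool" where
  "shape_operator Q g \<phi> N x u S \<longleftrightarrow>
     linear S \<and>
     (\<forall>v. has_covariant_derivative Q g (\<phi> \<circ> x) (N \<circ> x) u v (- differential (\<phi> \<circ> x) u (S v)))"

definition constant_mean_curvature ::
    "'a chart set \<Rightarrow> 'e::euclidean_space set \<Rightarrow> 'e metric \<Rightarrow> ('a \<Rightarrow> 'e) \<Rightarrow> ('a \<Rightarrow> 'e) \<Rightarrow> real \<Rightarrow> bool" where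
  "constant_mean_curvature A Q g \<phi> N H \<longleftrightarrow>
     (\<forall>(U, x)\<in>A. \<forall>u\<in>U. \<exists>S. shape_operator Q g \<phi> N x u S \<and> trace (matrix S) / 2 = H)"

definition minimal_immersion ::
    "'a chart set \<Rightarrow> 'a surface_metric \<Rightarrow> real \<Rightarrow> real \<Rightarrow> ('a \<Rightarrow> complex \<times> complex)
       \<Rightarrow> ('a \<Rightarrow> complex \<times> complex) \<Rightarrow> bool" where
  "minimal_immersion A h \<kappa> \<tau> \<phi> N \<longleftrightarrow>
     isometric_immersion A h S3 (berger_metric \<kappa> \<tau>) \<phi> \<and>
     unit_normal A S3 (berger_metric \<kappa> \<tau>) \<phi> N \<and>
     constant_mean_curvature A S3 (berger_metric \<kappa> \<tau>) \<phi> N 0"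

text \<open>\<open>\<phi>'\<close> with unit normal \<open>N'\<close> is the sister immersion of the minimal immersion \<open>\<phi>\<close> with unit
  normal \<open>N\<close>. Here \<open>T\<close> is the coordinate expression of the tangent part of the vertical field.
  The rotation field \<open>J\<close> is an orientation of the surface, not tied to \<open>N\<close> by an orientation of
  the Berger sphere: both orientations are allowed, and the compatibility equations of the two
  immersions decide for which of them a sister exists.\<close>

definition sister_immersion ::
    "'a chart set \<Rightarrow> 'a surface_metric \<Rightarrow> 'a endomorphism_field \<Rightarrow> real \<Rightarrow> real \<Rightarrow> real
       \<Rightarrow> ('a \<Rightarrow> complex \<times> complex) \<Rightarrow> ('a \<Rightarrow> complex \<times> complex)
       \<Rightarrow> ('a \<Rightarrow> (real^3) \<times> real) \<Rightarrow> ('a \<Rightarrow> (real^3) \<times> real) \<Rightarrow> bool" where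
  "sister_immersion A h J \<epsilon> \<kappa> \<tau> \<phi> N \<phi>' N' \<longleftrightarrow>
     isometric_immersion A h (M2R \<epsilon>) (M2R_metric \<epsilon>) \<phi>' \<and>
     unit_normal A (M2R \<epsilon>) (M2R_metric \<epsilon>) \<phi>' N' \<and>
     constant_mean_curvature A (M2R \<epsilon>) (M2R_metric \<epsilon>) \<phi>' N' \<tau> \<and>
     (\<forall>(U, x)\<in>A. \<forall>u\<in>U. \<exists>S T \<nu>.
        shape_operator S3 (berger_metric \<kappa> \<tau>) \<phi> N x u S \<and>
        berger_vertical \<kappa> \<tau> (\<phi> (x u)) = differential (\<phi> \<circ> x) u T + \<nu> *\<^sub>R N (x u) \<and>
        shape_operator (M2R \<epsilon>) (M2R_metric \<epsilon>) \<phi>' N' x u (\<lambda>v. - J (U, x) u (S v) + \<tau> *\<^sub>R v) \<and>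
        (0, 1) = differential (\<phi>' \<circ> x) u (- J (U, x) u T) + \<nu> *\<^sub>R N' (x u))"

section \<open>The two kinds of symmetries\<close>

definition symmetry_around_horizontal_geodesic ::
    "'a set \<Rightarrow> real \<Rightarrow> real \<Rightarrow> ('a \<Rightarrow> complex \<times> complex) \<Rightarrow> ('a \<Rightarrow> 'a) \<Rightarrow> bool" where
  "symmetry_around_horizontal_geodesic M \<kappa> \<tau> \<phi> \<sigma> \<longleftrightarrow>
     (\<exists>\<gamma> \<rho>. horizontal_geodesic \<kappa> \<tau> \<gamma> \<and> geodesic_reflection S3 (berger_metric \<kappa> \<tau>) \<gamma> \<rho> \<and>
        (\<forall>p\<in>M. \<phi> (\<sigma> p) = \<rho> (\<phi> p)))"

definition symmetry_in_vertical_plane ::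
    "'a set \<Rightarrow> real \<Rightarrow> ('a \<Rightarrow> (real^3) \<times> real) \<Rightarrow> ('a \<Rightarrow> 'a) \<Rightarrow> bool" where
  "symmetry_in_vertical_plane M \<epsilon> \<phi>' \<sigma> \<longleftrightarrow>
     (\<exists>v. mink \<epsilon> v v = 1 \<and> (\<forall>p\<in>M. \<phi>' (\<sigma> p) = vertical_reflection \<epsilon> v (\<phi>' p)))"

end

theory Submission
  imports Defs
begin

text \<open>An isometry \<open>\<sigma>\<close> of the surface that extends to the reflection around a horizontal geodesic
  maps \<open>N\<close> to \<open>- N\<close> and \<open>\<xi>\<close> to \<open>- \<xi>\<close>; hence it preserves \<open>\<nu>\<close>, while \<open>S\<close> and \<open>T\<close> anticommute
  with \<open>d\<sigma>\<close>. As \<open>\<sigma>\<close> reverses the orientation, so does \<open>J\<close>, and therefore \<open>d\<sigma>\<close> preserves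
  \<open>S\<^sup>* = - J S + \<tau>\<close> and \<open>T\<^sup>* = - J T\<close>. The sister immersion and its composition with \<open>\<sigma>\<close> then
  have the same data and so differ by an ambient isometry, which is read off at a fixed point of
  \<open>\<sigma>\<close>: it is the reflection in a vertical plane. The converse reverses this argument; there the
  condition \<open>\<tau> \<noteq> 0\<close> excludes that \<open>\<sigma>\<close> exchanges the two sides of the surface.

  Rigidity is proved in the ambient \<open>\<real>\<^sup>4\<close>: an immersion gives a moving frame consisting of
  position, normal and tangent plane, and the data determine both its Gram matrix and its
  connection coefficients, so that the linear map from one frame to another with the same data is
  constant. In the Berger sphere geodesics satisfy a linear equation with constant coefficients,
  which identifies the geodesic reflections around horizontal geodesics with the antilinear
  reflections of \<open>\<complex>\<^sup>2\<close> in Lagrangian planes.\<close>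

section \<open>Calculus\<close>

text \<open>Both kinds of symmetry are compared with one intrinsic condition on \<sigma>: it
  reverses the orientation and satisfies \<open>reflects_data\<close>. The obstacle on the way from
  this condition to the Berger sphere is that the flat second fundamental form there contains
  pairings of tangent and normal vectors with i times one another. The data fix these only up to a
  sign, since the transition map between the frames is merely known to be orthogonal and to reverse
  the Hopf direction. The sign is constant by connectedness and is found at a fixed point of
  \<sigma>; this is the purpose of \<open>hopf_reversed\<close>. S, T and \<nu> are given pointwise,
  without smoothness, so they are never differentiated: only immersions and normals are, and
  connection coefficients are compared through scalar products with the frame. A geodesic reflection
  is given as a relation between points. Identifying it with a linear map takes two arguments:
  geodesics orthogonal to \<gamma> are flipped by the map, and every point is reached by one of
  them. The second rests on explicit geodesics and the intermediate value theorem.\<close>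

definition twice_differentiable_on ::
    "'u set \<Rightarrow> ('u::real_normed_vector \<Rightarrow> 'v::real_normed_vector) \<Rightarrow> bool" where
  "twice_differentiable_on U f \<longleftrightarrow>
     (\<forall>u\<in>U. f differentiable (at u) \<and> (\<forall>w. (\<lambda>u. differential f u w) differentiable (at u)))"

text \<open>Two derivatives suffice for the symmetry of second derivatives, and this weaker notion
  passes to compositions without an induction over the order.\<close>

lemma smooth_on_imp_twice_differentiable_on:
  assumes "smooth_on U f"
  shows "twice_differentiable_on U f"
proof -
  have "Ck_on (Suc (Suc 0)) f U"
    using assms by (simp only: smooth_on_def)
  then show ?thesis
    by (simp add: twice_differentiable_on_def)
qed

lemma has_derivative_differential:
  "f differentiable (at u) \<Longrightarrow> (f has_derivative differential f u) (at u)"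
  by (simp add: frechet_derivative_works)

text \<open>By the mean value theorem along v the second difference over a small parallelogram is s
  times the change of the derivative in direction v across the side s w. This change is controlled
  by differentiability of that derivative at the single point u.\<close>

lemma second_difference_bound:
  fixes f :: "'u::real_normed_vector \<Rightarrow> real"
  assumes "open U" "u \<in> U" and f: "\<And>x. x \<in> U \<Longrightarrow> f differentiable (at x)"
    and G: "((\<lambda>x. differential f x v) has_derivative G') (at u)" and e: "e > 0"
  shows "\<exists>\<delta>>0. \<forall>s. 0 < s \<and> s < \<delta> \<longrightarrow>
    \<bar>f (u + s *\<^sub>R v + s *\<^sub>R w) - f (u + s *\<^sub>R v) - f (u + s *\<^sub>R w) + f u - s\<^sup>2 * G' w\<bar>
       \<le> e * s\<^sup>2 * (2 * norm v + norm w)"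
proof -
  obtain r where r: "r > 0" "ball u r \<subseteq> U"
    using assms(1,2) openE by blast
  obtain d where d: "d > 0"
      "\<And>y. norm (y - u) < d \<Longrightarrow>
          \<bar>differential f y v - differential f u v - G' (y - u)\<bar> \<le> e * norm (y - u)"
    using G e unfolding has_derivative_at_alt by (auto simp: real_norm_def)
  have linG: "linear G'"
    using G has_derivative_linear by blast
  define m where "m = min r d"
  define \<delta> where "\<delta> = m / (norm v + norm w + 1)"
  have m: "m > 0"
    using r d by (simp add: m_def)
  have \<delta>: "\<delta> > 0"
    using m by (simp add: \<delta>_def add_nonneg_pos)
  have "\<bar>f (u + s *\<^sub>R v + s *\<^sub>R w) - f (u + s *\<^sub>R v) - f (u + s *\<^sub>R w) + f u - s\<^sup>2 * G' w\<bar>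
       \<le> e * s\<^sup>2 * (2 * norm v + norm w)" if s: "0 < s" "s < \<delta>" for s
  proof -
    have small: "norm (t *\<^sub>R v + s' *\<^sub>R w) < m" if "0 \<le> t" "t \<le> s" "0 \<le> s'" "s' \<le> s" for t s'
    proof -
      have "norm (t *\<^sub>R v + s' *\<^sub>R w) \<le> t * norm v + s' * norm w"
        using norm_triangle_ineq[of "t *\<^sub>R v" "s' *\<^sub>R w"] that by simp
      also have "\<dots> \<le> s * norm v + s * norm w"
        using that by (intro add_mono mult_right_mono) auto
      also have "\<dots> \<le> s * (norm v + norm w + 1)"
        using s by (simp add: algebra_simps)
      also have "\<dots> < \<delta> * (norm v + norm w + 1)"
        using s by (intro mult_strict_right_mono) (auto simp: add_nonneg_pos)
      also have "\<dots> = m"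
        unfolding \<delta>_def by (smt (verit) nonzero_eq_divide_eq norm_ge_zero)
      finally show ?thesis .
    qed
    have dd: "((\<lambda>t. f (u + t *\<^sub>R v + s' *\<^sub>R w)) has_real_derivative
        differential f (u + t *\<^sub>R v + s' *\<^sub>R w) v) (at t)"
      if "0 \<le> t" "t \<le> s" "0 \<le> s'" "s' \<le> s" for t s'
    proof -
      have "norm (t *\<^sub>R v + s' *\<^sub>R w) < r"
        using small[OF that] by (simp add: m_def)
      then have "u + (t *\<^sub>R v + s' *\<^sub>R w) \<in> ball u r"
        using dist_add_cancel[of u 0 "t *\<^sub>R v + s' *\<^sub>R w"]
        by (simp only: mem_ball add_0_right dist_0_norm)
      then have "u + t *\<^sub>R v + s' *\<^sub>R w \<in> U"
        using r(2) by (auto simp: add.assoc)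
      then have *: "(f has_derivative differential f (u + t *\<^sub>R v + s' *\<^sub>R w)) (at (u + t *\<^sub>R v + s' *\<^sub>R w))"
        using f has_derivative_differential by blast
      have lin: "linear (differential f (u + t *\<^sub>R v + s' *\<^sub>R w))"
        using * has_derivative_linear by blast
      have "((\<lambda>t. f (u + t *\<^sub>R v + s' *\<^sub>R w)) has_derivative
          (\<lambda>h. differential f (u + t *\<^sub>R v + s' *\<^sub>R w) (h *\<^sub>R v))) (at t)"
        by (rule has_derivative_compose[of "\<lambda>t. u + t *\<^sub>R v + s' *\<^sub>R w", OF _ *])
           (auto intro!: derivative_eq_intros)
      then show ?thesis
        by (simp add: has_field_derivative_def linear_scale[OF lin] mult_commute_abs)
    qed
    \<comment> \<open>The summand \<open>0 *\<^sub>R w\<close> lets \<open>dd\<close> apply on the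
      side \<open>s' = 0\<close> as well.\<close>
    define g where "g = (\<lambda>t. f (u + t *\<^sub>R v + s *\<^sub>R w) - f (u + t *\<^sub>R v + 0 *\<^sub>R w))"
    define g' where "g' = (\<lambda>t. differential f (u + t *\<^sub>R v + s *\<^sub>R w) v - differential f (u + t *\<^sub>R v + 0 *\<^sub>R w) v)"
    have "(g has_real_derivative g' t) (at t)" if "0 \<le> t" "t \<le> s" for t
      unfolding g_def g'_def using that s by (intro DERIV_diff dd) auto
    then obtain \<theta> where \<theta>: "0 < \<theta>" "\<theta> < s" "g s - g 0 = (s - 0) * g' \<theta>"
      using MVT2[of 0 s g g'] s by auto
    have "\<bar>g' \<theta> - G' (s *\<^sub>R w)\<bar> \<le> e * norm (\<theta> *\<^sub>R v + s *\<^sub>R w) + e * norm (\<theta> *\<^sub>R v + 0 *\<^sub>R w)"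
      using d(2)[of "u + \<theta> *\<^sub>R v + s *\<^sub>R w"] d(2)[of "u + \<theta> *\<^sub>R v + 0 *\<^sub>R w"]
        small[of \<theta> s] small[of \<theta> 0] \<theta> s
      by (simp add: g'_def m_def linear_add[OF linG] linear_scale[OF linG] add.assoc)
    also have "\<dots> \<le> e * (s * norm v + s * norm w) + e * (s * norm v)"
      using \<theta> s e by (intro add_mono mult_left_mono norm_triangle_le) (auto intro!: mult_right_mono)
    also have "\<dots> = e * s * (2 * norm v + norm w)"
      by (simp add: algebra_simps)
    finally have "s * \<bar>g' \<theta> - G' (s *\<^sub>R w)\<bar> \<le> s * (e * s * (2 * norm v + norm w))"
      using s by simp
    moreover have "g s - g 0 - s\<^sup>2 * G' w = s * (g' \<theta> - G' (s *\<^sub>R w))"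
      using \<theta>(3) by (simp add: linear_scale[OF linG] algebra_simps power2_eq_square)
    ultimately have "\<bar>g s - g 0 - s\<^sup>2 * G' w\<bar> \<le> e * s\<^sup>2 * (2 * norm v + norm w)"
      using s by (simp add: abs_mult power2_eq_square mult_ac)
    then show ?thesis
      by (simp add: g_def algebra_simps)
  qed
  then show ?thesis
    using \<delta> by blast
qed

text \<open>The second difference is symmetric in v and w, and s^2 times either mixed derivative
  approximates it.\<close>

lemma second_differential_symmetric_real:
  fixes f :: "'u::real_normed_vector \<Rightarrow> real"
  assumes "open U" "u \<in> U" and f: "twice_differentiable_on U f"
  shows "differential (\<lambda>x. differential f x w) u v = differential (\<lambda>x. differential f x v) u w"
    (is "?a = ?b")
proof (rule ccontr)
  assume ne: "?a \<noteq> ?b"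
  \<comment> \<open>K exceeds the sum of the two error weights, 3 (norm v + norm w), and is
    positive; e then makes the total error half of the supposed gap.\<close>
  define K where "K = 3 * norm v + 3 * norm w + 1"
  define e where "e = \<bar>?a - ?b\<bar> / (2 * K)"
  have K: "K > 0"
    by (simp add: K_def add_nonneg_pos)
  then have e: "e > 0"
    using ne by (simp add: e_def)
  have df: "\<And>x. x \<in> U \<Longrightarrow> f differentiable (at x)"
    and d: "\<And>v. ((\<lambda>x. differential f x v) has_derivative differential (\<lambda>x. differential f x v) u) (at u)"
    using f assms(2) by (auto simp: twice_differentiable_on_def intro: has_derivative_differential)
  obtain \<delta>1 \<delta>2 where \<delta>: "\<delta>1 > 0" "\<delta>2 > 0"
    and 1: "\<And>s. 0 < s \<Longrightarrow> s < \<delta>1 \<Longrightarrow> 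
    \<bar>f (u + s *\<^sub>R v + s *\<^sub>R w) - f (u + s *\<^sub>R v) - f (u + s *\<^sub>R w) + f u - s\<^sup>2 * ?b\<bar>
       \<le> e * s\<^sup>2 * (2 * norm v + norm w)"
    and 2: "\<And>s. 0 < s \<Longrightarrow> s < \<delta>2 \<Longrightarrow> 
    \<bar>f (u + s *\<^sub>R w + s *\<^sub>R v) - f (u + s *\<^sub>R w) - f (u + s *\<^sub>R v) + f u - s\<^sup>2 * ?a\<bar>
       \<le> e * s\<^sup>2 * (2 * norm w + norm v)"
    using second_difference_bound[OF assms(1,2) df d e, of v w]
      second_difference_bound[OF assms(1,2) df d e, of w v] by blast
  define s where "s = min \<delta>1 \<delta>2 / 2"
  have s: "0 < s" "s < \<delta>1" "s < \<delta>2"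
    using \<delta> by (auto simp: s_def)
  define X where "X = f (u + s *\<^sub>R v + s *\<^sub>R w) - f (u + s *\<^sub>R v) - f (u + s *\<^sub>R w) + f u"
  have "\<bar>X - s\<^sup>2 * ?b\<bar> \<le> e * s\<^sup>2 * (2 * norm v + norm w)"
    using 1[OF s(1,2)] by (simp add: X_def)
  moreover have "X = f (u + s *\<^sub>R w + s *\<^sub>R v) - f (u + s *\<^sub>R w) - f (u + s *\<^sub>R v) + f u"
    by (simp add: X_def algebra_simps)
  then have "\<bar>X - s\<^sup>2 * ?a\<bar> \<le> e * s\<^sup>2 * (2 * norm w + norm v)"
    using 2[OF s(1,3)] by simp
  ultimately have "\<bar>s\<^sup>2 * ?a - s\<^sup>2 * ?b\<bar> \<le> e * s\<^sup>2 * (2 * norm v + norm w) + e * s\<^sup>2 * (2 * norm w + norm v)"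
    by linarith
  also have "\<dots> \<le> e * s\<^sup>2 * K"
    using e s by (simp add: K_def algebra_simps)
  finally have "s\<^sup>2 * \<bar>?a - ?b\<bar> \<le> s\<^sup>2 * (e * K)"
    by (simp add: abs_mult right_diff_distrib[symmetric] mult_ac)
  then have "\<bar>?a - ?b\<bar> \<le> e * K"
    using s by simp
  also have "\<dots> = \<bar>?a - ?b\<bar> / 2"
    using K by (simp add: e_def)
  finally show False
    using ne by simp
qed

section \<open>Differentials under linear maps and under local equality\<close>

lemma differential_linear_compose:
  assumes "bounded_linear L" "f differentiable (at u)"
  shows "(\<lambda>x. L (f x)) differentiable (at u)"
    and "differential (\<lambda>x. L (f x)) u = (\<lambda>v. L (differential f u v))"
proof -
  have *: "((\<lambda>x. L (f x)) has_derivative (\<lambda>v. L (differential f u v))) (at u)"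
    by (rule bounded_linear.has_derivative[OF assms(1)]) (rule has_derivative_differential[OF assms(2)])
  then show "(\<lambda>x. L (f x)) differentiable (at u)" "differential (\<lambda>x. L (f x)) u = (\<lambda>v. L (differential f u v))"
    by (auto simp: differentiable_def frechet_derivative_at[symmetric])
qed

lemma differential_cong_open:
  assumes "open U" "u \<in> U" "\<And>x. x \<in> U \<Longrightarrow> f x = g x"
  shows "differential f u = differential g u"
proof -
  have "(f has_derivative D) (at u) \<longleftrightarrow> (g has_derivative D) (at u)" for D
    using has_derivative_transform_within_open[OF _ assms(1,2), of f D UNIV g]
      has_derivative_transform_within_open[OF _ assms(1,2), of g D UNIV f] assms(3) by auto
  then show ?thesis
    by (simp add: frechet_derivative_def)
qed

lemma differentiable_cong_open:
  assumes "open U" "u \<in> U" "\<And>x. x \<in> U \<Longrightarrow> f x = g x" "f differentiable (at u)"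
  shows "g differentiable (at u)"
  using has_derivative_transform_within_open[OF _ assms(1,2), of f _ UNIV g] assms(3,4)
  by (auto simp: differentiable_def)

lemma twice_differentiable_on_cong:
  assumes "open U" "\<And>x. x \<in> U \<Longrightarrow> f x = g x" "twice_differentiable_on U f"
  shows "twice_differentiable_on U g"
  unfolding twice_differentiable_on_def
proof (intro ballI conjI allI)
  fix u w assume u: "u \<in> U"
  show "g differentiable at u"
    using differentiable_cong_open[OF assms(1) u, of f g] assms u by (auto simp: twice_differentiable_on_def)
  have "differential f x w = differential g x w" if "x \<in> U" for x
    using differential_cong_open[OF assms(1) that, of f g] assms(2) by auto
  then show "(\<lambda>u. differential g u w) differentiable at u"
    using differentiable_cong_open[OF assms(1) u, of "\<lambda>x. differential f x w"] assms(3) u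
    by (auto simp: twice_differentiable_on_def)
qed

lemma twice_differentiable_on_linear_compose:
  assumes "open U" "bounded_linear L" "twice_differentiable_on U f"
  shows "twice_differentiable_on U (\<lambda>x. L (f x))"
  unfolding twice_differentiable_on_def
proof (intro ballI conjI allI)
  fix u w assume u: "u \<in> U"
  show "(\<lambda>x. L (f x)) differentiable at u"
    using assms(3) u by (intro differential_linear_compose(1)[OF assms(2)]) (auto simp: twice_differentiable_on_def)
  have "L (differential f x w) = differential (\<lambda>x. L (f x)) x w" if "x \<in> U" for x
    using differential_linear_compose(2)[OF assms(2), of f x] assms(3) that
    by (auto simp: twice_differentiable_on_def)
  moreover have "(\<lambda>x. L (differential f x w)) differentiable at u"
    using assms(3) u by (intro differential_linear_compose(1)[OF assms(2)]) (auto simp: twice_differentiable_on_def)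
  ultimately show "(\<lambda>u. differential (\<lambda>x. L (f x)) u w) differentiable at u"
    using differentiable_cong_open[OF assms(1) u, of "\<lambda>x. L (differential f x w)"] by simp
qed

lemma second_differential_symmetric:
  fixes f :: "'u::real_normed_vector \<Rightarrow> 'e::euclidean_space"
  assumes "open U" "u \<in> U" "twice_differentiable_on U f"
  shows "differential (\<lambda>x. differential f x w) u v = differential (\<lambda>x. differential f x v) u w"
proof (rule euclidean_eqI)
  fix b :: 'e assume "b \<in> Basis"
  have bl: "bounded_linear (\<lambda>y. y \<bullet> b)"
    by (rule bounded_linear_inner_left)
  have *: "differential (\<lambda>x. differential (\<lambda>x. f x \<bullet> b) x w) u v = differential (\<lambda>x. differential f x w) u v \<bullet> b" for v w
  proof -
    have "differential (\<lambda>x. differential (\<lambda>x. f x \<bullet> b) x w) u = differential (\<lambda>x. differential f x w \<bullet> b) u"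
      using differential_linear_compose(2)[OF bl, of f] assms
      by (intro differential_cong_open[OF assms(1,2)]) (auto simp: twice_differentiable_on_def)
    also have "\<dots> = (\<lambda>v. differential (\<lambda>x. differential f x w) u v \<bullet> b)"
      using assms by (intro differential_linear_compose(2)[OF bl]) (auto simp: twice_differentiable_on_def)
    finally show ?thesis
      by simp
  qed
  show "differential (\<lambda>x. differential f x w) u v \<bullet> b = differential (\<lambda>x. differential f x v) u w \<bullet> b"
    using second_differential_symmetric_real[OF assms(1,2) twice_differentiable_on_linear_compose[OF assms(1) bl assms(3)]]
    by (simp add: *)
qed

section \<open>Families of linear maps and transport of frames\<close>

lemma linear_expand_Basis:
  fixes c :: "'k::euclidean_space"
  assumes "linear f"
  shows "f c = (\<Sum>b\<in>Basis. (c \<bullet> b) *\<^sub>R f b)"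
proof -
  have "f c = f (\<Sum>b\<in>Basis. (c \<bullet> b) *\<^sub>R b)"
    by (simp add: euclidean_representation)
  also have "\<dots> = (\<Sum>b\<in>Basis. (c \<bullet> b) *\<^sub>R f b)"
    by (simp only: linear_sum[OF assms] linear_scale[OF assms])
  finally show ?thesis .
qed

text \<open>Differentiability of the family is known only for each fixed argument; expanding c in a
  basis reduces the product rule to finitely many such terms.\<close>

lemma has_derivative_linear_family:
  fixes F :: "'u::real_normed_vector \<Rightarrow> 'k::euclidean_space \<Rightarrow> 'e::real_normed_vector"
  assumes "open W" "u \<in> W" "\<And>x. x \<in> W \<Longrightarrow> linear (F x)"
    and F: "\<And>k. ((\<lambda>x. F x k) has_derivative (\<lambda>v. F' v k)) (at u)"
    and F': "\<And>v. linear (F' v :: 'k \<Rightarrow> 'e)"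
    and c: "(c has_derivative c') (at u)"
  shows "((\<lambda>x. F x (c x)) has_derivative (\<lambda>v. F' v (c u) + F u (c' v))) (at u)"
proof -
  have "((\<lambda>x. \<Sum>b\<in>Basis. (c x \<bullet> b) *\<^sub>R F x b) has_derivative
      (\<lambda>v. \<Sum>b\<in>Basis. (c u \<bullet> b) *\<^sub>R F' v b + (c' v \<bullet> b) *\<^sub>R F u b)) (at u)"
    by (intro has_derivative_sum has_derivative_scaleR has_derivative_inner_left F c)
  moreover have "(\<Sum>b\<in>Basis. (c u \<bullet> b) *\<^sub>R F' v b + (c' v \<bullet> b) *\<^sub>R F u b) = F' v (c u) + F u (c' v)" for v
    using linear_expand_Basis[OF F'[of v], of "c u"] linear_expand_Basis[of "F u" "c' v"] assms(2,3)
    by (simp add: sum.distrib)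
  moreover have "F x (c x) = (\<Sum>b\<in>Basis. (c x \<bullet> b) *\<^sub>R F x b)" if "x \<in> W" for x
    using linear_expand_Basis[of "F x" "c x"] assms(3) that by simp
  ultimately show ?thesis
    by (auto intro: has_derivative_transform_within_open[OF _ assms(1,2)])
qed

text \<open>The factor g is o(norm (x - u)), so a bounded coefficient does no harm, even a
  discontinuous one. In the transport of frames, boundedness is all that has to be shown about the
  coordinates c.\<close>

lemma has_derivative_zero_scaleR_bounded:
  fixes g :: "'u::real_normed_vector \<Rightarrow> 'e::real_normed_vector"
  assumes g: "(g has_derivative (\<lambda>_. 0)) (at u)" "g u = 0"
    and b: "eventually (\<lambda>x. \<bar>b x\<bar> \<le> K) (at u)"
  shows "((\<lambda>x. b x *\<^sub>R g x) has_derivative (\<lambda>_. 0)) (at u)"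
proof -
  have *: "((\<lambda>x. norm (g x) / norm (x - u)) \<longlongrightarrow> 0) (at u)"
    using g by (simp add: has_derivative_iff_norm)
  have "((\<lambda>x. norm (b x *\<^sub>R g x) / norm (x - u)) \<longlongrightarrow> 0) (at u)"
  proof (rule Lim_null_comparison)
    show "((\<lambda>x. K * (norm (g x) / norm (x - u))) \<longlongrightarrow> 0) (at u)"
      using tendsto_mult_right_zero[OF *, of K] by simp
    show "\<forall>\<^sub>F x in at u. norm (norm (b x *\<^sub>R g x) / norm (x - u)) \<le> K * (norm (g x) / norm (x - u))"
      using b by eventually_elim (auto intro!: divide_right_mono mult_right_mono)
  qed
  then show ?thesis
    by (simp add: has_derivative_iff_norm g)
qed

text \<open>The map taking one frame to the other is constant when both frames satisfy the same
  differential equation; it is evaluated here at the fixed vector \<open>z\<close>.\<close>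

lemma frame_transport_derivative:
  fixes F\<^sub>1 F\<^sub>2 :: "'u::real_normed_vector \<Rightarrow> 'k::euclidean_space \<Rightarrow> 'e::euclidean_space"
  assumes W: "open W" "u \<in> W"
    and lin: "\<And>x. x \<in> W \<Longrightarrow> linear (F\<^sub>1 x)" "\<And>x. x \<in> W \<Longrightarrow> linear (F\<^sub>2 x)"
    and inj: "inj (F\<^sub>1 u)"
    and d1: "\<And>k. ((\<lambda>x. F\<^sub>1 x k) has_derivative (\<lambda>v. F\<^sub>1 u (\<Omega> v k))) (at u)"
    and d2: "\<And>k. ((\<lambda>x. F\<^sub>2 x k) has_derivative (\<lambda>v. F\<^sub>2 u (\<Omega> v k))) (at u)"
    and c: "\<And>x. x \<in> W \<Longrightarrow> F\<^sub>1 x (c x) = z"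
  shows "((\<lambda>x. F\<^sub>2 x (c x)) has_derivative (\<lambda>_. 0)) (at u)"
proof -
  obtain g where g: "linear g" "\<And>k. g (F\<^sub>1 u k) = k"
    using linear_injective_left_inverse[OF lin(1)[OF W(2)] inj] by (auto simp: fun_eq_iff)
  \<comment> \<open>G is the transition map frozen at u. As
    \<open>F\<^sub>2 x (c x) = G z + H x (c x)\<close> and each \<open>H x k\<close> vanishes at u
    to first order, what remains is boundedness of c near u.\<close>
  define G where "G = (\<lambda>y. F\<^sub>2 u (g y))"
  have G: "linear G"
    using linear_compose[OF g(1) lin(2)[OF W(2)]] by (simp add: G_def o_def)
  define H where "H = (\<lambda>x k. F\<^sub>2 x k - G (F\<^sub>1 x k))"
  have H0: "H u k = 0" for k
    by (simp add: H_def G_def g)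
  have dH: "((\<lambda>x. H x k) has_derivative (\<lambda>_. 0)) (at u)" for k
  proof -
    have "((\<lambda>x. H x k) has_derivative (\<lambda>v. F\<^sub>2 u (\<Omega> v k) - G (F\<^sub>1 u (\<Omega> v k)))) (at u)"
      unfolding H_def using G
      by (intro has_derivative_diff d2 bounded_linear.has_derivative[OF _ d1])
         (simp add: linear_conv_bounded_linear)
    then show ?thesis
      by (simp add: G_def g)
  qed
  \<comment> \<open>Injectivity of the frame at u gives the lower bound B. Nearby the frame differs
    from it by less than B / 2, which bounds the coordinates by 2 norm z / B.\<close>
  obtain B where B: "B > 0" "\<And>k. B * norm k \<le> norm (F\<^sub>1 u k)"
    using linear_inj_bounded_below_pos[OF lin(1)[OF W(2)] inj] by metis
  define \<eta> where "\<eta> = (\<lambda>x. \<Sum>b\<in>Basis. norm (F\<^sub>1 x b - F\<^sub>1 u b))"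
  have "isCont (\<lambda>x. F\<^sub>1 x b) u" for b
    using d1 has_derivative_continuous by blast
  then have "isCont \<eta> u"
    unfolding \<eta>_def by (intro continuous_intros) auto
  then have "(\<eta> \<longlongrightarrow> 0) (at u)"
    unfolding isCont_def by (simp add: \<eta>_def)
  then have "\<forall>\<^sub>F x in at u. \<eta> x < B / 2"
    using B(1) by (intro order_tendstoD) auto
  moreover have "\<forall>\<^sub>F x in at u. x \<in> W"
    using W by (rule eventually_at_in_open')
  ultimately have bdd: "\<forall>\<^sub>F x in at u. norm (c x) \<le> 2 * norm z / B"
  proof eventually_elim
    case (elim x)
    have "norm (F\<^sub>1 x (c x) - F\<^sub>1 u (c x)) = norm (\<Sum>b\<in>Basis. (c x \<bullet> b) *\<^sub>R (F\<^sub>1 x b - F\<^sub>1 u b))"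
      using linear_expand_Basis[OF lin(1)[OF elim(2)], of "c x"] linear_expand_Basis[OF lin(1)[OF W(2)], of "c x"]
      by (simp add: sum_subtractf algebra_simps)
    also have "\<dots> \<le> (\<Sum>b\<in>Basis. norm (c x) * norm (F\<^sub>1 x b - F\<^sub>1 u b))"
      by (intro sum_norm_le) (auto intro!: mult_right_mono Basis_le_norm)
    also have "\<dots> = norm (c x) * \<eta> x"
      by (simp add: \<eta>_def sum_distrib_left)
    also have "\<dots> \<le> norm (c x) * (B / 2)"
      using elim by (intro mult_left_mono) auto
    finally have "norm (z - F\<^sub>1 u (c x)) \<le> norm (c x) * (B / 2)"
      using c elim by simp
    moreover have "B * norm (c x) \<le> norm z + norm (z - F\<^sub>1 u (c x))"
      using B(2)[of "c x"] norm_triangle_ineq4[of z "z - F\<^sub>1 u (c x)"] by simp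
    ultimately show ?case
      using B(1) by (simp add: field_simps)
  qed
  have "((\<lambda>x. (c x \<bullet> b) *\<^sub>R H x b) has_derivative (\<lambda>_. 0)) (at u)" if "b \<in> Basis" for b
    using that by (intro has_derivative_zero_scaleR_bounded[OF dH H0, where K = "2 * norm z / B"]
        eventually_mono[OF bdd]) (auto intro: order_trans[OF Basis_le_norm])
  then have "((\<lambda>x. G z + (\<Sum>b\<in>Basis. (c x \<bullet> b) *\<^sub>R H x b)) has_derivative (\<lambda>v. 0 + (\<Sum>b\<in>(Basis::'k set). 0))) (at u)"
    by (intro has_derivative_add has_derivative_const has_derivative_sum)
  moreover have "G z + (\<Sum>b\<in>Basis. (c x \<bullet> b) *\<^sub>R H x b) = F\<^sub>2 x (c x)" if "x \<in> W" for x
  proof -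
    have "linear (H x)"
      unfolding H_def using linear_compose[OF lin(1)[OF that] G] lin(2)[OF that]
      by (intro linear_compose_sub) (auto simp: o_def)
    then have "(\<Sum>b\<in>Basis. (c x \<bullet> b) *\<^sub>R H x b) = H x (c x)"
      using linear_expand_Basis by metis
    then show ?thesis
      using c[OF that] by (simp add: H_def)
  qed
  ultimately show ?thesis
    using has_derivative_transform_within_open[OF _ W] by force
qed

lemma twice_differentiable_on_compose:
  fixes f :: "'k::euclidean_space \<Rightarrow> 'e::real_normed_vector" and s :: "'u::real_normed_vector \<Rightarrow> 'k"
  assumes "open W" "open V" "\<And>x. x \<in> W \<Longrightarrow> s x \<in> V"
    and s: "twice_differentiable_on W s" and f: "twice_differentiable_on V f"
  shows "twice_differentiable_on W (\<lambda>x. f (s x))"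
    and "x \<in> W \<Longrightarrow> differential (\<lambda>x. f (s x)) x = (\<lambda>v. differential f (s x) (differential s x v))"
proof -
  have ds: "(s has_derivative differential s x) (at x)"
    and dds: "\<And>w. ((\<lambda>x. differential s x w) has_derivative differential (\<lambda>x. differential s x w) x) (at x)" 
    if "x \<in> W" for x
    using that s by (auto simp: twice_differentiable_on_def intro: has_derivative_differential)
  have df: "(f has_derivative differential f y) (at y)" 
    and ddf: "\<And>w. ((\<lambda>y. differential f y w) has_derivative differential (\<lambda>y. differential f y w) y) (at y)" 
    if "y \<in> V" for y
    using that f by (auto simp: twice_differentiable_on_def intro: has_derivative_differential)
  have d: "((\<lambda>x. f (s x)) has_derivative (\<lambda>v. differential f (s x) (differential s x v))) (at x)" if "x \<in> W" for x
    using has_derivative_compose[OF ds[OF that] df] assms(3) that by simp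
  then show D: "differential (\<lambda>x. f (s x)) x = (\<lambda>v. differential f (s x) (differential s x v))" if "x \<in> W" for x
    using that by (metis frechet_derivative_at)
  show "twice_differentiable_on W (\<lambda>x. f (s x))"
    unfolding twice_differentiable_on_def
  proof (intro ballI conjI allI)
    fix x w assume x: "x \<in> W"
    show "(\<lambda>x. f (s x)) differentiable at x"
      using d[OF x] by (auto simp: differentiable_def)
    have lf: "linear (differential f (s x))" if "x \<in> W" for x
      using df assms(3) that has_derivative_linear by blast
    define F' where "F' = (\<lambda>v k. differential (\<lambda>y. differential f y k) (s x) (differential s x v))"
    have F: "((\<lambda>x. differential f (s x) k) has_derivative (\<lambda>v. F' v k)) (at x)" for k
      unfolding F'_def using has_derivative_compose[OF ds[OF x] ddf] assms(3) x by simp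
    \<comment> \<open>Differentiability for each k separately does not contain linearity in k. It
      follows from uniqueness of derivatives, since \<open>differential f (s x)\<close> is linear
      for every x in W.\<close>
    have "linear (F' v)" for v
    proof (rule linearI)
      fix a b :: 'k and r :: real
      have "((\<lambda>x. differential f (s x) (a + b)) has_derivative (\<lambda>v. F' v a + F' v b)) (at x)"
        by (rule has_derivative_transform_within_open[OF has_derivative_add[OF F F] assms(1) x])
           (simp add: linear_add[OF lf])
      then have "(\<lambda>v. F' v a + F' v b) = (\<lambda>v. F' v (a + b))"
        using F has_derivative_unique by blast
      then show "F' v (a + b) = F' v a + F' v b"
        by metis
      have "((\<lambda>x. differential f (s x) (r *\<^sub>R a)) has_derivative (\<lambda>v. r *\<^sub>R F' v a)) (at x)"
        by (rule has_derivative_transform_within_open[OF has_derivative_scaleR_right[OF F] assms(1) x])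
           (simp add: linear_scale[OF lf])
      then have "(\<lambda>v. r *\<^sub>R F' v a) = (\<lambda>v. F' v (r *\<^sub>R a))"
        using F has_derivative_unique by blast
      then show "F' v (r *\<^sub>R a) = r *\<^sub>R F' v a"
        by metis
    qed
    then have "(\<lambda>x. differential f (s x) (differential s x w)) differentiable at x"
      using has_derivative_linear_family[OF assms(1) x lf F _ dds[OF x]] by (auto simp: differentiable_def)
    then show "(\<lambda>x. differential (\<lambda>x. f (s x)) x w) differentiable at x"
      using differentiable_cong_open[OF assms(1) x, of "\<lambda>x. differential f (s x) (differential s x w)"] D by force
  qed
qed

lemma isCont_linear_family:
  fixes F :: "'u::real_normed_vector \<Rightarrow> 'k::euclidean_space \<Rightarrow> 'e::real_normed_vector"
  assumes "open W" "u \<in> W" "\<And>x. x \<in> W \<Longrightarrow> linear (F x)"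
    and F: "\<And>k. isCont (\<lambda>x. F x k) u" and c: "isCont c u"
  shows "isCont (\<lambda>x. F x (c x)) u"
proof -
  have "isCont (\<lambda>x. \<Sum>b\<in>Basis. (c x \<bullet> b) *\<^sub>R F x b) u"
    by (intro continuous_intros F c)
  moreover have "\<forall>\<^sub>F x in nhds u. (\<Sum>b\<in>Basis. (c x \<bullet> b) *\<^sub>R F x b) = F x (c x)"
    using linear_expand_Basis[OF assms(3)] assms(1,2)
    by (intro eventually_nhds_in_open[THEN eventually_mono]) auto
  ultimately show ?thesis
    using isCont_cong by fast
qed

text \<open>Exactly one of \<open>e\<^sub>1\<close>, \<open>e\<^sub>2\<close> vanishes at each point
  of D, so either alternative amounts to the non-vanishing of a function continuous at u. The signs
  that are later spread by connectedness (of orientation, normal and Hopf field) get their local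
  constancy here.\<close>

lemma locally_constant_dichotomy:
  fixes e\<^sub>1 e\<^sub>2 :: "'u::t2_space \<Rightarrow> 'e::real_normed_vector"
  assumes D: "open D" "u \<in> D" and cont: "isCont e\<^sub>1 u" "isCont e\<^sub>2 u"
    and P: "\<And>x. x \<in> D \<Longrightarrow> P x \<longleftrightarrow> e\<^sub>1 x = 0" "\<And>x. x \<in> D \<Longrightarrow> e\<^sub>1 x = 0 \<longleftrightarrow> e\<^sub>2 x \<noteq> 0"
  shows "\<exists>W. open W \<and> u \<in> W \<and> W \<subseteq> D \<and> (\<forall>x\<in>W. P x \<longleftrightarrow> P u)"
proof -
  have nonzero: "\<exists>W. open W \<and> u \<in> W \<and> (\<forall>x\<in>W. e x \<noteq> 0)"
    if "isCont e u" "e u \<noteq> 0" for e :: "'u \<Rightarrow> 'e"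
  proof -
    have "(e \<longlongrightarrow> e u) (nhds u)"
      using that(1) by (simp add: isCont_def tendsto_at_iff_tendsto_nhds)
    from tendsto_imp_eventually_ne[OF this that(2)] show ?thesis
      unfolding eventually_nhds .
  qed
  have "\<exists>W. open W \<and> u \<in> W \<and> (\<forall>x\<in>W \<inter> D. P x \<longleftrightarrow> P u)"
  proof (cases "e\<^sub>1 u = 0")
    case True
    then show ?thesis
      using nonzero[OF cont(2)] P D(2) by (metis IntD1 IntD2)
  next
    case False
    then show ?thesis
      using nonzero[OF cont(1)] P D(2) by (metis IntD1 IntD2)
  qed
  then show ?thesis
    using D by (metis IntI Int_lower2 open_Int)
qed

section \<open>Inner products and rotations of the plane\<close>

definition inner_form :: "('v::real_vector \<Rightarrow> 'v \<Rightarrow> real) \<Rightarrow> bool" where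
  "inner_form g \<longleftrightarrow> bilinear g \<and> (\<forall>v w. g v w = g w v) \<and> (\<forall>v. v \<noteq> 0 \<longrightarrow> g v v > 0)"

definition rotation_of :: "('v::real_vector \<Rightarrow> 'v \<Rightarrow> real) \<Rightarrow> ('v \<Rightarrow> 'v) \<Rightarrow> bool" where
  "rotation_of g J \<longleftrightarrow> linear J \<and> (\<forall>v. g (J v) (J v) = g v v \<and> g (J v) v = 0)"

lemma inner_form_simps:
  assumes "inner_form g"
  shows "g (x + y) z = g x z + g y z" "g x (y + z) = g x y + g x z"
    "g (x - y) z = g x z - g y z" "g x (y - z) = g x y - g x z"
    "g (- x) y = - g x y" "g x (- y) = - g x y"
    "g (r *\<^sub>R x) y = r * g x y" "g x (r *\<^sub>R y) = r * g x y" "g 0 y = 0" "g x 0 = 0"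
proof -
  have b: "bilinear g"
    using assms by (simp add: inner_form_def)
  note b_simps = bilinear_ladd[OF b] bilinear_radd[OF b] bilinear_lsub[OF b] bilinear_rsub[OF b]
    bilinear_lneg[OF b] bilinear_rneg[OF b] bilinear_lmul[OF b] bilinear_rmul[OF b]
    bilinear_lzero[OF b] bilinear_rzero[OF b]
  show "g (x + y) z = g x z + g y z" "g x (y + z) = g x y + g x z"
    "g (x - y) z = g x z - g y z" "g x (y - z) = g x y - g x z"
    "g (- x) y = - g x y" "g x (- y) = - g x y"
    "g (r *\<^sub>R x) y = r * g x y" "g x (r *\<^sub>R y) = r * g x y" "g 0 y = 0" "g x 0 = 0"
    by (simp_all add: b_simps)
qed

lemma inner_form_sym: "inner_form g \<Longrightarrow> g x y = g y x"
  by (auto simp: inner_form_def)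

lemma inner_form_eq_0_iff: "inner_form g \<Longrightarrow> g x x = 0 \<longleftrightarrow> x = 0"
  using inner_form_simps(9)[of g] by (metis inner_form_def less_irrefl)

lemma inner_form_eqI:
  assumes "inner_form g" "\<And>z. g x z = g y z"
  shows "x = y"
  using inner_form_eq_0_iff[OF assms(1), of "x - y"] assms(2)[of "x - y"]
  by (simp add: inner_form_simps[OF assms(1)])

lemma rotation_of_skew:
  assumes g: "inner_form g" and "rotation_of g J"
  shows "g (J v) w = - g v (J w)"
proof -
  have J: "linear J" "\<And>v. g (J v) v = 0"
    using assms(2) by (auto simp: rotation_of_def)
  have "g (J (v + w)) (v + w) = 0"
    by (rule J)
  then show ?thesis
    using J(2)[of v] J(2)[of w]
    by (simp add: linear_add[OF J(1)] inner_form_simps[OF g] inner_form_sym[OF g, of v])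
qed

lemma rotation_of_isometry:
  assumes g: "inner_form g" and "rotation_of g J"
  shows "g (J v) (J w) = g v w"
proof -
  have J: "linear J" "\<And>v. g (J v) (J v) = g v v"
    using assms(2) by (auto simp: rotation_of_def)
  have "g (J (v + w)) (J (v + w)) = g (v + w) (v + w)"
    by (rule J)
  then show ?thesis
    by (simp add: linear_add[OF J(1)] inner_form_simps[OF g] inner_form_sym[OF g, of w v]
        inner_form_sym[OF g, of "J w" "J v"] J(2))
qed

lemma rotation_of_square:
  assumes g: "inner_form g" and J: "rotation_of g J"
  shows "J (J v) = - v"
  by (rule inner_form_eqI[OF g])
     (subst rotation_of_skew[OF g J], simp add: rotation_of_isometry[OF g J] inner_form_simps[OF g])

lemma rotation_of_basis:
  fixes w v :: "real^2"
  assumes g: "inner_form g" and J: "rotation_of g J" and w: "w \<noteq> 0"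
  shows "\<exists>a b. v = a *\<^sub>R w + b *\<^sub>R J w"
proof -
  define f where "f = (\<lambda>e::real^2. e$1 *\<^sub>R w + e$2 *\<^sub>R J w)"
  have f: "linear f"
    by (rule linearI) (simp_all add: f_def algebra_simps)
  have Jw: "g (J w) w = 0" "g w (J w) = 0" "g (J w) (J w) = g w w"
    using J inner_form_sym[OF g, of w "J w"] by (auto simp: rotation_of_def)
  have ww: "g w w \<noteq> 0"
    using w by (simp add: inner_form_eq_0_iff[OF g])
  have "e = 0" if "f e = 0" for e
  proof -
    have "g (f e) w = 0" "g (f e) (J w) = 0"
      using that by (simp_all add: inner_form_simps[OF g])
    then have "e$1 = 0" "e$2 = 0"
      using ww by (simp_all add: f_def inner_form_simps[OF g] Jw)
    then show ?thesis
      by (simp add: vec_eq_iff forall_2)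
  qed
  then have "inj f"
    using f linear_injective_0 by blast
  then have "surj f"
    using f linear_injective_imp_surjective by blast
  then obtain e where "v = f e"
    by (metis surjD)
  then show ?thesis
    by (auto simp: f_def)
qed

text \<open>The vector L (J w) is orthogonal to L w and of the same length, hence J' (L w) up to
  sign; as J and J' square to -1, the sign at w holds on the basis w, J w. Both signs occur because
  \<open>rotation_of\<close> leaves the sense of rotation open.\<close>

lemma isometry_rotation_sign:
  fixes L :: "real^2 \<Rightarrow> real^2"
  assumes g: "inner_form g" and J: "rotation_of g J" and g': "inner_form g'" and J': "rotation_of g' J'"
    and L: "linear L" "\<And>v w. g' (L v) (L w) = g v w"
  shows "\<exists>s. (s = 1 \<or> s = -1) \<and> (\<forall>v. L (J v) = s *\<^sub>R J' (L v))"
proof -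
  define w where "w = axis (1::2) (1::real)"
  have w: "w \<noteq> 0"
    by (simp add: w_def)
  have ww: "g w w \<noteq> 0"
    using w by (simp add: inner_form_eq_0_iff[OF g])
  then have Lw: "L w \<noteq> 0"
    using L(2)[of w w] by (auto simp: inner_form_simps[OF g'])
  obtain a b where ab: "L (J w) = a *\<^sub>R L w + b *\<^sub>R J' (L w)"
    using rotation_of_basis[OF g' J' Lw] by blast
  have z: "g' (J' (L w)) (L w) = 0" "g' (J' (L w)) (J' (L w)) = g w w"
    using J' L by (auto simp: rotation_of_def)
  have "g' (L (J w)) (L w) = 0" "g' (L (J w)) (L (J w)) = g w w"
    using J L by (auto simp: rotation_of_def)
  then have a: "a = 0" and "b * (b * g w w) = g w w"
    using ww by (simp_all add: ab inner_form_simps[OF g'] z L inner_form_sym[OF g', of "L w"])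
  then have b2: "b * b = 1"
    using ww by (simp add: mult.assoc[symmetric])
  have lin: "linear J" "linear J'"
    using J J' by (auto simp: rotation_of_def)
  have "L (J v) = b *\<^sub>R J' (L v)" for v
  proof -
    obtain c d where v: "v = c *\<^sub>R w + d *\<^sub>R J w"
      using rotation_of_basis[OF g J w] by blast
    show ?thesis
      using ab a b2 unfolding v
      by (simp add: linear_add[OF lin(1)] linear_scale[OF lin(1)] linear_add[OF lin(2)] linear_scale[OF lin(2)]
          linear_add[OF L(1)] linear_scale[OF L(1)] rotation_of_square[OF g J] rotation_of_square[OF g' J']
          linear_neg[OF L(1)] linear_diff[OF L(1)] algebra_simps mult.assoc[symmetric])
  qed
  moreover have "b = 1 \<or> b = -1"
    using b2 by (simp add: square_eq_1_iff)
  ultimately show ?thesis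
    by blast
qed

section \<open>Charts\<close>

lemma smooth_surface_chart:
  assumes "smooth_surface M A" "(U, x) \<in> A"
  shows "open U" "inj_on x U" "continuous_on U x" "x ` U \<subseteq> M"
    and "open W \<Longrightarrow> W \<subseteq> U \<Longrightarrow> openin (top_of_set M) (x ` W)"
proof -
  obtain y where U: "open U" "openin (top_of_set M) (x ` U)" and y: "homeomorphism U (x ` U) x y"
    using assms by (auto simp: smooth_surface_def)
  show "open U" by (rule U)
  show "inj_on x U"
    using y by (metis homeomorphism_apply1 inj_on_inverseI)
  show "continuous_on U x"
    using y by (rule homeomorphism_cont1)
  show "x ` U \<subseteq> M"
    using U openin_imp_subset by blast
  assume "open W" "W \<subseteq> U"
  then have "openin (top_of_set U) W"
    by (simp add: open_openin_trans U(1))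
  then show "openin (top_of_set M) (x ` W)"
    using homeomorphism_imp_open_map[OF y] U(2) openin_trans by blast
qed

lemma smooth_surface_cover:
  assumes "smooth_surface M A" "p \<in> M"
  obtains U x u where "(U, x) \<in> A" "u \<in> U" "x u = p"
  using assms by (auto simp: smooth_surface_def)

text \<open>Charts carry open sets to relatively open sets of M, so the local hypothesis makes both
  P and its negation open in M.\<close>

lemma locally_constant_on_connected:
  assumes S: "smooth_surface M A" and "connected M"
    and loc: "\<And>U x u. (U, x) \<in> A \<Longrightarrow> u \<in> U \<Longrightarrow>
       \<exists>W. open W \<and> u \<in> W \<and> W \<subseteq> U \<and> (\<forall>u'\<in>W. P (x u') \<longleftrightarrow> P (x u))"
    and "p \<in> M" "P p" "q \<in> M"
  shows "P q"
proof (rule ccontr)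
  assume "\<not> P q"
  have op: "openin (top_of_set M) {p \<in> M. Q p}" if Q: "Q = P \<or> Q = (\<lambda>p. \<not> P p)" for Q
  proof (subst openin_subopen, intro ballI)
    fix r assume "r \<in> {p \<in> M. Q p}"
    then obtain U x u where x: "(U, x) \<in> A" "u \<in> U" "x u = r" and r: "Q r"
      using smooth_surface_cover[OF S] by blast
    obtain W where W: "open W" "u \<in> W" "W \<subseteq> U" "\<forall>u'\<in>W. P (x u') \<longleftrightarrow> P (x u)"
      using loc[OF x(1,2)] by blast
    have "openin (top_of_set M) (x ` W)"
      using smooth_surface_chart(5)[OF S x(1)] W by blast
    moreover have "x ` W \<subseteq> {p \<in> M. Q p}"
      using W x r Q smooth_surface_chart(4)[OF S x(1)] by auto
    ultimately show "\<exists>T. openin (top_of_set M) T \<and> r \<in> T \<and> T \<subseteq> {p \<in> M. Q p}"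
      using W x by blast
  qed
  have "openin (top_of_set M) {p \<in> M. P p}" "openin (top_of_set M) {p \<in> M. \<not> P p}"
    using op by auto
  moreover have "M \<subseteq> {p \<in> M. P p} \<union> {p \<in> M. \<not> P p}" "{p \<in> M. P p} \<inter> {p \<in> M. \<not> P p} = {}"
    by auto
  ultimately show False
    using \<open>connected M\<close> assms(4-6) \<open>\<not> P q\<close> unfolding connected_openin by blast
qed

lemma coord_dom_open:
  assumes S: "smooth_surface M A" and c: "(U, x) \<in> A" and d: "(V, y) \<in> A"
    and F: "continuous_on M F" "F ` M \<subseteq> M"
  shows "open (coord_dom (U, x) (V, y) F)"
proof -
  obtain T where T: "open T" "y ` V = M \<inter> T"
    using smooth_surface_chart(5)[OF S d smooth_surface_chart(1)[OF S d]] by (auto simp: openin_open)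
  have "F (x u) \<in> M" if "u \<in> U" for u
    using F(2) smooth_surface_chart(4)[OF S c] that by blast
  then have "coord_dom (U, x) (V, y) F = U \<inter> (F \<circ> x) -` T"
    using T(2) by (auto simp: coord_dom_def)
  moreover have "continuous_on U (F \<circ> x)"
    using smooth_surface_chart(3,4)[OF S c] F(1) by (meson continuous_on_compose continuous_on_subset)
  ultimately show ?thesis
    using continuous_open_preimage smooth_surface_chart(1)[OF S c] T(1) by metis
qed

lemma coord_rep_mem:
  assumes "u \<in> coord_dom (U, x) (V, y) F"
  shows "coord_rep (U, x) (V, y) F u \<in> V" "y (coord_rep (U, x) (V, y) F u) = F (x u)" "u \<in> U"
  using assms by (auto simp: coord_dom_def coord_rep_def intro: inv_into_into f_inv_into_f)

lemma coord_rep_eqI: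
  assumes "smooth_surface M A" "(V, y) \<in> A" "v \<in> V" "y v = F (x u)"
  shows "coord_rep (U, x) (V, y) F u = v"
  using inv_into_f_f[OF smooth_surface_chart(2)[OF assms(1,2)] assms(3)] assms(4)
  by (simp add: coord_rep_def)

lemma coord_domI: "u \<in> U \<Longrightarrow> v \<in> V \<Longrightarrow> y v = F (x u) \<Longrightarrow> u \<in> coord_dom (U, x) (V, y) F"
  by (auto simp: coord_dom_def image_iff) metis

section \<open>Isometries of the surface in coordinates\<close>

locale riemannian_surface =
  fixes M :: "'a::{t2_space,second_countable_topology} set"
    and A :: "'a chart set" and h :: "'a surface_metric"
  assumes smooth: "smooth_surface M A" and connected: "connected M" and metric: "riemannian_metric A h"
begin

lemma metric_inner_form: "(U, x) \<in> A \<Longrightarrow> u \<in> U \<Longrightarrow> inner_form (h (U, x) u)"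
  using metric by (force simp: riemannian_metric_def inner_form_def)

lemma surface_isometry_id: "surface_isometry M A h id"
  using smooth metric by (auto simp: surface_isometry_def smooth_surface_def riemannian_metric_def)

lemma surface_isometry_mem: "surface_isometry M A h F \<Longrightarrow> p \<in> M \<Longrightarrow> F p \<in> M"
  by (auto simp: surface_isometry_def bij_betw_def)

lemma ex_target_chart:
  assumes "surface_isometry M A h F" "(U, x) \<in> A" "u \<in> U"
  obtains V y where "(V, y) \<in> A" "u \<in> coord_dom (U, x) (V, y) F"
proof -
  have "F (x u) \<in> M"
    using assms surface_isometry_mem smooth_surface_chart(4)[OF smooth assms(2)] by blast
  then obtain V y v where "(V, y) \<in> A" "v \<in> V" "y v = F (x u)"
    by (rule smooth_surface_cover[OF smooth])
  then show ?thesis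
    using that coord_domI assms(3) by metis
qed

context
  fixes F U x V y
  assumes F: "surface_isometry M A h F" and c: "(U, x) \<in> A" and d: "(V, y) \<in> A"
begin

lemma isometry_dom_open: "open (coord_dom (U, x) (V, y) F)"
  using F coord_dom_open[OF smooth c d] by (simp add: surface_isometry_def bij_betw_def)

lemma isometry_rep_twice_differentiable:
  "twice_differentiable_on (coord_dom (U, x) (V, y) F) (coord_rep (U, x) (V, y) F)"
  using F c d by (intro smooth_on_imp_twice_differentiable_on) (auto simp: surface_isometry_def)

context
  fixes u
  assumes u: "u \<in> coord_dom (U, x) (V, y) F"
begin

lemma isometry_rep_has_derivative:
  "(coord_rep (U, x) (V, y) F has_derivative differential (coord_rep (U, x) (V, y) F) u) (at u)"
  using isometry_rep_twice_differentiable u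
  by (auto simp: twice_differentiable_on_def intro: has_derivative_differential)

lemma isometry_rep_linear: "linear (differential (coord_rep (U, x) (V, y) F) u)"
  using isometry_rep_has_derivative has_derivative_linear by blast

lemma isometry_rep_metric:
  "h (V, y) (coord_rep (U, x) (V, y) F u) (differential (coord_rep (U, x) (V, y) F) u v)
     (differential (coord_rep (U, x) (V, y) F) u w) = h (U, x) u v w"
  using F c d u unfolding surface_isometry_def preserves_metric_def by blast

text \<open>Preserving a positive definite form makes the differential injective, hence onto in
  dimension 2. Test vectors in the target chart can therefore be taken as images of vectors in the
  source chart.\<close>

lemma isometry_rep_surj: "\<exists>w. differential (coord_rep (U, x) (V, y) F) u w = v"
proof -
  let ?L = "differential (coord_rep (U, x) (V, y) F) u"
  have h: "inner_form (h (V, y) (coord_rep (U, x) (V, y) F u))" "inner_form (h (U, x) u)"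
    using metric_inner_form[OF d] metric_inner_form[OF c] coord_rep_mem[OF u] by auto
  have "w = 0" if "?L w = 0" for w
    using isometry_rep_metric[of w w] that
    by (simp add: inner_form_simps[OF h(1)] inner_form_eq_0_iff[OF h(2)])
  then have "inj ?L"
    using isometry_rep_linear linear_injective_0 by blast
  then have "surj ?L"
    using isometry_rep_linear linear_injective_imp_surjective by blast
  then show ?thesis
    by (metis surjD)
qed

end

lemma twice_differentiable_on_isometry_rep:
  assumes "twice_differentiable_on V (f \<circ> y)"
  shows "twice_differentiable_on (coord_dom (U, x) (V, y) F) (f \<circ> F \<circ> x)"
    and "u \<in> coord_dom (U, x) (V, y) F \<Longrightarrow> differential (f \<circ> F \<circ> x) u v =
      differential (f \<circ> y) (coord_rep (U, x) (V, y) F u) (differential (coord_rep (U, x) (V, y) F) u v)"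
proof -
  let ?s = "coord_rep (U, x) (V, y) F" and ?D = "coord_dom (U, x) (V, y) F"
  have V: "open V"
    using smooth_surface_chart(1)[OF smooth d] .
  have "?s u \<in> V" if "u \<in> ?D" for u
    using coord_rep_mem(1)[OF that] .
  note comp = twice_differentiable_on_compose[OF isometry_dom_open V this
      isometry_rep_twice_differentiable assms]
  have eq: "(f \<circ> y) (?s u) = (f \<circ> F \<circ> x) u" if "u \<in> ?D" for u
    using coord_rep_mem[OF that] by simp
  show "twice_differentiable_on ?D (f \<circ> F \<circ> x)"
    by (rule twice_differentiable_on_cong[OF isometry_dom_open eq comp(1)])
  assume u: "u \<in> ?D"
  have "differential (f \<circ> F \<circ> x) u = differential (\<lambda>u. (f \<circ> y) (?s u)) u"
    using eq by (intro differential_cong_open[OF isometry_dom_open u]) simp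
  then show "differential (f \<circ> F \<circ> x) u v = differential (f \<circ> y) (?s u) (differential ?s u v)"
    using comp(2)[OF _ u] by simp
qed

end

lemma twice_differentiable_on_isometry:
  assumes F: "surface_isometry M A h F" and f: "\<And>V y. (V, y) \<in> A \<Longrightarrow> twice_differentiable_on V (f \<circ> y)"
    and c: "(U, x) \<in> A"
  shows "twice_differentiable_on U (f \<circ> F \<circ> x)"
  unfolding twice_differentiable_on_def
proof
  fix u assume "u \<in> U"
  then obtain V y where d: "(V, y) \<in> A" "u \<in> coord_dom (U, x) (V, y) F"
    using ex_target_chart[OF F c] by blast
  then show "f \<circ> F \<circ> x differentiable at u \<and> (\<forall>w. (\<lambda>u. differential (f \<circ> F \<circ> x) u w) differentiable at u)"
    using twice_differentiable_on_isometry_rep(1)[OF F c d(1) f[OF d(1)]]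
    by (simp add: twice_differentiable_on_def)
qed

text \<open>Used with one of the two isometries equal to the identity, it compares coordinate
  expressions of the other one in different charts.\<close>

lemma coord_rep_chain:
  assumes F: "surface_isometry M A h F" and G: "surface_isometry M A h G"
    and c: "(U, x) \<in> A" and d: "(V, y) \<in> A" and e: "(W, z) \<in> A"
    and u: "u \<in> coord_dom (U, x) (V, y) F" "coord_rep (U, x) (V, y) F u \<in> coord_dom (V, y) (W, z) G"
  shows "coord_rep (U, x) (W, z) (G \<circ> F) u = coord_rep (V, y) (W, z) G (coord_rep (U, x) (V, y) F u)"
    and "differential (coord_rep (U, x) (W, z) (G \<circ> F)) u v =
       differential (coord_rep (V, y) (W, z) G) (coord_rep (U, x) (V, y) F u) (differential (coord_rep (U, x) (V, y) F) u v)"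
proof -
  let ?s = "coord_rep (U, x) (V, y) F" and ?t = "coord_rep (V, y) (W, z) G"
  have eq: "coord_rep (U, x) (W, z) (G \<circ> F) u = ?t (?s u)"
    if "u \<in> coord_dom (U, x) (V, y) F" "?s u \<in> coord_dom (V, y) (W, z) G" for u
    using coord_rep_mem[OF that(1)] coord_rep_mem[OF that(2)]
    by (intro coord_rep_eqI[OF smooth e]) auto
  then show "coord_rep (U, x) (W, z) (G \<circ> F) u = ?t (?s u)"
    using u by blast
  define D where "D = coord_dom (U, x) (V, y) F \<inter> ?s -` coord_dom (V, y) (W, z) G"
  have "continuous_on (coord_dom (U, x) (V, y) F) ?s"
    using isometry_rep_has_derivative[OF F c d] has_derivative_continuous
    by (metis continuous_at_imp_continuous_on)
  then have D: "open D"
    unfolding D_def by (intro continuous_open_preimage isometry_dom_open F G c d e)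
  have "((\<lambda>u. ?t (?s u)) has_derivative (\<lambda>v. differential ?t (?s u) (differential ?s u v))) (at u)"
    using has_derivative_compose[OF isometry_rep_has_derivative[OF F c d u(1)] isometry_rep_has_derivative[OF G d e u(2)]] .
  then have "(coord_rep (U, x) (W, z) (G \<circ> F) has_derivative (\<lambda>v. differential ?t (?s u) (differential ?s u v))) (at u)"
    by (rule has_derivative_transform_within_open[OF _ D]) (use u eq in \<open>auto simp: D_def\<close>)
  then show "differential (coord_rep (U, x) (W, z) (G \<circ> F)) u v = differential ?t (?s u) (differential ?s u v)"
    by (metis frechet_derivative_at)
qed

text \<open>Differentiating \<sigma> (x (c t)) = x (c t) along the fixed curve makes the velocity a
  fixed vector of the differential. The time 1/2 is an arbitrary interior one.\<close>

lemma reflection_fixed_direction: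
  assumes \<sigma>: "surface_reflection M A h \<sigma>"
  obtains U x u w where "(U, x) \<in> A" "u \<in> coord_dom (U, x) (U, x) \<sigma>" "\<sigma> (x u) = x u" "w \<noteq> 0"
    "coord_rep (U, x) (U, x) \<sigma> u = u" "differential (coord_rep (U, x) (U, x) \<sigma>) u w = w"
proof -
  have iso: "surface_isometry M A h \<sigma>"
    using \<sigma> by (simp add: surface_reflection_def)
  obtain U x c where x: "(U, x) \<in> A" and c: "smooth_on {0<..<1} c"
    and ct: "\<And>t. t \<in> {0<..<1} \<Longrightarrow> c t \<in> U \<and> velocity c t \<noteq> 0 \<and> \<sigma> (x (c t)) = x (c t)"
    using \<sigma> by (auto simp: surface_reflection_def)
  let ?s = "coord_rep (U, x) (U, x) \<sigma>"
  define w where "w = velocity c (1/2)"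
  have fix': "c t \<in> coord_dom (U, x) (U, x) \<sigma>" "?s (c t) = c t" if "t \<in> {0<..<1}" for t
  proof -
    show "c t \<in> coord_dom (U, x) (U, x) \<sigma>"
      using ct[OF that] coord_domI[of "c t" U "c t" U x \<sigma> x] by simp
    show "?s (c t) = c t"
      using ct[OF that] by (intro coord_rep_eqI[OF smooth x]) auto
  qed
  have half: "(1/2::real) \<in> {0<..<1}"
    by simp
  have "c differentiable (at (1/2))"
    using smooth_on_imp_twice_differentiable_on[OF c] half by (simp add: twice_differentiable_on_def)
  then have dc: "(c has_derivative (\<lambda>r. r *\<^sub>R w)) (at (1/2))"
    by (simp add: w_def vector_derivative_works has_vector_derivative_def)
  have "((\<lambda>t. ?s (c t)) has_derivative (\<lambda>r. differential ?s (c (1/2)) (r *\<^sub>R w))) (at (1/2))"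
    using has_derivative_compose[OF dc isometry_rep_has_derivative[OF iso x x fix'(1)[OF half]]] .
  then have "(c has_derivative (\<lambda>r. differential ?s (c (1/2)) (r *\<^sub>R w))) (at (1/2))"
    by (rule has_derivative_transform_within_open[OF _ open_greaterThanLessThan half]) (simp add: fix')
  from has_derivative_unique[OF this dc] have "differential ?s (c (1/2)) (1 *\<^sub>R w) = 1 *\<^sub>R w"
    by (rule fun_cong)
  then have "differential ?s (c (1/2)) w = w"
    by simp
  then show ?thesis
    using that[OF x fix'(1)[OF half], of w] ct[OF half] fix'(2)[OF half] by (simp add: w_def)
qed

end

section \<open>Isometries and orientation\<close>

locale oriented_surface = riemannian_surface M A h
  for M :: "'a::{t2_space,second_countable_topology} set" and A h +
  fixes J :: "'a endomorphism_field"
  assumes rotation: "rotation_field A h J"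
begin

lemma rotation_of_field: "(U, x) \<in> A \<Longrightarrow> u \<in> U \<Longrightarrow> rotation_of (h (U, x) u) (J (U, x) u)"
  using rotation by (force simp: rotation_field_def rotation_of_def)

lemma rotation_coord_change:
  assumes "c \<in> A" "d \<in> A" "u \<in> coord_dom c d id"
  shows "differential (coord_rep c d id) u (J c u v) = J d (coord_rep c d id u) (differential (coord_rep c d id) u v)"
  using rotation assms unfolding rotation_field_def by blast

lemma rotation_isCont:
  assumes "(U, x) \<in> A" "u \<in> U"
  shows "isCont (\<lambda>u. J (U, x) u v) u"
proof -
  have "smooth_on U (\<lambda>u. J (U, x) u v)"
    using rotation assms by (force simp: rotation_field_def)
  then show ?thesis
    using assms smooth_on_imp_twice_differentiable_on twice_differentiable_on_def
      differentiable_imp_continuous_within by metis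
qed

text \<open>An isometry commutes or anticommutes with the rotation field at every point, and by
  connectedness with the same sign everywhere.\<close>

definition reverses_at :: "('a \<Rightarrow> 'a) \<Rightarrow> 'a \<Rightarrow> bool" where
  "reverses_at F p \<longleftrightarrow> (\<forall>(U, x)\<in>A. \<forall>(V, y)\<in>A. \<forall>u\<in>coord_dom (U, x) (V, y) F. x u = p \<longrightarrow>
     (\<forall>v. differential (coord_rep (U, x) (V, y) F) u (J (U, x) u v)
        = - J (V, y) (coord_rep (U, x) (V, y) F u) (differential (coord_rep (U, x) (V, y) F) u v)))"

text \<open>The rotation field and the differential of F both obey the transformation rule for
  changes of charts, so one pair of charts decides.\<close>

lemma reverses_atI:
  assumes F: "surface_isometry M A h F" and c: "(U, x) \<in> A" and d: "(V, y) \<in> A"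
    and u: "u \<in> coord_dom (U, x) (V, y) F"
    and rev: "\<And>v. differential (coord_rep (U, x) (V, y) F) u (J (U, x) u v)
        = - J (V, y) (coord_rep (U, x) (V, y) F u) (differential (coord_rep (U, x) (V, y) F) u v)"
  shows "reverses_at F (x u)"
  unfolding reverses_at_def
proof (clarify)
  fix U' x' V' y' u' v'
  assume c': "(U', x') \<in> A" and d': "(V', y') \<in> A" and u': "u' \<in> coord_dom (U', x') (V', y') F" "x' u' = x u"
  note id = surface_isometry_id
  let ?s = "coord_rep (U, x) (V, y) F" and ?s' = "coord_rep (U', x') (V', y') F"
  let ?k = "coord_rep (U, x) (U', x') id" and ?l = "coord_rep (V, y) (V', y') id"
  have k: "u \<in> coord_dom (U, x) (U', x') id" "?k u = u'"
    using coord_rep_mem[OF u] coord_rep_mem[OF u'(1)] u'(2)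
    by (auto intro: coord_domI coord_rep_eqI[OF smooth c'])
  have l: "?s u \<in> coord_dom (V, y) (V', y') id" "?l (?s u) = ?s' u'"
    using coord_rep_mem[OF u] coord_rep_mem[OF u'(1)] u'(2)
    by (auto intro: coord_domI coord_rep_eqI[OF smooth d'])
  \<comment> \<open>The expression of F from the chart x to the chart y' factors in two ways,
    through y and through x'. Comparing them yields the differential in the primed charts.\<close>
  have 1: "differential (coord_rep (U, x) (V', y') F) u v = differential ?l (?s u) (differential ?s u v)" for v
    using coord_rep_chain(2)[OF F id c d d' u l(1)] by simp
  have 2: "differential (coord_rep (U, x) (V', y') F) u v = differential ?s' u' (differential ?k u v)" for v
    using coord_rep_chain(2)[OF id F c c' d' k(1)] k(2) u'(1) by simp
  obtain v where v: "differential ?k u v = v'"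
    using isometry_rep_surj[OF id c c' k(1)] by blast
  have lin: "linear (differential ?l (?s u))"
    using isometry_rep_linear[OF id d d' l(1)] .
  have "differential ?s' u' (J (U', x') u' v') = differential ?s' u' (differential ?k u (J (U, x) u v))"
    using rotation_coord_change[OF c c' k(1), of v] v k(2) by simp
  also have "\<dots> = differential ?l (?s u) (- J (V, y) (?s u) (differential ?s u v))"
    using 1 2 rev by metis
  also have "\<dots> = - J (V', y') (?l (?s u)) (differential ?l (?s u) (differential ?s u v))"
    using rotation_coord_change[OF d d' l(1)] by (simp add: linear_neg[OF lin])
  also have "\<dots> = - J (V', y') (?s' u') (differential ?s' u' v')"
    using 1 2 v l(2) by metis
  finally show "differential ?s' u' (J (U', x') u' v') = - J (V', y') (?s' u') (differential ?s' u' v')" .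
qed

lemma reverses_at_everywhere:
  assumes F: "surface_isometry M A h F" and "p \<in> M" "reverses_at F p" "q \<in> M"
  shows "reverses_at F q"
proof (rule locally_constant_on_connected[where P = "reverses_at F", OF smooth connected _ assms(2-4)])
  fix U x u1 assume c: "(U, x) \<in> A" and u1: "u1 \<in> U"
  obtain V y where d: "(V, y) \<in> A" and u1D: "u1 \<in> coord_dom (U, x) (V, y) F"
    using ex_target_chart[OF F c u1] .
  let ?s = "coord_rep (U, x) (V, y) F" and ?D = "coord_dom (U, x) (V, y) F"
  note mem = coord_rep_mem[of _ U x V y F]
  define w where "w = axis (1::2) (1::real)"
  have w: "w \<noteq> 0"
    by (simp add: w_def)
  \<comment> \<open>\<open>e r\<close> vanishes where F intertwines the rotations with sign r.
    Testing the one vector w is enough because the sign is known to be 1 or -1 for all vectors at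
    once.\<close>
  define e where "e = (\<lambda>r u. differential ?s u (J (U, x) u w) - r *\<^sub>R J (V, y) (?s u) (differential ?s u w))"
  have iff: "reverses_at F (x u) \<longleftrightarrow> e (-1) u = 0" "e (-1) u = 0 \<longleftrightarrow> e 1 u \<noteq> 0" if u: "u \<in> ?D" for u
  proof -
    have g: "inner_form (h (U, x) u)" "inner_form (h (V, y) (?s u))"
      "rotation_of (h (U, x) u) (J (U, x) u)" "rotation_of (h (V, y) (?s u)) (J (V, y) (?s u))"
      using metric_inner_form[OF c] metric_inner_form[OF d] rotation_of_field[OF c] rotation_of_field[OF d]
        mem[OF u] by auto
    have "\<exists>s. (s = 1 \<or> s = -1) \<and>
        (\<forall>v. differential ?s u (J (U, x) u v) = s *\<^sub>R J (V, y) (?s u) (differential ?s u v))"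
      by (rule isometry_rotation_sign[OF g(1,3,2,4) isometry_rep_linear[OF F c d u]])
         (rule isometry_rep_metric[OF F c d u])
    then obtain s where s: "s = 1 \<or> s = -1"
      "\<And>v. differential ?s u (J (U, x) u v) = s *\<^sub>R J (V, y) (?s u) (differential ?s u v)"
      by blast
    have "h (V, y) (?s u) (differential ?s u w) (differential ?s u w) \<noteq> 0"
      using isometry_rep_metric[OF F c d u] w inner_form_eq_0_iff[OF g(1)] by metis
    then have nz: "J (V, y) (?s u) (differential ?s u w) \<noteq> 0"
      using g(4) inner_form_eq_0_iff[OF g(2)] unfolding rotation_of_def by metis
    have e: "e r u = (s - r) *\<^sub>R J (V, y) (?s u) (differential ?s u w)" for r
      by (simp add: e_def s(2) algebra_simps)
    show "e (-1) u = 0 \<longleftrightarrow> e 1 u \<noteq> 0"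
      using s(1) nz by (auto simp: e)
    have "reverses_at F (x u) \<longleftrightarrow> s = -1"
    proof
      assume "reverses_at F (x u)"
      then have "differential ?s u (J (U, x) u w) = - J (V, y) (?s u) (differential ?s u w)"
        using c d u unfolding reverses_at_def by blast
      then have "e (-1) u = 0"
        by (simp add: e_def)
      then show "s = -1"
        using nz by (simp add: e add_eq_0_iff)
    next
      assume "s = -1"
      then show "reverses_at F (x u)"
        using s(2) by (intro reverses_atI[OF F c d u]) simp
    qed
    then show "reverses_at F (x u) \<longleftrightarrow> e (-1) u = 0"
      using s(1) nz by (auto simp: e)
  qed
  have cont: "isCont (e r) u1" for r
  proof -
    have ds: "isCont (\<lambda>u. differential ?s u k) u1" for k
      using isometry_rep_twice_differentiable[OF F c d] u1D
      by (auto simp: twice_differentiable_on_def intro: differentiable_imp_continuous_within)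
    have s: "isCont ?s u1"
      using has_derivative_continuous[OF isometry_rep_has_derivative[OF F c d u1D]] .
    have J: "isCont (\<lambda>u. J (V, y) (?s u) k) u1" for k
      using isCont_o2[OF s, of "\<lambda>v. J (V, y) v k"] rotation_isCont[OF d mem(1)[OF u1D]] by simp
    have lin: "linear (J (V, y) (?s u))" if "u \<in> ?D" for u
      using rotation_of_field[OF d mem(1)[OF that]] by (simp add: rotation_of_def)
    note family = isCont_linear_family[OF isometry_dom_open[OF F c d] u1D]
    have "isCont (\<lambda>u. differential ?s u (J (U, x) u w)) u1"
      by (rule family[OF isometry_rep_linear[OF F c d] ds rotation_isCont[OF c u1]])
    moreover have "isCont (\<lambda>u. J (V, y) (?s u) (differential ?s u w)) u1"
      by (rule family[OF lin J ds])
    ultimately show ?thesis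
      unfolding e_def by (intro continuous_intros)
  qed
  have "\<exists>W. open W \<and> u1 \<in> W \<and> W \<subseteq> ?D \<and> (\<forall>u\<in>W. reverses_at F (x u) \<longleftrightarrow> reverses_at F (x u1))"
    using locally_constant_dichotomy[OF isometry_dom_open[OF F c d] u1D cont cont iff] .
  then show "\<exists>W. open W \<and> u1 \<in> W \<and> W \<subseteq> U \<and> (\<forall>u\<in>W. reverses_at F (x u) \<longleftrightarrow> reverses_at F (x u1))"
    using mem(3) by blast
qed

end

section \<open>Rigidity of immersed surfaces\<close>

lemma linear_inj_imp_surj_DIM:
  fixes f :: "'k::euclidean_space \<Rightarrow> 'e::euclidean_space"
  assumes "linear f" "inj f" "DIM('k) = DIM('e)"
  shows "surj f"
proof -
  have "dim (range f) = DIM('k)"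
    using dim_image_eq[of f UNIV] assms(1,2) by (simp add: inj_on_subset span_UNIV)
  then have "dim (range f) = DIM('e)"
    using assms(3) by simp
  moreover have "subspace (range f)"
    using linear_subspace_image[OF assms(1) subspace_UNIV] .
  ultimately show ?thesis
    by (metis dim_eq_full span_eq_iff)
qed

text \<open>The frame \<open>(\<pi> \<circ> f, N, df)\<close> along the immersion \<open>f\<close>, with \<open>\<pi>\<close> the projection for which
  \<open>\<pi> \<circ> f\<close> is normal to the target manifold.\<close>

definition frame :: "('e::euclidean_space \<Rightarrow> 'e) \<Rightarrow> ('a \<Rightarrow> 'e) \<Rightarrow> ('a \<Rightarrow> 'e) \<Rightarrow> (real^2 \<Rightarrow> 'a) \<Rightarrow> real^2
    \<Rightarrow> real \<times> real \<times> (real^2) \<Rightarrow> 'e" where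
  "frame \<pi> f N x u k =
     fst k *\<^sub>R \<pi> (f (x u)) + fst (snd k) *\<^sub>R N (x u) + differential (f \<circ> x) u (snd (snd k))"

definition frame_derivative :: "('e::euclidean_space \<Rightarrow> 'e) \<Rightarrow> ('a \<Rightarrow> 'e) \<Rightarrow> ('a \<Rightarrow> 'e) \<Rightarrow> (real^2 \<Rightarrow> 'a)
    \<Rightarrow> real^2 \<Rightarrow> real^2 \<Rightarrow> real \<times> real \<times> (real^2) \<Rightarrow> 'e" where
  "frame_derivative \<pi> f N x u v k =
     fst k *\<^sub>R \<pi> (differential (f \<circ> x) u v) + fst (snd k) *\<^sub>R differential (N \<circ> x) u v
     + differential (\<lambda>u. differential (f \<circ> x) u (snd (snd k))) u v"

lemma linear_frame:
  assumes "f \<circ> x differentiable (at u)"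
  shows "linear (frame \<pi> f N x u)"
  using linear_frechet_derivative[OF assms]
  by (intro linearI) (simp_all add: frame_def linear_add linear_scale algebra_simps)

lemma frame_has_derivative:
  assumes "bounded_linear \<pi>" "twice_differentiable_on U (f \<circ> x)" "N \<circ> x differentiable (at u)" "u \<in> U"
  shows "((\<lambda>u. frame \<pi> f N x u k) has_derivative (\<lambda>v. frame_derivative \<pi> f N x u v k)) (at u)"
proof -
  have f: "((\<lambda>u. f (x u)) has_derivative differential (f \<circ> x) u) (at u)"
    and df: "((\<lambda>u. differential (f \<circ> x) u w) has_derivative differential (\<lambda>u. differential (f \<circ> x) u w) u) (at u)" for w
    using assms(2,4) has_derivative_differential[of "f \<circ> x" u]
    by (auto simp: twice_differentiable_on_def o_def intro: has_derivative_differential)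
  have N: "((\<lambda>u. N (x u)) has_derivative differential (N \<circ> x) u) (at u)"
    using has_derivative_differential[OF assms(3)] by (simp add: o_def)
  show ?thesis
    unfolding frame_def frame_derivative_def
    by (intro has_derivative_add has_derivative_scaleR_right bounded_linear.has_derivative[OF assms(1)] f df N)
qed

text \<open>The last claim is the symmetry of second derivatives, which acts as vanishing torsion.
  The first comes from it too: exchanging the slots turns the argument 0 into a derivative in
  direction 0.\<close>

lemma frame_derivative_split:
  assumes "open U" "twice_differentiable_on U (f \<circ> x)" "u \<in> U"
  shows "differential (\<lambda>u. differential (f \<circ> x) u 0) u v = 0"
    and "frame_derivative \<pi> f N x u v (p, n, w) =
    p *\<^sub>R frame_derivative \<pi> f N x u v (1, 0, 0) + n *\<^sub>R frame_derivative \<pi> f N x u v (0, 1, 0)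
    + frame_derivative \<pi> f N x u v (0, 0, w)"
    and "frame_derivative \<pi> f N x u v (0, 0, w) = frame_derivative \<pi> f N x u w (0, 0, v)"
proof -
  have sym: "differential (\<lambda>u. differential (f \<circ> x) u w) u v = differential (\<lambda>u. differential (f \<circ> x) u v) u w" for v w
    using second_differential_symmetric[OF assms(1,3,2)] .
  have "linear (differential (\<lambda>u. differential (f \<circ> x) u v) u)" for v
    using assms(2,3) by (auto simp: twice_differentiable_on_def intro: linear_frechet_derivative)
  then show "differential (\<lambda>u. differential (f \<circ> x) u 0) u v = 0"
    using sym[of 0 v] linear_0 by metis
  then show "frame_derivative \<pi> f N x u v (p, n, w) =
    p *\<^sub>R frame_derivative \<pi> f N x u v (1, 0, 0) + n *\<^sub>R frame_derivative \<pi> f N x u v (0, 1, 0)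
    + frame_derivative \<pi> f N x u v (0, 0, w)"
    by (simp add: frame_derivative_def)
  show "frame_derivative \<pi> f N x u v (0, 0, w) = frame_derivative \<pi> f N x u w (0, 0, v)"
    by (simp add: frame_derivative_def sym)
qed

lemma frame_split:
  assumes "f \<circ> x differentiable (at u)"
  shows "frame \<pi> f N x u (p, n, w) =
    p *\<^sub>R frame \<pi> f N x u (1, 0, 0) + n *\<^sub>R frame \<pi> f N x u (0, 1, 0) + frame \<pi> f N x u (0, 0, w)"
  using linear_0[OF linear_frechet_derivative[OF assms]] by (simp add: frame_def)

text \<open>The algebra behind the uniqueness of the Levi-Civita connection: alternating the two
  symmetries six times leads back to D a b c with the opposite sign.\<close>

lemma symmetric_skew_trilinear_zero:
  fixes D :: "'v \<Rightarrow> 'v \<Rightarrow> 'v \<Rightarrow> real"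
  assumes sym: "\<And>a b c. D a b c = D b a c" and skew: "\<And>a b c. D a b c = - D a c b"
  shows "D a b c = 0"
proof -
  have "D a b c = - D a c b" by (rule skew)
  also have "\<dots> = - D c a b" by (simp only: sym[of a c])
  also have "\<dots> = D c b a" by (simp only: skew[of c a b])
  also have "\<dots> = D b c a" by (simp only: sym[of c b])
  also have "\<dots> = - D b a c" by (rule skew)
  also have "\<dots> = - D a b c" by (simp only: sym[of b a])
  finally show ?thesis by simp
qed

text \<open>Differentiating the equal Gram matrices shows that the difference \<delta> of the
  connection coefficients is skew in its last two arguments. The hypotheses \<open>proj\<close> and
  \<open>second\<close> remove the entries that involve position and normal; on tangent vectors
  \<delta> is also symmetric, hence zero. Christoffel symbols of the surface thus never have to be
  computed.\<close>

lemma frame_derivative_products_agree: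
  fixes \<beta> :: "'e::euclidean_space \<Rightarrow> 'e \<Rightarrow> real"
  assumes \<beta>: "bounded_bilinear \<beta>" "\<And>a b. \<beta> a b = \<beta> b a"
    and \<pi>: "bounded_linear \<pi>" and U: "open U" "u \<in> U"
    and tw: "twice_differentiable_on U (f\<^sub>1 \<circ> x)" "twice_differentiable_on U (f\<^sub>2 \<circ> x)"
    and N: "\<And>u. u \<in> U \<Longrightarrow> N\<^sub>1 \<circ> x differentiable (at u)" "\<And>u. u \<in> U \<Longrightarrow> N\<^sub>2 \<circ> x differentiable (at u)"
    and gram: "\<And>u k l. u \<in> U \<Longrightarrow> \<beta> (frame \<pi> f\<^sub>1 N\<^sub>1 x u k) (frame \<pi> f\<^sub>1 N\<^sub>1 x u l)
        = \<beta> (frame \<pi> f\<^sub>2 N\<^sub>2 x u k) (frame \<pi> f\<^sub>2 N\<^sub>2 x u l)"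
    and proj: "\<And>u v k. u \<in> U \<Longrightarrow> \<beta> (\<pi> (differential (f\<^sub>1 \<circ> x) u v)) (frame \<pi> f\<^sub>1 N\<^sub>1 x u k)
        = \<beta> (\<pi> (differential (f\<^sub>2 \<circ> x) u v)) (frame \<pi> f\<^sub>2 N\<^sub>2 x u k)"
    and second: "\<And>u v w. u \<in> U \<Longrightarrow> \<beta> (differential (N\<^sub>1 \<circ> x) u v) (differential (f\<^sub>1 \<circ> x) u w)
        = \<beta> (differential (N\<^sub>2 \<circ> x) u v) (differential (f\<^sub>2 \<circ> x) u w)"
  shows "\<beta> (frame_derivative \<pi> f\<^sub>1 N\<^sub>1 x u v k) (frame \<pi> f\<^sub>1 N\<^sub>1 x u l)
    = \<beta> (frame_derivative \<pi> f\<^sub>2 N\<^sub>2 x u v k) (frame \<pi> f\<^sub>2 N\<^sub>2 x u l)"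
proof -
  interpret \<beta>: bounded_bilinear \<beta> by (rule \<beta>)
  define F\<^sub>1 where "F\<^sub>1 = frame \<pi> f\<^sub>1 N\<^sub>1 x"
  define F\<^sub>2 where "F\<^sub>2 = frame \<pi> f\<^sub>2 N\<^sub>2 x"
  define D\<^sub>1 where "D\<^sub>1 = frame_derivative \<pi> f\<^sub>1 N\<^sub>1 x u"
  define D\<^sub>2 where "D\<^sub>2 = frame_derivative \<pi> f\<^sub>2 N\<^sub>2 x u"
  define \<delta> where "\<delta> = (\<lambda>v k l. \<beta> (D\<^sub>1 v k) (F\<^sub>1 u l) - \<beta> (D\<^sub>2 v k) (F\<^sub>2 u l))"
  have d1: "((\<lambda>u. F\<^sub>1 u k) has_derivative (\<lambda>v. D\<^sub>1 v k)) (at u)" for k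
    unfolding F\<^sub>1_def D\<^sub>1_def by (rule frame_has_derivative[OF \<pi> tw(1) N(1)[OF U(2)] U(2)])
  have d2: "((\<lambda>u. F\<^sub>2 u k) has_derivative (\<lambda>v. D\<^sub>2 v k)) (at u)" for k
    unfolding F\<^sub>2_def D\<^sub>2_def by (rule frame_has_derivative[OF \<pi> tw(2) N(2)[OF U(2)] U(2)])
  have skew: "\<delta> v k l = - \<delta> v l k" for v k l
  proof -
    have "((\<lambda>u. \<beta> (F\<^sub>1 u k) (F\<^sub>1 u l)) has_derivative (\<lambda>v. \<beta> (F\<^sub>1 u k) (D\<^sub>1 v l) + \<beta> (D\<^sub>1 v k) (F\<^sub>1 u l))) (at u)"
      by (rule \<beta>.FDERIV[OF d1 d1])
    then have "((\<lambda>u. \<beta> (F\<^sub>2 u k) (F\<^sub>2 u l)) has_derivative (\<lambda>v. \<beta> (F\<^sub>1 u k) (D\<^sub>1 v l) + \<beta> (D\<^sub>1 v k) (F\<^sub>1 u l))) (at u)"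
      by (rule has_derivative_transform_within_open[OF _ U]) (simp add: F\<^sub>1_def F\<^sub>2_def gram)
    moreover have "((\<lambda>u. \<beta> (F\<^sub>2 u k) (F\<^sub>2 u l)) has_derivative (\<lambda>v. \<beta> (F\<^sub>2 u k) (D\<^sub>2 v l) + \<beta> (D\<^sub>2 v k) (F\<^sub>2 u l))) (at u)"
      by (rule \<beta>.FDERIV[OF d2 d2])
    ultimately have "(\<lambda>v. \<beta> (F\<^sub>1 u k) (D\<^sub>1 v l) + \<beta> (D\<^sub>1 v k) (F\<^sub>1 u l)) = (\<lambda>v. \<beta> (F\<^sub>2 u k) (D\<^sub>2 v l) + \<beta> (D\<^sub>2 v k) (F\<^sub>2 u l))"
      by (rule has_derivative_unique)
    from fun_cong[OF this, of v] show ?thesis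
      using \<beta>(2)[of "F\<^sub>1 u k" "D\<^sub>1 v l"] \<beta>(2)[of "F\<^sub>2 u k" "D\<^sub>2 v l"] by (simp add: \<delta>_def)
  qed
  have diff: "f\<^sub>1 \<circ> x differentiable (at u)" "f\<^sub>2 \<circ> x differentiable (at u)"
    using tw U by (auto simp: twice_differentiable_on_def)
  have D\<^sub>1: "D\<^sub>1 v (p, n, w) = p *\<^sub>R D\<^sub>1 v (1, 0, 0) + n *\<^sub>R D\<^sub>1 v (0, 1, 0) + D\<^sub>1 v (0, 0, w)" "D\<^sub>1 v (0, 0, w) = D\<^sub>1 w (0, 0, v)"
    and D\<^sub>2: "D\<^sub>2 v (p, n, w) = p *\<^sub>R D\<^sub>2 v (1, 0, 0) + n *\<^sub>R D\<^sub>2 v (0, 1, 0) + D\<^sub>2 v (0, 0, w)" "D\<^sub>2 v (0, 0, w) = D\<^sub>2 w (0, 0, v)"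
    for v p n w
    unfolding D\<^sub>1_def D\<^sub>2_def
    by (rule frame_derivative_split(2,3)[OF U(1) tw(1) U(2)] frame_derivative_split(2,3)[OF U(1) tw(2) U(2)])+
  have F\<^sub>1: "F\<^sub>1 u (p, n, w) = p *\<^sub>R F\<^sub>1 u (1, 0, 0) + n *\<^sub>R F\<^sub>1 u (0, 1, 0) + F\<^sub>1 u (0, 0, w)"
    and F\<^sub>2: "F\<^sub>2 u (p, n, w) = p *\<^sub>R F\<^sub>2 u (1, 0, 0) + n *\<^sub>R F\<^sub>2 u (0, 1, 0) + F\<^sub>2 u (0, 0, w)" for p n w
    unfolding F\<^sub>1_def F\<^sub>2_def by (rule frame_split[OF diff(1)] frame_split[OF diff(2)])+
  have right: "\<delta> v k (p, n, w) = p * \<delta> v k (1, 0, 0) + n * \<delta> v k (0, 1, 0) + \<delta> v k (0, 0, w)" for v k p n w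
    unfolding \<delta>_def F\<^sub>1[of p n w] F\<^sub>2[of p n w]
    by (simp add: \<beta>.add_right \<beta>.scaleR_right algebra_simps)
  have left: "\<delta> v (p, n, w) l = p * \<delta> v (1, 0, 0) l + n * \<delta> v (0, 1, 0) l + \<delta> v (0, 0, w) l" for v l p n w
    unfolding \<delta>_def D\<^sub>1(1)[of v p n w] D\<^sub>2(1)[of v p n w]
    by (simp add: \<beta>.add_left \<beta>.scaleR_left algebra_simps)
  have zero: "differential (\<lambda>u. differential (f\<^sub>1 \<circ> x) u 0) u v = 0" "differential (\<lambda>u. differential (f\<^sub>2 \<circ> x) u 0) u v = 0" for v
    by (rule frame_derivative_split(1)[OF U(1) tw(1) U(2)] frame_derivative_split(1)[OF U(1) tw(2) U(2)])+
  have P: "\<delta> v (1, 0, 0) l = 0" for v l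
    using proj[OF U(2), of v l] by (simp add: \<delta>_def D\<^sub>1_def D\<^sub>2_def F\<^sub>1_def F\<^sub>2_def frame_derivative_def zero)
  have P': "\<delta> v l (1, 0, 0) = 0" for v l
    using P skew[of v l] by simp
  have Nw: "\<delta> v (0, 1, 0) (0, 0, w) = 0" for v w
    using second[OF U(2), of v w]
    by (simp add: \<delta>_def D\<^sub>1_def D\<^sub>2_def F\<^sub>1_def F\<^sub>2_def frame_derivative_def frame_def zero)
  have wN: "\<delta> v (0, 0, w) (0, 1, 0) = 0" for v w
    using Nw skew[of v "(0, 0, w)"] by simp
  have NN: "\<delta> v (0, 1, 0) (0, 1, 0) = 0" for v
    using skew[of v "(0, 1, 0)" "(0, 1, 0)"] by simp
  have sym: "\<delta> v (0, 0, w) l = \<delta> w (0, 0, v) l" for v w l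
    unfolding \<delta>_def by (simp only: D\<^sub>1(2)[of v w] D\<^sub>2(2)[of v w])
  have ww: "\<delta> v (0, 0, w) (0, 0, w') = 0" for v w w'
    using symmetric_skew_trilinear_zero[of "\<lambda>v w w'. \<delta> v (0, 0, w) (0, 0, w')", OF sym skew] .
  obtain p n w p' n' w' where kl: "k = (p, n, w)" "l = (p', n', w')"
    by (metis prod.exhaust)
  have "\<delta> v k l = 0"
    unfolding kl left[of v p n w] right[of v _ p' n' w'] P P' Nw wN NN ww by simp
  then show ?thesis
    by (simp add: \<delta>_def F\<^sub>1_def F\<^sub>2_def D\<^sub>1_def D\<^sub>2_def)
qed

section \<open>Congruence of immersions with the same data\<close>

context riemannian_surface
begin

text \<open>In a chart the transition map from the first frame to the second has derivative zero, so
  it equals R near any point where it equals R; nondegeneracy of \<beta> recovers the derivative of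
  the second frame from its products. Connectedness carries the equality through M.\<close>

theorem congruent_immersions:
  fixes f\<^sub>1 f\<^sub>2 N\<^sub>1 N\<^sub>2 :: "'a \<Rightarrow> 'e::euclidean_space" and \<beta> :: "'e \<Rightarrow> 'e \<Rightarrow> real"
  assumes \<beta>: "bounded_bilinear \<beta>" "\<And>a b. \<beta> a b = \<beta> b a" "\<And>z. (\<And>w. \<beta> z w = 0) \<Longrightarrow> z = 0"
    and dim: "DIM('e) = 4"
    and \<pi>: "bounded_linear \<pi>"
    and tw: "\<And>U x. (U, x) \<in> A \<Longrightarrow> twice_differentiable_on U (f\<^sub>1 \<circ> x)"
      "\<And>U x. (U, x) \<in> A \<Longrightarrow> twice_differentiable_on U (f\<^sub>2 \<circ> x)"
    and N: "\<And>U x u. (U, x) \<in> A \<Longrightarrow> u \<in> U \<Longrightarrow> N\<^sub>1 \<circ> x differentiable (at u)"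
      "\<And>U x u. (U, x) \<in> A \<Longrightarrow> u \<in> U \<Longrightarrow> N\<^sub>2 \<circ> x differentiable (at u)"
    and inj: "\<And>U x u k. (U, x) \<in> A \<Longrightarrow> u \<in> U \<Longrightarrow> frame \<pi> f\<^sub>1 N\<^sub>1 x u k = 0 \<Longrightarrow> k = 0"
      "\<And>U x u k. (U, x) \<in> A \<Longrightarrow> u \<in> U \<Longrightarrow> frame \<pi> f\<^sub>2 N\<^sub>2 x u k = 0 \<Longrightarrow> k = 0"
    and gram: "\<And>U x u k l. (U, x) \<in> A \<Longrightarrow> u \<in> U \<Longrightarrow> \<beta> (frame \<pi> f\<^sub>1 N\<^sub>1 x u k) (frame \<pi> f\<^sub>1 N\<^sub>1 x u l)
        = \<beta> (frame \<pi> f\<^sub>2 N\<^sub>2 x u k) (frame \<pi> f\<^sub>2 N\<^sub>2 x u l)"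
    and proj: "\<And>U x u v k. (U, x) \<in> A \<Longrightarrow> u \<in> U \<Longrightarrow>
        \<beta> (\<pi> (differential (f\<^sub>1 \<circ> x) u v)) (frame \<pi> f\<^sub>1 N\<^sub>1 x u k)
        = \<beta> (\<pi> (differential (f\<^sub>2 \<circ> x) u v)) (frame \<pi> f\<^sub>2 N\<^sub>2 x u k)"
    and second: "\<And>U x u v w. (U, x) \<in> A \<Longrightarrow> u \<in> U \<Longrightarrow>
        \<beta> (differential (N\<^sub>1 \<circ> x) u v) (differential (f\<^sub>1 \<circ> x) u w)
        = \<beta> (differential (N\<^sub>2 \<circ> x) u v) (differential (f\<^sub>2 \<circ> x) u w)"
    and R: "linear R" "\<And>z. \<pi> (R z) = R (\<pi> z)"
    and base: "(U\<^sub>0, x\<^sub>0) \<in> A" "u\<^sub>0 \<in> U\<^sub>0" "f\<^sub>2 (x\<^sub>0 u\<^sub>0) = R (f\<^sub>1 (x\<^sub>0 u\<^sub>0))" "N\<^sub>2 (x\<^sub>0 u\<^sub>0) = R (N\<^sub>1 (x\<^sub>0 u\<^sub>0))"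
      "\<And>w. differential (f\<^sub>2 \<circ> x\<^sub>0) u\<^sub>0 w = R (differential (f\<^sub>1 \<circ> x\<^sub>0) u\<^sub>0 w)"
    and p: "p \<in> M"
  shows "f\<^sub>2 p = R (f\<^sub>1 p)"
proof -
  interpret \<beta>: bounded_bilinear \<beta> by (rule \<beta>)
  have bR: "bounded_linear R"
    using R(1) by (simp add: linear_conv_bounded_linear)
  have local: "f\<^sub>2 (x u) = R (f\<^sub>1 (x u)) \<and> N\<^sub>2 (x u) = R (N\<^sub>1 (x u))"
    if c: "(U, x) \<in> A" and B: "ball a r \<subseteq> U" and u1: "u1 \<in> ball a r" and u: "u \<in> ball a r"
      and at_u1: "f\<^sub>2 (x u1) = R (f\<^sub>1 (x u1))" "N\<^sub>2 (x u1) = R (N\<^sub>1 (x u1))"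
        "\<And>w. differential (f\<^sub>2 \<circ> x) u1 w = R (differential (f\<^sub>1 \<circ> x) u1 w)"
    for U x a r u1 u
  proof -
    let ?F\<^sub>1 = "frame \<pi> f\<^sub>1 N\<^sub>1 x" and ?F\<^sub>2 = "frame \<pi> f\<^sub>2 N\<^sub>2 x"
    have diff: "f\<^sub>1 \<circ> x differentiable (at u)" "f\<^sub>2 \<circ> x differentiable (at u)" if "u \<in> U" for u
      using tw c that by (auto simp: twice_differentiable_on_def)
    have lin: "linear (?F\<^sub>1 u)" "linear (?F\<^sub>2 u)" if "u \<in> U" for u
      by (rule linear_frame[OF diff(1)[OF that]] linear_frame[OF diff(2)[OF that]])+
    have injF: "inj (?F\<^sub>1 u)" "inj (?F\<^sub>2 u)" if "u \<in> U" for u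
      using inj[OF c that] lin[OF that] linear_injective_0 by blast+
    have surjF: "surj (?F\<^sub>1 u)" "surj (?F\<^sub>2 u)" if "u \<in> U" for u
      using linear_inj_imp_surj_DIM[OF lin(1) injF(1)] linear_inj_imp_surj_DIM[OF lin(2) injF(2)] that dim
      by simp_all
    define c where "c = (\<lambda>z u. inv (?F\<^sub>1 u) z)"
    have c: "?F\<^sub>1 u (c z u) = z" "c (?F\<^sub>1 u k) u = k" if "u \<in> U" for z u k
      using surj_f_inv_f[OF surjF(1)[OF that]] inv_f_f[OF injF(1)[OF that]] by (auto simp: c_def)
    have zero: "((\<lambda>u. ?F\<^sub>2 u (c z u)) has_derivative (\<lambda>_. 0)) (at u)" if u: "u \<in> U" for z u
    proof -
      \<comment> \<open>\<Omega> holds the connection coefficients of the first frame; equality of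
        the products forces the same coefficients on the second.\<close>
      define \<Omega> where "\<Omega> = (\<lambda>v k. c (frame_derivative \<pi> f\<^sub>1 N\<^sub>1 x u v k) u)"
      have "frame_derivative \<pi> f\<^sub>1 N\<^sub>1 x u v k = ?F\<^sub>1 u (\<Omega> v k)" for v k
        using c(1)[OF u] by (simp add: \<Omega>_def)
      then have d1: "((\<lambda>u. ?F\<^sub>1 u k) has_derivative (\<lambda>v. ?F\<^sub>1 u (\<Omega> v k))) (at u)" for k
        using frame_has_derivative[OF \<pi> tw(1)[OF \<open>(U, x) \<in> A\<close>] N(1)[OF \<open>(U, x) \<in> A\<close> u] u, of k] by simp
      have "frame_derivative \<pi> f\<^sub>2 N\<^sub>2 x u v k - ?F\<^sub>2 u (\<Omega> v k) = 0" for v k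
      proof (rule \<beta>(3))
        fix w
        obtain l where l: "w = ?F\<^sub>2 u l"
          using surjF(2)[OF u] by (metis surjD)
        have "\<beta> (frame_derivative \<pi> f\<^sub>2 N\<^sub>2 x u v k) (?F\<^sub>2 u l) = \<beta> (frame_derivative \<pi> f\<^sub>1 N\<^sub>1 x u v k) (?F\<^sub>1 u l)"
          by (rule frame_derivative_products_agree[OF \<beta>(1,2) \<pi> smooth_surface_chart(1)[OF smooth \<open>(U, x) \<in> A\<close>] u
                tw(1) tw(2) N(1) N(2) gram proj second, symmetric]) (use \<open>(U, x) \<in> A\<close> in auto)
        also have "\<dots> = \<beta> (?F\<^sub>1 u (\<Omega> v k)) (?F\<^sub>1 u l)"
          using c(1)[OF u] by (simp add: \<Omega>_def)
        also have "\<dots> = \<beta> (?F\<^sub>2 u (\<Omega> v k)) (?F\<^sub>2 u l)"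
          by (rule gram[OF \<open>(U, x) \<in> A\<close> u])
        finally show "\<beta> (frame_derivative \<pi> f\<^sub>2 N\<^sub>2 x u v k - ?F\<^sub>2 u (\<Omega> v k)) w = 0"
          by (simp add: l \<beta>.diff_left)
      qed
      then have "frame_derivative \<pi> f\<^sub>2 N\<^sub>2 x u v k = ?F\<^sub>2 u (\<Omega> v k)" for v k
        by simp
      then have d2: "((\<lambda>u. ?F\<^sub>2 u k) has_derivative (\<lambda>v. ?F\<^sub>2 u (\<Omega> v k))) (at u)" for k
        using frame_has_derivative[OF \<pi> tw(2)[OF \<open>(U, x) \<in> A\<close>] N(2)[OF \<open>(U, x) \<in> A\<close> u] u, of k] by simp
      show ?thesis
        by (rule frame_transport_derivative[where F\<^sub>1 = ?F\<^sub>1 and F\<^sub>2 = ?F\<^sub>2 and W = U and c = "c z" and z = z])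
           (use u lin injF d1 d2 c smooth_surface_chart(1)[OF smooth \<open>(U, x) \<in> A\<close>] in auto)
    qed
    have const: "?F\<^sub>2 u (c z u) = ?F\<^sub>2 u1 (c z u1)" if "u \<in> ball a r" for u z
    proof (rule has_derivative_zero_unique[of "ball a r" "\<lambda>u. ?F\<^sub>2 u (c z u)"])
      fix u assume "u \<in> ball a r"
      then show "((\<lambda>u. ?F\<^sub>2 u (c z u)) has_derivative (\<lambda>_. 0)) (at u within ball a r)"
        using zero[of u z] B has_derivative_at_withinI by blast
    qed (use u1 that in auto)
    have "?F\<^sub>2 u1 k = R (?F\<^sub>1 u1 k)" for k
      using R at_u1 by (simp add: frame_def linear_add[OF R(1)] linear_scale[OF R(1)])
    then have F: "?F\<^sub>2 u k = R (?F\<^sub>1 u k)" if "u \<in> ball a r" for u k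
      using const[OF that, of "?F\<^sub>1 u k"] c(2)[of u k] c(1)[of u1] that B u1 by (auto simp: subset_eq)
    have 0: "differential (f\<^sub>1 \<circ> x) u 0 = 0" "differential (f\<^sub>2 \<circ> x) u 0 = 0" if "u \<in> U" for u
      using linear_0[OF linear_frechet_derivative] diff that by auto
    have Nu: "N\<^sub>2 (x u) = R (N\<^sub>1 (x u))"
      using F[OF u, of "(0, 1, 0)"] 0[of u] B u by (auto simp: frame_def)
    have df: "differential (f\<^sub>2 \<circ> x) u w = R (differential (f\<^sub>1 \<circ> x) u w)" if "u \<in> ball a r" for u w
      using F[OF that, of "(0, 0, w)"] by (simp add: frame_def)
    have "((\<lambda>u. (f\<^sub>2 \<circ> x) u - R ((f\<^sub>1 \<circ> x) u)) has_derivative (\<lambda>w. 0)) (at u within ball a r)" if "u \<in> ball a r" for u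
    proof -
      have "((\<lambda>u. (f\<^sub>2 \<circ> x) u - R ((f\<^sub>1 \<circ> x) u)) has_derivative
          (\<lambda>w. differential (f\<^sub>2 \<circ> x) u w - R (differential (f\<^sub>1 \<circ> x) u w))) (at u)"
        using diff[of u] that B
        by (intro has_derivative_diff bounded_linear.has_derivative[OF bR] has_derivative_differential)
             (auto simp: o_def subset_eq)
      then show ?thesis
        by (simp add: df[OF that] has_derivative_at_withinI)
    qed
    \<comment> \<open>The frame contains only the part \<pi> of the position, which in the product
      omits the height. The position itself is recovered by integrating its differential.\<close>
    from has_derivative_zero_unique[OF convex_ball this u u1]
    have "(f\<^sub>2 \<circ> x) u - R ((f\<^sub>1 \<circ> x) u) = (f\<^sub>2 \<circ> x) u1 - R ((f\<^sub>1 \<circ> x) u1)" .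
    then show ?thesis
      using Nu at_u1(1) by simp
  qed
  \<comment> \<open>Agreement is demanded on a neighbourhood, so that differentiating it gives
    agreement of the differentials and the transport can start afresh at any point.\<close>
  define P where "P = (\<lambda>p. \<exists>T. openin (top_of_set M) T \<and> p \<in> T \<and> (\<forall>q\<in>T. f\<^sub>2 q = R (f\<^sub>1 q) \<and> N\<^sub>2 q = R (N\<^sub>1 q)))"
  have all: "P (x u)"
    if c: "(U, x) \<in> A" and B: "ball a r \<subseteq> U" and u1: "u1 \<in> ball a r" and u: "u \<in> ball a r"
      and at_u1: "f\<^sub>2 (x u1) = R (f\<^sub>1 (x u1))" "N\<^sub>2 (x u1) = R (N\<^sub>1 (x u1))"
        "\<And>w. differential (f\<^sub>2 \<circ> x) u1 w = R (differential (f\<^sub>1 \<circ> x) u1 w)"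
    for U x a r u1 u
    unfolding P_def
    using local[OF c B u1 _ at_u1] smooth_surface_chart(5)[OF smooth c open_ball B] u
    by (intro exI[of _ "x ` ball a r"]) auto
  have "P p"
  proof (rule locally_constant_on_connected[where P = P, OF smooth connected _ _ _ p])
    show "x\<^sub>0 u\<^sub>0 \<in> M"
      using smooth_surface_chart(4)[OF smooth base(1)] base(2) by blast
    obtain r where "r > 0" "ball u\<^sub>0 r \<subseteq> U\<^sub>0"
      using smooth_surface_chart(1)[OF smooth base(1)] base(2) openE by blast
    then show "P (x\<^sub>0 u\<^sub>0)"
      using all[OF base(1) _ _ _ base(3-5)] by simp
  next
    fix U x u assume c: "(U, x) \<in> A" and u: "u \<in> U"
    obtain r where r: "r > 0" "ball u r \<subseteq> U"
      using smooth_surface_chart(1)[OF smooth c] u openE by blast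
    have spread: "P (x u')" if u1: "u1 \<in> ball u r" "P (x u1)" and u': "u' \<in> ball u r" for u1 u'
    proof -
      obtain T where T: "openin (top_of_set M) T" "x u1 \<in> T" "\<And>q. q \<in> T \<Longrightarrow> f\<^sub>2 q = R (f\<^sub>1 q) \<and> N\<^sub>2 q = R (N\<^sub>1 q)"
        using u1(2) by (auto simp: P_def)
      obtain T' where T': "open T'" "T = M \<inter> T'"
        using T(1) by (auto simp: openin_open)
      have "open (U \<inter> x -` T')"
        using continuous_open_preimage smooth_surface_chart[OF smooth c] T'(1) by blast
      moreover have u1U: "u1 \<in> U \<inter> x -` T'"
        using u1 r T(2) T'(2) by auto
      moreover have "(f\<^sub>2 \<circ> x) w = R ((f\<^sub>1 \<circ> x) w)" if "w \<in> U \<inter> x -` T'" for w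
        using T(3)[of "x w"] T'(2) that smooth_surface_chart(4)[OF smooth c] by auto
      ultimately have "differential (f\<^sub>2 \<circ> x) u1 = differential (\<lambda>w. R ((f\<^sub>1 \<circ> x) w)) u1"
        by (rule differential_cong_open)
      also have "\<dots> = (\<lambda>w. R (differential (f\<^sub>1 \<circ> x) u1 w))"
        using tw(1)[OF c] u1U by (intro differential_linear_compose(2)[OF bR]) (auto simp: twice_differentiable_on_def o_def)
      finally show ?thesis
        using all[OF c r(2) u1(1) u'] T(2,3) by simp
    qed
    show "\<exists>W. open W \<and> u \<in> W \<and> W \<subseteq> U \<and> (\<forall>u'\<in>W. P (x u') \<longleftrightarrow> P (x u))"
      using r spread by (intro exI[of _ "ball u r"]) (auto intro: spread[of _ u] spread[of u])
  qed
  then show ?thesis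
    by (auto simp: P_def)
qed

end

section \<open>The complex structure of \<open>\<complex>\<^sup>2\<close>\<close>

lemma hopf_linear: "linear hopf_field"
  by (rule linearI) (simp_all add: hopf_field_def algebra_simps)

lemma hopf_simps [simp]:
  "hopf_field (X + Y) = hopf_field X + hopf_field Y"
  "hopf_field (X - Y) = hopf_field X - hopf_field Y"
  "hopf_field (- X) = - hopf_field X"
  "hopf_field (r *\<^sub>R X) = r *\<^sub>R hopf_field X"
  "hopf_field 0 = 0"
  "hopf_field (hopf_field X) = - X"
  by (simp_all add: hopf_field_def algebra_simps prod_eq_iff)

lemma hopf_isometry [simp]: "hopf_field X \<bullet> hopf_field Y = X \<bullet> Y"
  by (simp add: hopf_field_def inner_prod_def inner_complex_def)

lemma hopf_orthogonal [simp]: "hopf_field X \<bullet> X = 0" "X \<bullet> hopf_field X = 0"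
  by (simp_all add: hopf_field_def inner_prod_def inner_complex_def)

lemma hopf_skew: "X \<bullet> hopf_field Y = - (hopf_field X \<bullet> Y)"
  by (simp add: hopf_field_def inner_prod_def inner_complex_def)

lemma hopf_bounded_linear: "bounded_linear hopf_field"
  using hopf_linear by (simp add: linear_conv_bounded_linear)

definition cscale :: "complex \<Rightarrow> complex \<times> complex \<Rightarrow> complex \<times> complex" where
  "cscale c X = (c * fst X, c * snd X)"

text \<open>An orthonormal pair spanning a Lagrangian plane of \<open>\<complex>\<^sup>2\<close>; equivalently a horizontal unit
  vector \<open>e\<close> at the point \<open>a\<close> of the sphere.\<close>

definition legendrian :: "complex \<times> complex \<Rightarrow> complex \<times> complex \<Rightarrow> bool" where
  "legendrian a e \<longleftrightarrow> a \<bullet> a = 1 \<and> e \<bullet> e = 1 \<and> a \<bullet> e = 0 \<and> e \<bullet> hopf_field a = 0"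

lemma legendrianD:
  assumes "legendrian a e"
  shows "a \<bullet> a = 1" "e \<bullet> e = 1" "a \<bullet> e = 0" "e \<bullet> a = 0" "e \<bullet> hopf_field a = 0"
    "hopf_field a \<bullet> e = 0" "a \<bullet> hopf_field e = 0" "hopf_field e \<bullet> a = 0"
  using assms by (auto simp: legendrian_def inner_commute hopf_skew[of a e])

text \<open>The Lagrangian condition makes a, i a, e, i e orthonormal, hence a basis of the real
  space of dimension 4.\<close>

lemma legendrian_expansion:
  assumes "legendrian a e"
  shows "X = (X \<bullet> a) *\<^sub>R a + (X \<bullet> hopf_field a) *\<^sub>R hopf_field a + (X \<bullet> e) *\<^sub>R e
    + (X \<bullet> hopf_field e) *\<^sub>R hopf_field e"
proof -
  note [simp] = legendrianD[OF assms]
  define f where "f = (\<lambda>z::complex \<times> complex. Re (fst z) *\<^sub>R a + Im (fst z) *\<^sub>R hopf_field a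
    + Re (snd z) *\<^sub>R e + Im (snd z) *\<^sub>R hopf_field e)"
  have f: "linear f"
    by (rule linearI) (simp_all add: f_def algebra_simps)
  have coords: "f z \<bullet> a = Re (fst z)" "f z \<bullet> hopf_field a = Im (fst z)"
    "f z \<bullet> e = Re (snd z)" "f z \<bullet> hopf_field e = Im (snd z)" for z
    by (simp_all add: f_def inner_add_left)
  have "z = 0" if "f z = 0" for z
    using coords[of z] that by (simp add: prod_eq_iff complex_eq_iff)
  then have "inj f"
    using f linear_injective_0 by blast
  then have "surj f"
    using f linear_injective_imp_surjective by blast
  then obtain z where z: "X = f z"
    by (metis surjD)
  show ?thesis
    unfolding z coords by (simp add: f_def)
qed

definition plane_reflection :: "complex \<times> complex \<Rightarrow> complex \<times> complex \<Rightarrow> complex \<times> complex \<Rightarrow> complex \<times> complex" where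
  "plane_reflection a e X = (2 * (X \<bullet> a)) *\<^sub>R a + (2 * (X \<bullet> e)) *\<^sub>R e - X"

lemma plane_reflection_linear: "linear (plane_reflection a e)"
  by (rule linearI) (simp_all add: plane_reflection_def algebra_simps)

lemma plane_reflection_bounded_linear: "bounded_linear (plane_reflection a e)"
  using plane_reflection_linear by (simp add: linear_conv_bounded_linear)

lemma plane_reflection_isometry:
  assumes "legendrian a e"
  shows "plane_reflection a e X \<bullet> plane_reflection a e Y = X \<bullet> Y"
  by (simp add: plane_reflection_def algebra_simps legendrianD[OF assms] inner_commute[of a X] inner_commute[of e X]
      inner_commute[of a Y] inner_commute[of e Y])

lemma plane_reflection_fixes:
  assumes "legendrian a e"
  shows "plane_reflection a e a = a" "plane_reflection a e e = e"
  by (simp_all add: plane_reflection_def legendrianD[OF assms] scaleR_2)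

lemma plane_reflection_fixed:
  assumes "plane_reflection a e X = X"
  shows "X = (X \<bullet> a) *\<^sub>R a + (X \<bullet> e) *\<^sub>R e"
proof -
  have "2 *\<^sub>R X = 2 *\<^sub>R ((X \<bullet> a) *\<^sub>R a + (X \<bullet> e) *\<^sub>R e)"
    using assms by (simp add: plane_reflection_def algebra_simps scaleR_2)
  then show ?thesis
    by simp
qed

text \<open>Multiplication by i carries a Lagrangian plane to its orthogonal complement, so it
  exchanges the eigenspaces of the reflection for 1 and -1.\<close>

lemma plane_reflection_hopf:
  assumes "legendrian a e"
  shows "plane_reflection a e (hopf_field X) = - hopf_field (plane_reflection a e X)"
proof -
  have eq: "hopf_field X = (hopf_field X \<bullet> a) *\<^sub>R a + (X \<bullet> a) *\<^sub>R hopf_field a + (hopf_field X \<bullet> e) *\<^sub>R e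
    + (X \<bullet> e) *\<^sub>R hopf_field e"
    using legendrian_expansion[OF assms, of "hopf_field X"] by simp
  have "2 *\<^sub>R hopf_field X = (2 * (hopf_field X \<bullet> a)) *\<^sub>R a + (2 * (X \<bullet> a)) *\<^sub>R hopf_field a
     + (2 * (hopf_field X \<bullet> e)) *\<^sub>R e + (2 * (X \<bullet> e)) *\<^sub>R hopf_field e"
    using arg_cong[OF eq, of "scaleR 2"] by (simp only: scaleR_add_right scaleR_scaleR)
  then show ?thesis
    by (simp add: plane_reflection_def scaleR_2 algebra_simps)
qed

section \<open>The Berger metric\<close>

lemma tangent_space_sphere:
  fixes p :: "'e::euclidean_space"
  assumes "p \<in> sphere 0 1"
  shows "tangent_space (sphere 0 1) p = {v. v \<bullet> p = 0}"
proof (intro set_eqI iffI)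
  fix v assume "v \<in> tangent_space (sphere 0 1) p"
  then obtain c where c: "\<And>s::real. c s \<in> sphere 0 1" "c 0 = p" "(c has_vector_derivative v) (at 0)"
    by (auto simp: tangent_space_def)
  have "((\<lambda>s. c s \<bullet> c s) has_derivative (\<lambda>s. c 0 \<bullet> (s *\<^sub>R v) + (s *\<^sub>R v) \<bullet> c 0)) (at 0)"
    using c(3) by (intro has_derivative_inner) (simp_all add: has_vector_derivative_def)
  moreover have "c s \<bullet> c s = 1" for s
    using c(1)[of s] by (simp add: dot_square_norm)
  ultimately have "((\<lambda>s::real. 1::real) has_derivative (\<lambda>s. c 0 \<bullet> (s *\<^sub>R v) + (s *\<^sub>R v) \<bullet> c 0)) (at 0)"
    by simp
  from has_derivative_unique[OF this has_derivative_const]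
  have "c 0 \<bullet> (1 *\<^sub>R v) + (1 *\<^sub>R v) \<bullet> c 0 = 0"
    by (rule fun_cong)
  then show "v \<in> {v. v \<bullet> p = 0}"
    using c(2) by (simp add: inner_commute)
next
  fix v assume "v \<in> {v. v \<bullet> p = 0}"
  then have v: "v \<bullet> p = 0" "p \<bullet> v = 0"
    by (auto simp: inner_commute)
  have p: "p \<bullet> p = 1"
    using assms by (simp add: dot_square_norm)
  \<comment> \<open>The line \<open>p + s *\<^sub>R v\<close> projected radially to the sphere; it
    is defined for all s, as \<open>tangent_space\<close> demands.\<close>
  define c where "c = (\<lambda>s. (1 / sqrt (1 + s\<^sup>2 * (v \<bullet> v))) *\<^sub>R (p + s *\<^sub>R v))"
  have pos: "1 + s\<^sup>2 * (v \<bullet> v) > 0" for s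
    by (simp add: add_pos_nonneg)
  have "c s \<bullet> c s = 1" for s
    using pos[of s] by (simp add: c_def inner_add_left inner_add_right v p power2_eq_square[symmetric] field_simps)
  then have "c s \<in> sphere 0 1" for s
    by (simp add: norm_eq_sqrt_inner)
  moreover have "c 0 = p"
    by (simp add: c_def)
  moreover have "(c has_vector_derivative v) (at 0)"
    unfolding c_def by (auto intro!: derivative_eq_intros simp: field_simps)
  ultimately show "v \<in> tangent_space (sphere 0 1) p"
    by (auto simp: tangent_space_def)
qed

lemma tangent_space_S3: "p \<in> S3 \<Longrightarrow> tangent_space S3 p = {v. v \<bullet> p = 0}"
  by (rule tangent_space_sphere)

locale berger =
  fixes \<kappa> \<tau> :: real
  assumes \<kappa>_pos: "\<kappa> > 0" and \<tau>_nz: "\<tau> \<noteq> 0"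
begin

definition b :: real where "b = 4 * \<tau>\<^sup>2 / \<kappa> - 1"

abbreviation g :: "(complex \<times> complex) metric" where "g \<equiv> berger_metric \<kappa> \<tau>"

lemma \<kappa>_nz: "\<kappa> \<noteq> 0"
  using \<kappa>_pos by simp

lemma b_pos: "1 + b > 0"
  using \<kappa>_pos \<tau>_nz by (simp add: b_def)

lemma g_eq: "g p X Y = 4 / \<kappa> * (X \<bullet> Y + b * (X \<bullet> hopf_field p) * (Y \<bullet> hopf_field p))"
  by (simp add: berger_metric_def b_def)

lemma g_vertical:
  assumes "p \<bullet> p = 1"
  shows "g p X (hopf_field p) = 4 / \<kappa> * (1 + b) * (X \<bullet> hopf_field p)"
  using assms \<kappa>_nz by (simp add: g_eq field_simps)

text \<open>Each derivative of the metric contributes two products. Because multiplication by i is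
  skew, the two products containing \<open>Z \<bullet> hopf_field p\<close> cancel and the other
  four agree in pairs.\<close>

lemma christoffel_g:
  "christoffel g p X Y Z = 4 / \<kappa> * b * ((Y \<bullet> hopf_field p) * (Z \<bullet> hopf_field X) + (X \<bullet> hopf_field p) * (Z \<bullet> hopf_field Y))"
proof -
  have d: "deriv (\<lambda>s. g (p + s *\<^sub>R X) Y Z) 0
      = 4 / \<kappa> * b * ((Y \<bullet> hopf_field X) * (Z \<bullet> hopf_field p) + (Y \<bullet> hopf_field p) * (Z \<bullet> hopf_field X))" for X Y Z
    unfolding g_eq
    by (rule DERIV_imp_deriv) (auto intro!: derivative_eq_intros simp: \<kappa>_nz inner_add_right algebra_simps)
  show ?thesis
    unfolding christoffel_def d
    by (simp add: hopf_skew[of Y X] hopf_skew[of X Z] hopf_skew[of Y Z] inner_commute[of "hopf_field X"] inner_commute[of "hopf_field Y"]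
        algebra_simps add_divide_distrib diff_divide_distrib)
qed

text \<open>An antilinear isometry changes the sign of every pairing
  \<open>X \<bullet> hopf_field Y\<close>, and such pairings occur only in products of two.\<close>

lemma g_plane_reflection:
  assumes "legendrian a e"
  shows "g (plane_reflection a e p) (plane_reflection a e X) (plane_reflection a e Y) = g p X Y"
    and "christoffel g (plane_reflection a e p) (plane_reflection a e X) (plane_reflection a e Y) (plane_reflection a e Z)
      = christoffel g p X Y Z"
proof -
  have *: "plane_reflection a e X \<bullet> hopf_field (plane_reflection a e Y) = - (X \<bullet> hopf_field Y)" for X Y
    using plane_reflection_hopf[OF assms, of Y] plane_reflection_isometry[OF assms, of X "hopf_field Y"]
    by (metis add.inverse_inverse inner_minus_right)
  show "g (plane_reflection a e p) (plane_reflection a e X) (plane_reflection a e Y) = g p X Y"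
    by (simp add: g_eq * plane_reflection_isometry[OF assms])
  show "christoffel g (plane_reflection a e p) (plane_reflection a e X) (plane_reflection a e Y) (plane_reflection a e Z)
      = christoffel g p X Y Z"
    by (simp add: christoffel_g *)
qed

end

section \<open>Geodesics of the Berger sphere\<close>

lemma has_vector_derivative_hopf:
  "(c has_vector_derivative v) (at t) \<Longrightarrow> ((\<lambda>t. hopf_field (c t)) has_vector_derivative hopf_field v) (at t)"
  by (rule bounded_linear.has_vector_derivative[OF hopf_bounded_linear])

lemma has_vector_derivative_inner:
  "(c has_vector_derivative v) (at t) \<Longrightarrow> (d has_vector_derivative w) (at t) \<Longrightarrow>
    ((\<lambda>t. c t \<bullet> d t) has_real_derivative v \<bullet> d t + c t \<bullet> w) (at t)"
  unfolding has_vector_derivative_def has_field_derivative_def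
  by (rule has_derivative_eq_rhs[OF has_derivative_inner]) (auto simp: fun_eq_iff algebra_simps)

text \<open>Writing \<delta> = exp(- i m t) y turns the equation into y'' = - (K + m^2) y, and
  \<eta> becomes exp(- i m t) y'. The conserved quantity W is the energy of this oscillator,
  positive definite by the hypothesis on K + m^2.\<close>

lemma linear_ode_zero:
  fixes \<delta> :: "real \<Rightarrow> complex \<times> complex"
  assumes d: "\<And>t. (\<delta> has_vector_derivative \<delta>' t) (at t)"
    and d': "\<And>t. (\<delta>' has_vector_derivative - (2 * m) *\<^sub>R hopf_field (\<delta>' t) - K *\<^sub>R \<delta> t) (at t)"
    and K: "K + m\<^sup>2 > 0" and init: "\<delta> 0 = 0" "\<delta>' 0 = 0"
  shows "\<delta> t = 0"
proof -
  define \<eta> where "\<eta> = (\<lambda>t. \<delta>' t + m *\<^sub>R hopf_field (\<delta> t))"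
  define W where "W = (\<lambda>t. \<eta> t \<bullet> \<eta> t + (K + m\<^sup>2) * (\<delta> t \<bullet> \<delta> t))"
  have two: "- (2 * m) *\<^sub>R X = (- m) *\<^sub>R X + (- m) *\<^sub>R X" for X :: "complex \<times> complex"
    unfolding scaleR_add_left[symmetric] by simp
  have \<eta>: "(\<eta> has_vector_derivative (- m) *\<^sub>R hopf_field (\<delta>' t) - K *\<^sub>R \<delta> t) (at t)" for t
    unfolding \<eta>_def
    by (rule has_vector_derivative_eq_rhs[OF has_vector_derivative_add[OF d'
          bounded_linear.has_vector_derivative[OF bounded_linear_scaleR_right has_vector_derivative_hopf[OF d]]]])
       (simp only: two, simp)
  have key: "((- m) *\<^sub>R hopf_field (\<delta>' t) - K *\<^sub>R \<delta> t) \<bullet> \<eta> t = - (K + m\<^sup>2) * (\<delta>' t \<bullet> \<delta> t)" for t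
    by (simp add: \<eta>_def inner_add_right inner_diff_left inner_commute[of "\<delta> t" "\<delta>' t"]
        power2_eq_square algebra_simps)
  have "(W has_real_derivative 0) (at t)" for t
    unfolding W_def
    by (rule DERIV_cong[OF DERIV_add[OF has_vector_derivative_inner[OF \<eta> \<eta>]
          DERIV_cmult[OF has_vector_derivative_inner[OF d d]]]])
       (simp only: inner_commute[of "\<eta> t"] inner_commute[of "\<delta> t" "\<delta>' t"] key, simp add: algebra_simps)
  then have "W t = W 0"
    using DERIV_isconst_all by blast
  then have "\<eta> t \<bullet> \<eta> t + (K + m\<^sup>2) * (\<delta> t \<bullet> \<delta> t) = 0"
    using init by (simp add: W_def \<eta>_def)
  moreover have "\<eta> t \<bullet> \<eta> t \<ge> 0" "(K + m\<^sup>2) * (\<delta> t \<bullet> \<delta> t) \<ge> 0"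
    using K by simp_all
  ultimately have "(K + m\<^sup>2) * (\<delta> t \<bullet> \<delta> t) = 0"
    by linarith
  then show ?thesis
    using K by simp
qed

lemma linear_ode_unique:
  fixes c d :: "real \<Rightarrow> complex \<times> complex"
  assumes "\<And>t. (c has_vector_derivative c' t) (at t)" "\<And>t. (d has_vector_derivative d' t) (at t)"
    and "\<And>t. (c' has_vector_derivative - (2 * m) *\<^sub>R hopf_field (c' t) - K *\<^sub>R c t) (at t)"
    and "\<And>t. (d' has_vector_derivative - (2 * m) *\<^sub>R hopf_field (d' t) - K *\<^sub>R d t) (at t)"
    and K: "K + m\<^sup>2 > 0" and init: "c 0 = d 0" "c' 0 = d' 0"
  shows "c t = d t"
proof -
  have "(\<lambda>t. c t - d t) t = 0"
  proof (rule linear_ode_zero[OF _ _ K])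
    show "((\<lambda>t. c t - d t) has_vector_derivative c' t - d' t) (at t)" for t
      by (intro has_vector_derivative_diff assms)
    show "((\<lambda>t. c' t - d' t) has_vector_derivative
        - (2 * m) *\<^sub>R hopf_field (c' t - d' t) - K *\<^sub>R (c t - d t)) (at t)" for t
      by (rule has_vector_derivative_eq_rhs[OF has_vector_derivative_diff[OF assms(3,4)]])
         (simp add: algebra_simps)
  qed (use init in auto)
  then show ?thesis
    by simp
qed

section \<open>The geodesic equation of the Berger sphere\<close>

context berger
begin

text \<open>The pairing a of the velocity with the Hopf field is constant, as that field is Killing,
  and with a constant the geodesic equation becomes linear. The coefficient of the position is
  forced by the curve staying on the sphere.\<close>

lemma geodesic_ode:
  assumes "geodesic S3 g c"
  obtains a k where "\<And>t. (c has_vector_derivative velocity c t) (at t)"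
    "\<And>t. (velocity c has_vector_derivative - (2 * (b * a)) *\<^sub>R hopf_field (velocity c t) - (k + 2 * b * a\<^sup>2) *\<^sub>R c t) (at t)"
    "\<And>t. velocity c t \<bullet> hopf_field (c t) = a" "\<And>t. velocity c t \<bullet> velocity c t = k"
    "(k + 2 * b * a\<^sup>2) + (b * a)\<^sup>2 > 0" "\<And>t. c t \<bullet> c t = 1" "\<And>t. c t \<bullet> velocity c t = 0"
proof -
  define v where "v = velocity c"
  have tw: "twice_differentiable_on UNIV c"
    using assms smooth_on_imp_twice_differentiable_on by (auto simp: geodesic_def)
  have diff: "c differentiable (at t)" for t
    using tw by (auto simp: twice_differentiable_on_def)
  have dc: "(c has_vector_derivative v t) (at t)" for t
    using diff by (simp add: v_def vector_derivative_works[symmetric])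
  have v1: "differential c t = (\<lambda>r. r *\<^sub>R v t)" for t
    using frechet_derivative_eq_vector_derivative[OF diff] by (simp add: v_def)
  have "(\<lambda>t. differential c t 1) differentiable (at t)" for t
    using tw by (auto simp: twice_differentiable_on_def)
  then have vdiff: "v differentiable (at t)" for t
    by (simp add: v1)
  define q where "q = (\<lambda>t. velocity v t)"
  have dv: "(v has_vector_derivative q t) (at t)" for t
    using vdiff by (simp add: q_def vector_derivative_works[symmetric])
  have q1: "differential v t = (\<lambda>r. r *\<^sub>R q t)" for t
    using frechet_derivative_eq_vector_derivative[OF vdiff] by (simp add: q_def)
  have S: "c t \<in> S3" and v0: "v t \<noteq> 0" and cov: "has_covariant_derivative S3 g c v t 1 0" for t
    using assms by (auto simp: geodesic_def v_def)
  have cc: "c t \<bullet> c t = 1" for t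
    using S[of t] by (simp add: dot_square_norm)
  have cv: "c t \<bullet> v t = 0" for t
  proof -
    have "((\<lambda>t. c t \<bullet> c t) has_real_derivative v t \<bullet> c t + c t \<bullet> v t) (at t)"
      by (rule has_vector_derivative_inner[OF dc dc])
    then have "((\<lambda>t. 1) has_real_derivative v t \<bullet> c t + c t \<bullet> v t) (at t)"
      by (simp add: cc)
    from DERIV_unique[OF this DERIV_const] show ?thesis
      by (simp add: inner_commute)
  qed
  have cq: "c t \<bullet> q t = - (v t \<bullet> v t)" for t
  proof -
    have "((\<lambda>t. c t \<bullet> v t) has_real_derivative v t \<bullet> v t + c t \<bullet> q t) (at t)"
      by (rule has_vector_derivative_inner[OF dc dv])
    then have "((\<lambda>t. 0) has_real_derivative v t \<bullet> v t + c t \<bullet> q t) (at t)"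
      by (simp add: cv)
    from DERIV_unique[OF this DERIV_const] show ?thesis
      by simp
  qed
  have eq: "q t \<bullet> Z + b * (q t \<bullet> hopf_field (c t)) * (Z \<bullet> hopf_field (c t))
      + 2 * b * (v t \<bullet> hopf_field (c t)) * (Z \<bullet> hopf_field (v t)) = 0" if "Z \<bullet> c t = 0" for Z t
  proof -
    have "g (c t) 0 Z = g (c t) (1 *\<^sub>R q t) Z + christoffel g (c t) (1 *\<^sub>R v t) (v t) Z"
      using cov[of t] that unfolding has_covariant_derivative_def tangent_space_S3[OF S] v1 q1 by blast
    then have "4 / \<kappa> * (q t \<bullet> Z + b * (q t \<bullet> hopf_field (c t)) * (Z \<bullet> hopf_field (c t))
      + 2 * b * (v t \<bullet> hopf_field (c t)) * (Z \<bullet> hopf_field (v t))) = 0"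
      by (simp add: g_eq christoffel_g algebra_simps)
    then show ?thesis
      using \<kappa>_pos by simp
  qed
  have qV: "q t \<bullet> hopf_field (c t) = 0" for t
  proof -
    have "(1 + b) * (q t \<bullet> hopf_field (c t)) = 0"
      using eq[where Z = "hopf_field (c t)" and t = t] cc[of t] cv[of t] by (simp add: algebra_simps)
    then show ?thesis
      using b_pos by simp
  qed
  have qv: "q t \<bullet> v t = 0" for t
    using eq[of "v t" t] qV[of t] cv[of t] by (simp add: inner_commute)
  define a where "a = v 0 \<bullet> hopf_field (c 0)"
  define k where "k = v 0 \<bullet> v 0"
  have a: "v t \<bullet> hopf_field (c t) = a" for t
  proof -
    have "((\<lambda>t. v t \<bullet> hopf_field (c t)) has_real_derivative 0) (at t)" for t
      using has_vector_derivative_inner[OF dv has_vector_derivative_hopf[OF dc], of t] by (simp add: qV)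
    then show ?thesis
      unfolding a_def using DERIV_isconst_all by blast
  qed
  have k: "v t \<bullet> v t = k" for t
  proof -
    have "((\<lambda>t. v t \<bullet> v t) has_real_derivative 0) (at t)" for t
      using has_vector_derivative_inner[OF dv dv, of t] by (simp add: qv inner_commute[of "v t"])
    then show ?thesis
      unfolding k_def using DERIV_isconst_all by blast
  qed
  have q: "q t = - (2 * (b * a)) *\<^sub>R hopf_field (v t) - (k + 2 * b * a\<^sup>2) *\<^sub>R c t" for t
  proof -
    \<comment> \<open>The defect w of the claimed equation is tangent to the sphere, so it may serve
      as its own test vector Z in \<open>eq\<close>.\<close>
    define w where "w = q t + (2 * (b * a)) *\<^sub>R hopf_field (v t) + (k + 2 * b * a\<^sup>2) *\<^sub>R c t"
    have "hopf_field (v t) \<bullet> c t = - a"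
      using a[of t] by (simp add: hopf_skew)
    then have wc: "w \<bullet> c t = 0"
      using cq[of t] k[of t] cc[of t]
      by (simp add: w_def inner_add_left inner_add_right inner_commute power2_eq_square algebra_simps)
    have "w \<bullet> w = (q t + (2 * (b * a)) *\<^sub>R hopf_field (v t)) \<bullet> w + (k + 2 * b * a\<^sup>2) * (c t \<bullet> w)"
      by (subst (1) w_def) (simp only: inner_add_left inner_scaleR_left)
    also have "\<dots> = (q t + (2 * (b * a)) *\<^sub>R hopf_field (v t)) \<bullet> w"
      using wc by (simp add: inner_commute)
    also have "\<dots> = 0"
      using eq[OF wc] by (simp add: qV a inner_add_right inner_commute)
    finally have "w = 0"
      by simp
    moreover have "q t = w - (2 * (b * a)) *\<^sub>R hopf_field (v t) - (k + 2 * b * a\<^sup>2) *\<^sub>R c t"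
      by (simp add: w_def)
    ultimately show ?thesis
      by simp
  qed
  \<comment> \<open>With m = b a this is the condition \<open>K + m\<^sup>2 > 0\<close> of
    \<open>linear_ode_unique\<close>; the difference k - a^2 is nonnegative by the Cauchy-Schwarz
    inequality.\<close>
  have pos: "(k + 2 * b * a\<^sup>2) + (b * a)\<^sup>2 > 0"
  proof -
    have k0: "k > 0"
      using v0[of 0] by (simp add: k_def)
    have "a\<^sup>2 \<le> k"
      using Cauchy_Schwarz_ineq[of "v 0" "hopf_field (c 0)"] cc[of 0] by (simp add: a_def k_def)
    moreover have "(k + 2 * b * a\<^sup>2) + (b * a)\<^sup>2 = (k - a\<^sup>2) + (1 + b)\<^sup>2 * a\<^sup>2"
      by (simp add: power2_eq_square algebra_simps)
    moreover have "a \<noteq> 0 \<Longrightarrow> (1 + b)\<^sup>2 * a\<^sup>2 > 0"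
      using b_pos by simp
    ultimately show ?thesis
      using k0 by (cases "a = 0") auto
  qed
  show thesis
    using that[of a k] dc dv a k pos q cc cv unfolding v_def by metis
qed

text \<open>K may be any number because K c is orthogonal to the sphere and drops out against
  tangent vectors.\<close>

lemma geodesicI:
  assumes "smooth_on UNIV c"
    and dc: "\<And>t. (c has_vector_derivative v t) (at t)"
    and dv: "\<And>t. (v has_vector_derivative - (2 * (b * a)) *\<^sub>R hopf_field (v t) - K *\<^sub>R c t) (at t)"
    and a: "\<And>t. v t \<bullet> hopf_field (c t) = a" and S: "\<And>t. c t \<bullet> c t = 1" and v0: "\<And>t. v t \<noteq> 0"
    and cv: "\<And>t. c t \<bullet> v t = 0"
  shows "geodesic S3 g c"
proof -
  have v: "velocity c = v" "velocity c t = v t" for t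
    using vector_derivative_at[OF dc] by blast+
  have S3: "c t \<in> S3" for t
    using S[of t] by (simp add: norm_eq_sqrt_inner)
  have c1: "differential c t 1 = v t" for t
    using frechet_derivative_eq_vector_derivative[OF differentiableI_vector[OF dc]] vector_derivative_at[OF dc] by simp
  have v1: "differential v t 1 = - (2 * (b * a)) *\<^sub>R hopf_field (v t) - K *\<^sub>R c t" for t
    using frechet_derivative_eq_vector_derivative[OF differentiableI_vector[OF dv]] vector_derivative_at[OF dv] by simp
  have "has_covariant_derivative S3 g c v t 1 0" for t
    unfolding has_covariant_derivative_def tangent_space_S3[OF S3] c1 v1
  proof (intro conjI ballI)
    fix Z assume "Z \<in> {v. v \<bullet> c t = 0}"
    then have Z: "Z \<bullet> c t = 0" "c t \<bullet> Z = 0"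
      by (auto simp: inner_commute)
    have "v t \<bullet> c t = 0" "Z \<bullet> hopf_field (v t) = hopf_field (v t) \<bullet> Z"
      using cv[of t] by (simp_all add: inner_commute)
    then show "g (c t) 0 Z = g (c t) (- (2 * (b * a)) *\<^sub>R hopf_field (v t) - K *\<^sub>R c t) Z + christoffel g (c t) (v t) (v t) Z"
      by (simp add: g_eq christoffel_g Z a inner_diff_left algebra_simps)
  qed simp
  then show ?thesis
    using assms(1) v0 S3 by (simp add: geodesic_def v)
qed

end

section \<open>Reflections around horizontal geodesics\<close>

context berger
begin

text \<open>Reversing time and applying the antilinear reflection each change the sign of the
  first-order term, so together they preserve the linear geodesic equation. The initial data agree
  as well: the reflection fixes \<alpha> 0 and negates the velocity, which is orthogonal to \<alpha>
  0 and e.\<close>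

lemma geodesic_flip:
  assumes \<alpha>: "geodesic S3 g \<alpha>" and leg: "legendrian (\<alpha> 0) e" and orth: "velocity \<alpha> 0 \<bullet> e = 0"
  shows "plane_reflection (\<alpha> 0) e (\<alpha> s) = \<alpha> (- s)"
proof -
  let ?L = "plane_reflection (\<alpha> 0) e" and ?v = "velocity \<alpha>"
  obtain a k where d: "\<And>t. (\<alpha> has_vector_derivative ?v t) (at t)"
    and dv: "\<And>t. (?v has_vector_derivative - (2 * (b * a)) *\<^sub>R hopf_field (?v t) - (k + 2 * b * a\<^sup>2) *\<^sub>R \<alpha> t) (at t)"
    and pos: "(k + 2 * b * a\<^sup>2) + (b * a)\<^sup>2 > 0" and cv: "\<And>t. \<alpha> t \<bullet> ?v t = 0"
    by (rule geodesic_ode[OF \<alpha>]) blast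
  define K where "K = k + 2 * b * a\<^sup>2"
  have neg: "((\<lambda>t. ?L (c (- t))) has_vector_derivative - ?L (c' (- t))) (at t)"
    if "\<And>t. (c has_vector_derivative c' t) (at t)" for c c' t
  proof -
    have "(uminus has_vector_derivative (- 1 :: real)) (at t)"
      by (auto intro!: derivative_eq_intros)
    from vector_diff_chain_at[OF this that] have "((\<lambda>t. c (- t)) has_vector_derivative - c' (- t)) (at t)"
      by (simp add: o_def)
    from bounded_linear.has_vector_derivative[OF plane_reflection_bounded_linear this] show ?thesis
      by (simp add: linear_neg[OF plane_reflection_linear])
  qed
  have "?L (\<alpha> (- t)) = \<alpha> t" for t
  proof (rule linear_ode_unique[where c = "\<lambda>t. ?L (\<alpha> (- t))" and c' = "\<lambda>t. - ?L (?v (- t))" and d = \<alpha>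
        and d' = ?v and m = "b * a" and K = K])
    show "((\<lambda>t. ?L (\<alpha> (- t))) has_vector_derivative - ?L (?v (- t))) (at t)" for t
      by (rule neg[OF d])
    show "(\<alpha> has_vector_derivative ?v t) (at t)" for t
      by (rule d)
    show "(?v has_vector_derivative - (2 * (b * a)) *\<^sub>R hopf_field (?v t) - K *\<^sub>R \<alpha> t) (at t)" for t
      using dv by (simp add: K_def)
    show "((\<lambda>t. - ?L (?v (- t))) has_vector_derivative
        - (2 * (b * a)) *\<^sub>R hopf_field (- ?L (?v (- t))) - K *\<^sub>R ?L (\<alpha> (- t))) (at t)" for t
    proof (rule has_vector_derivative_eq_rhs[OF has_vector_derivative_minus[OF neg[OF dv]]])
      show "- (- ?L (- (2 * (b * a)) *\<^sub>R hopf_field (?v (- t)) - (k + 2 * b * a\<^sup>2) *\<^sub>R \<alpha> (- t))) =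
        - (2 * (b * a)) *\<^sub>R hopf_field (- ?L (?v (- t))) - K *\<^sub>R ?L (\<alpha> (- t))"
        by (simp add: K_def linear_diff[OF plane_reflection_linear] linear_scale[OF plane_reflection_linear]
            linear_neg[OF plane_reflection_linear] plane_reflection_hopf[OF leg])
    qed
    show "?L (\<alpha> (- 0)) = \<alpha> 0"
      by (simp add: plane_reflection_fixes[OF leg])
    show "- ?L (?v (- 0)) = ?v 0"
      using cv[of 0] orth by (simp add: plane_reflection_def inner_commute)
  qed (use pos in \<open>simp add: K_def\<close>)
  from this[of "- s"] show ?thesis
    by simp
qed

text \<open>Horizontality makes a = 0 and leaves \<gamma>'' = - k \<gamma>, a great circle, whose
  plane does not depend on t. The factor r = 1 / sqrt k normalizes the velocity.\<close>

lemma horizontal_geodesic_plane: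
  assumes "horizontal_geodesic \<kappa> \<tau> \<gamma>"
  obtains r where "\<And>t. legendrian (\<gamma> t) (r *\<^sub>R velocity \<gamma> t)"
    "\<And>t. plane_reflection (\<gamma> t) (r *\<^sub>R velocity \<gamma> t) = plane_reflection (\<gamma> 0) (r *\<^sub>R velocity \<gamma> 0)"
proof -
  let ?v = "velocity \<gamma>"
  have \<gamma>: "geodesic S3 g \<gamma>" and hor: "g (\<gamma> t) (?v t) (hopf_field (\<gamma> t)) = 0" for t
    using assms by (auto simp: horizontal_geodesic_def)
  obtain a k where d: "\<And>t. (\<gamma> has_vector_derivative ?v t) (at t)"
    and dv: "\<And>t. (?v has_vector_derivative - (2 * (b * a)) *\<^sub>R hopf_field (?v t) - (k + 2 * b * a\<^sup>2) *\<^sub>R \<gamma> t) (at t)"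
    and a: "\<And>t. ?v t \<bullet> hopf_field (\<gamma> t) = a" and k: "\<And>t. ?v t \<bullet> ?v t = k"
    and pos: "(k + 2 * b * a\<^sup>2) + (b * a)\<^sup>2 > 0" and c: "\<And>t. \<gamma> t \<bullet> \<gamma> t = 1" and cv: "\<And>t. \<gamma> t \<bullet> ?v t = 0"
    by (rule geodesic_ode[OF \<gamma>]) blast
  have a0: "a = 0"
    using hor[of 0] a[of 0] b_pos \<kappa>_nz by (simp add: g_vertical[OF c])
  then have kpos: "k > 0"
    using pos by simp
  have dv: "(?v has_vector_derivative - k *\<^sub>R \<gamma> t) (at t)" for t
    using dv[of t] a0 by simp
  define r where "r = 1 / sqrt k"
  have rr: "r * r = 1 / k"
    using kpos by (simp add: r_def)
  have rr': "r * (r * x) = x / k" for x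
    using rr by (simp add: mult.assoc[symmetric])
  have leg: "legendrian (\<gamma> t) (r *\<^sub>R ?v t)" for t
    using c[of t] cv[of t] a[of t] k[of t] a0 rr kpos by (simp add: legendrian_def mult.assoc[symmetric])
  have "plane_reflection (\<gamma> t) (r *\<^sub>R ?v t) X = plane_reflection (\<gamma> 0) (r *\<^sub>R ?v 0) X" for t X
  proof -
    define P where "P = (\<lambda>t. (2 * (\<gamma> t \<bullet> X)) *\<^sub>R \<gamma> t + (2 / k * (?v t \<bullet> X)) *\<^sub>R ?v t - X)"
    have P: "plane_reflection (\<gamma> t) (r *\<^sub>R ?v t) X = P t" for t
      by (simp add: plane_reflection_def P_def inner_commute[of X] rr' mult_ac)
    have i: "((\<lambda>t. \<gamma> t \<bullet> X) has_real_derivative ?v t \<bullet> X) (at t)"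
      "((\<lambda>t. ?v t \<bullet> X) has_real_derivative - k * (\<gamma> t \<bullet> X)) (at t)" for t
      using has_vector_derivative_inner[OF d[of t] has_vector_derivative_const[of X]]
        has_vector_derivative_inner[OF dv[of t] has_vector_derivative_const[of X]] by simp_all
    have "(P has_vector_derivative 0) (at t)" for t
    proof (rule has_vector_derivative_eq_rhs)
      show "(P has_vector_derivative (((2 * (\<gamma> t \<bullet> X)) *\<^sub>R ?v t + (2 * (?v t \<bullet> X)) *\<^sub>R \<gamma> t)
        + ((2 / k * (?v t \<bullet> X)) *\<^sub>R (- k *\<^sub>R \<gamma> t) + (2 / k * (- k * (\<gamma> t \<bullet> X))) *\<^sub>R ?v t) - 0)) (at t)"
        unfolding P_def
        by (intro has_vector_derivative_diff has_vector_derivative_add has_vector_derivative_scaleR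
            has_vector_derivative_const d dv DERIV_cmult i)
      show "((2 * (\<gamma> t \<bullet> X)) *\<^sub>R ?v t + (2 * (?v t \<bullet> X)) *\<^sub>R \<gamma> t)
        + ((2 / k * (?v t \<bullet> X)) *\<^sub>R (- k *\<^sub>R \<gamma> t) + (2 / k * (- k * (\<gamma> t \<bullet> X))) *\<^sub>R ?v t) - 0 = 0"
        using kpos by (simp add: mult_ac)
    qed
    then have "P t = P 0"
      by (intro has_derivative_zero_unique[of UNIV P]) (auto simp: has_vector_derivative_def)
    then show ?thesis
      by (simp add: P)
  qed
  then show thesis
    using that[of r] leg by blast
qed

text \<open>Orthogonality to a horizontal vector means the same in the Berger and in the Euclidean
  metric. So every geodesic meeting \<gamma> orthogonally is flipped by the reflection in the plane
  of \<gamma>, which is the same at all meeting points.\<close>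

theorem geodesic_reflection_eq_plane_reflection:
  assumes "horizontal_geodesic \<kappa> \<tau> \<gamma>" and \<rho>: "geodesic_reflection S3 g \<gamma> \<rho>"
  obtains a e where "legendrian a e" "\<And>p. p \<in> S3 \<Longrightarrow> \<rho> p = plane_reflection a e p"
proof -
  obtain r where leg: "\<And>t. legendrian (\<gamma> t) (r *\<^sub>R velocity \<gamma> t)"
    and L: "\<And>t. plane_reflection (\<gamma> t) (r *\<^sub>R velocity \<gamma> t) = plane_reflection (\<gamma> 0) (r *\<^sub>R velocity \<gamma> 0)"
    using horizontal_geodesic_plane[OF assms(1)] by blast
  have "\<rho> p = plane_reflection (\<gamma> 0) (r *\<^sub>R velocity \<gamma> 0) p" if p: "p \<in> S3" for p
  proof -
    obtain \<alpha> s t where \<alpha>: "geodesic S3 g \<alpha>" "\<alpha> 0 = \<gamma> t" "g (\<gamma> t) (velocity \<alpha> 0) (velocity \<gamma> t) = 0"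
      "\<alpha> s = p" "\<rho> p = \<alpha> (- s)"
      using \<rho> p unfolding geodesic_reflection_def by blast
    have "r \<noteq> 0"
      using leg[of t] by (auto simp: legendrian_def)
    then have "velocity \<gamma> t \<bullet> hopf_field (\<gamma> t) = 0"
      using leg[of t] by (simp add: legendrian_def)
    then have "velocity \<alpha> 0 \<bullet> (r *\<^sub>R velocity \<gamma> t) = 0"
      using \<alpha>(3) \<kappa>_nz by (simp add: g_eq)
    from geodesic_flip[OF \<alpha>(1) _ this, of s] show ?thesis
      using leg[of t] L[of t] \<alpha> by simp
  qed
  then show thesis
    using that leg by blast
qed

end

section \<open>Explicit geodesics and the points that they reach\<close>

definition herm :: "complex \<times> complex \<Rightarrow> complex \<times> complex \<Rightarrow> complex" where
  "herm X Y = fst X * cnj (fst Y) + snd X * cnj (snd Y)"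

lemma herm_eq: "herm X Y = Complex (X \<bullet> Y) (X \<bullet> hopf_field Y)"
  by (simp add: herm_def hopf_field_def inner_prod_def inner_complex_def complex_eq_iff)

lemma herm_simps:
  "herm (X + Y) Z = herm X Z + herm Y Z" "herm X (Y + Z) = herm X Y + herm X Z"
  "herm (cscale c X) Y = c * herm X Y" "herm X (cscale c Y) = cnj c * herm X Y"
  by (simp_all add: herm_def cscale_def algebra_simps)

definition two_frequencies :: "real \<Rightarrow> real \<Rightarrow> complex \<times> complex \<Rightarrow> complex \<times> complex \<Rightarrow> real \<Rightarrow> complex \<times> complex" where
  "two_frequencies l m X Y s = cscale (cis (l * s)) X + cscale (cis (m * s)) Y"

lemma two_frequencies_derivative:
  "(two_frequencies l m X Y has_vector_derivative
     two_frequencies l m (cscale (\<i> * l) X) (cscale (\<i> * m) Y) s) (at s)"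
  unfolding two_frequencies_def[abs_def] cscale_def has_vector_derivative_def
  by (auto intro!: derivative_eq_intros simp: fun_eq_iff scaleR_conv_of_real algebra_simps)

text \<open>Differentiation only rescales X and Y by complex factors, so the induction on the order
  runs over all X and Y.\<close>

lemma two_frequencies_smooth: "smooth_on UNIV (two_frequencies l m X Y)"
proof -
  have "Ck_on n (two_frequencies l m X Y) UNIV" for n
  proof (induction n arbitrary: X Y)
    case 0
    show ?case
      using two_frequencies_derivative[of l m X Y]
      by (auto intro!: continuous_at_imp_continuous_on simp: has_vector_derivative_def dest: has_derivative_continuous)
  next
    case (Suc n)
    have diff: "two_frequencies l m X Y differentiable (at s)" for s
      using two_frequencies_derivative differentiableI_vector by blast
    have "(\<lambda>s. differential (two_frequencies l m X Y) s v)
        = two_frequencies l m (cscale (v * (\<i> * l)) X) (cscale (v * (\<i> * m)) Y)" for v :: real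
      using frechet_derivative_eq_vector_derivative[OF diff] vector_derivative_at[OF two_frequencies_derivative[of l m X Y]]
      by (auto simp: fun_eq_iff two_frequencies_def cscale_def scaleR_conv_of_real algebra_simps)
    then show ?case
      using Suc diff by simp
  qed
  then show ?thesis
    by (simp add: smooth_on_def)
qed

context berger
begin

text \<open>The geodesic through \<open>P\<close> with initial velocity \<open>y - m i P\<close>, which in the rotating frame
  \<open>cis (m s)\<close> becomes the great circle through \<open>P\<close> and \<open>y\<close>.\<close>

definition spiral :: "real \<Rightarrow> complex \<times> complex \<Rightarrow> complex \<times> complex \<Rightarrow> real \<Rightarrow> complex \<times> complex" where
  "spiral m P y = two_frequencies (1 - m) (- 1 - m) ((1/2) *\<^sub>R (P - hopf_field y)) ((1/2) *\<^sub>R (P + hopf_field y))"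

lemma spiral_eq: "spiral m P y s = cscale (cis (- (m * s))) (cos s *\<^sub>R P + sin s *\<^sub>R y)"
proof -
  have "cis ((1 - m) * s) = cis (- (m * s)) * (cos s + \<i> * sin s)"
    "cis ((- 1 - m) * s) = cis (- (m * s)) * (cos s - \<i> * sin s)"
    by (simp_all add: algebra_simps cis_conv_exp exp_add exp_diff exp_minus_inverse[symmetric] cis_mult
        flip: cis_mult cis_conv_exp) (simp_all add: complex_eq_iff cos_add sin_add cos_diff sin_diff algebra_simps)
  note eqs = this
  show ?thesis
    unfolding spiral_def two_frequencies_def eqs
    by (simp add: cscale_def hopf_field_def prod_eq_iff scaleR_conv_of_real
        field_simps)
qed

text \<open>A spiral solves the geodesic equation if its rotation speed m is b times its constant
  vertical component \<open>y \<bullet> hopf_field P - m\<close>; solving for m gives the stated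
  value. The coefficient of the position is then 1 - m^2.\<close>

lemma spiral_geodesic:
  assumes P: "P \<bullet> P = 1" "y \<bullet> y = 1" "P \<bullet> y = 0" and m: "m = b / (1 + b) * (y \<bullet> hopf_field P)"
  shows "geodesic S3 g (spiral m P y)" "spiral m P y 0 = P" "velocity (spiral m P y) 0 = y - m *\<^sub>R hopf_field P"
    "velocity (spiral m P y) s \<bullet> hopf_field (spiral m P y s) = y \<bullet> hopf_field P - m"
proof -
  define A where "A = y \<bullet> hopf_field P"
  define z where "z = (1/2) *\<^sub>R (P - hopf_field y)"
  define w where "w = (1/2) *\<^sub>R (P + hopf_field y)"
  define v where "v = two_frequencies (1 - m) (- 1 - m) (cscale (\<i> * (1 - m)) z) (cscale (\<i> * (- 1 - m)) w)"
  have s: "spiral m P y = two_frequencies (1 - m) (- 1 - m) z w"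
    by (simp add: spiral_def z_def w_def)
  have yP: "y \<bullet> P = 0" "hopf_field y \<bullet> P = - A" "P \<bullet> hopf_field y = - A"
    using P(3) by (simp_all add: inner_commute A_def hopf_skew[of y P])
  \<comment> \<open>The two circular components are Hermitian orthogonal, so products along the
    curve have no oscillating part and reduce to constants.\<close>
  have zw: "herm z w = 0" "herm w z = 0" "herm z z = (1 + A) / 2" "herm w w = (1 - A) / 2"
    by (simp_all add: herm_eq z_def w_def complex_eq_iff algebra_simps P yP)
  have cc: "cis x * cnj (cis x) = 1" for x
    by (simp add: complex_eq_iff power2_eq_square[symmetric] algebra_simps)
  have cc': "cis x * (cnj (cis x) * q) = q" for x q
    using cc[of x] by (simp add: mult.assoc[symmetric])
  have herm_two: "herm (two_frequencies l m' (cscale c z) (cscale d w) s) (two_frequencies l m' (cscale c' z) (cscale d' w) s)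
    = c * cnj c' * ((1 + A) / 2) + d * cnj d' * ((1 - A) / 2)" for l m' c d c' d' s
    by (simp add: two_frequencies_def herm_simps zw algebra_simps cc cc')
  have one: "two_frequencies l m' z w s = two_frequencies l m' (cscale 1 z) (cscale 1 w) s" for l m' s
    by (simp add: cscale_def)
  have inner: "X \<bullet> Y = Re (herm X Y)" "X \<bullet> hopf_field Y = Im (herm X Y)" for X Y
    by (simp_all add: herm_eq)
  have dc: "(spiral m P y has_vector_derivative v s) (at s)" for s
    unfolding s v_def using two_frequencies_derivative[of "1 - m" "- 1 - m" z w s] by simp
  have mA: "m * (1 + b) = b * A"
    using b_pos m by (simp add: A_def)
  then have bm: "b * (A - m) = m" and Am: "(1 + b) * (A - m) = A"
    by (simp_all add: algebra_simps)
  have a: "v s \<bullet> hopf_field (spiral m P y s) = A - m" for s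
    unfolding v_def s one inner(2) herm_two by (simp add: field_simps)
  have vv: "v s \<bullet> v s = (1 - A\<^sup>2) + (A - m)\<^sup>2" for s
    unfolding v_def inner herm_two by (simp add: field_simps power2_eq_square)
  show "geodesic S3 g (spiral m P y)"
  proof (rule geodesicI[of _ v "A - m" "1 - m\<^sup>2"])
    show "smooth_on UNIV (spiral m P y)"
      unfolding s by (rule two_frequencies_smooth)
    show "(spiral m P y has_vector_derivative v s) (at s)" for s
      by (rule dc)
    show "(v has_vector_derivative - (2 * (b * (A - m))) *\<^sub>R hopf_field (v s) - (1 - m\<^sup>2) *\<^sub>R spiral m P y s) (at s)" for s
      unfolding bm v_def s
      by (rule has_vector_derivative_eq_rhs[OF two_frequencies_derivative])
         (simp add: two_frequencies_def cscale_def hopf_field_def prod_eq_iff scaleR_conv_of_real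
          power2_eq_square algebra_simps)
    show "v s \<bullet> hopf_field (spiral m P y s) = A - m" for s
      by (rule a)
    show "spiral m P y s \<bullet> spiral m P y s = 1" for s
      unfolding s one inner herm_two by (simp add: field_simps)
    show "spiral m P y s \<bullet> v s = 0" for s
      unfolding v_def s one inner herm_two by simp
    have "A\<^sup>2 \<le> 1"
      using Cauchy_Schwarz_ineq[of y "hopf_field P"] P by (simp add: A_def)
    moreover have "A - m \<noteq> 0 \<or> A = 0"
      using Am by auto
    ultimately have "(1 - A\<^sup>2) + (A - m)\<^sup>2 > 0"
      by (auto intro: add_nonneg_pos)
    then show "v s \<noteq> 0" for s
      using vv[of s] by auto
  qed
  show "spiral m P y 0 = P"
    by (simp add: spiral_eq cscale_def)
  show "velocity (spiral m P y) 0 = y - m *\<^sub>R hopf_field P"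
    unfolding vector_derivative_at[OF dc]
    by (simp add: v_def two_frequencies_def cscale_def z_def w_def hopf_field_def prod_eq_iff
        scaleR_conv_of_real field_simps)
  show "velocity (spiral m P y) s \<bullet> hopf_field (spiral m P y s) = y \<bullet> hopf_field P - m"
    unfolding vector_derivative_at[OF dc] a A_def ..
qed

end

text \<open>For d other than 0 the points \<open>Complex (cos \<phi>) (A * sin \<phi>)\<close> fill
  the circle of radius sqrt (1 - d^2), and the factor cis changes their argument continuously. It is
  1 at the two real points of the circle, so the upper half still reaches all arguments from 0 to
  pi. In \<open>spirals_cover\<close> this matches the product of the two coordinates.\<close>

lemma twisted_circle_covers:
  fixes k d \<psi> :: real
  assumes "k \<noteq> 1" "\<bar>d\<bar> \<le> 1" "\<bar>\<psi>\<bar> \<le> pi"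
  obtains \<phi> A C where "A\<^sup>2 + C\<^sup>2 = 1" "C * sin \<phi> = d"
    "cis (- (k * A * \<phi>)) * Complex (cos \<phi>) (A * sin \<phi>) = complex_of_real (sqrt (1 - d\<^sup>2)) * cis \<psi>"
proof (cases "d = 0")
  case True
  \<comment> \<open>For d = 0 the radius is 1, and with A = 1 the argument is (1 - k) \<phi>; the
    general construction could divide by S = 0 here.\<close>
  define \<phi> where "\<phi> = \<psi> / (1 - k)"
  have "\<phi> * (1 - k) = \<psi>"
    using assms(1) by (simp add: \<phi>_def)
  then have "\<phi> - k * \<phi> = \<psi>"
    by (simp add: algebra_simps)
  then have "cis (- (k * \<phi>)) * cis \<phi> = cis \<psi>"
    by (simp add: cis_mult)
  then show ?thesis
    using that[of 1 0 \<phi>] True by (simp add: cis.code)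
next
  case False
  define r where "r = sqrt (1 - d\<^sup>2)"
  have "d\<^sup>2 \<le> 1"
    using assms(2) by (simp add: abs_square_le_1)
  then have r2: "r\<^sup>2 = 1 - d\<^sup>2" and r0: "r \<ge> 0"
    by (auto simp: r_def)
  have "d\<^sup>2 > 0"
    using False by simp
  then have r1: "r < 1"
    using r2 r0 by (metis abs_of_nonneg abs_square_less_1 diff_less_eq less_add_same_cancel1)
  have rc: "\<bar>r * cos \<theta>\<bar> < 1" for \<theta>
    using mult_mono[of "\<bar>r\<bar>" r "\<bar>cos \<theta>\<bar>" 1] r0 r1 abs_cos_le_one[of \<theta>] by (simp add: abs_mult)
  \<comment> \<open>Given the point r cis \<theta> of the circle, its real part is taken as the
    cosine of an angle F \<theta>; S is the sine of that angle, and A \<theta> the quotient that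
    reproduces the imaginary part.\<close>
  define S where "S = (\<lambda>\<theta>. sqrt (1 - (r * cos \<theta>)\<^sup>2))"
  have S: "S \<theta> > 0" "(S \<theta>)\<^sup>2 = 1 - (r * cos \<theta>)\<^sup>2" for \<theta>
    using rc[of \<theta>] abs_square_less_1[of "r * cos \<theta>"] by (auto simp: S_def)
  define F where "F = (\<lambda>\<theta>. arccos (r * cos \<theta>))"
  define A where "A = (\<lambda>\<theta>. r * sin \<theta> / S \<theta>)"
  have F: "cos (F \<theta>) = r * cos \<theta>" "sin (F \<theta>) = S \<theta>" for \<theta>
    using rc[of \<theta>] sin_arccos_abs[of "r * cos \<theta>"] cos_arccos_abs[of "r * cos \<theta>"] by (auto simp: F_def S_def)
  have AC: "(A \<theta>)\<^sup>2 + (d / S \<theta>)\<^sup>2 = 1" for \<theta>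
  proof -
    have "(r * sin \<theta>)\<^sup>2 + d\<^sup>2 = (S \<theta>)\<^sup>2"
      using r2 unfolding S(2) power_mult_distrib sin_squared_eq by algebra
    then show ?thesis
      using S(1)[of \<theta>] by (simp add: A_def power_divide add_divide_distrib[symmetric])
  qed
  have cont: "continuous_on {0..pi} (\<lambda>\<theta>. \<theta> - k * A \<theta> * F \<theta>)"
    unfolding A_def F_def S_def
    by (intro continuous_intros ballI) (use rc S(1) in \<open>auto simp: S_def abs_less_iff intro: less_imp_le dest: less_imp_neq\<close>)
  \<comment> \<open>A vanishes at 0 and pi, so the twisted argument is 0 and pi there. The sign
    \<sigma> afterwards takes care of negative \<psi>.\<close>
  obtain \<theta> where \<theta>: "0 \<le> \<theta>" "\<theta> \<le> pi" "\<theta> - k * A \<theta> * F \<theta> = \<bar>\<psi>\<bar>"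
    using IVT'[OF _ _ _ cont, of "\<bar>\<psi>\<bar>"] assms(3) by (auto simp: A_def)
  define \<sigma> where "\<sigma> = (if \<psi> \<ge> 0 then 1 else - 1 :: real)"
  have \<sigma>: "\<sigma> * \<bar>\<psi>\<bar> = \<psi>" "\<sigma>\<^sup>2 = 1"
    by (auto simp: \<sigma>_def)
  have "A \<theta> * S \<theta> = r * sin \<theta>"
    using S(1)[of \<theta>] by (simp add: A_def)
  then have "Complex (cos (F \<theta>)) (\<sigma> * A \<theta> * sin (F \<theta>)) = r * cis (\<sigma> * \<theta>)"
    using F by (auto simp: complex_eq_iff \<sigma>_def)
  moreover have "- (k * (\<sigma> * A \<theta>) * F \<theta>) + \<sigma> * \<theta> = \<sigma> * (\<theta> - k * A \<theta> * F \<theta>)"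
    by (simp add: algebra_simps)
  ultimately have "cis (- (k * (\<sigma> * A \<theta>) * F \<theta>)) * Complex (cos (F \<theta>)) (\<sigma> * A \<theta> * sin (F \<theta>)) = r * cis \<psi>"
    using \<theta>(3) \<sigma>(1) by (simp add: cis_mult mult.left_commute)
  moreover have "(\<sigma> * A \<theta>)\<^sup>2 + (d / S \<theta>)\<^sup>2 = 1"
    using AC[of \<theta>] \<sigma>(2) by (simp add: power_mult_distrib)
  moreover have "d / S \<theta> * sin (F \<theta>) = d"
    using S(1)[of \<theta>] F(2) by simp
  ultimately show ?thesis
    using that unfolding r_def by blast
qed

text \<open>The circle action \<open>(U\<^sub>1, U\<^sub>2) \<mapsto> (cis t U\<^sub>1, cis (-t) U\<^sub>2)\<close> is the action of the real rotations
  of \<open>\<complex>\<^sup>2\<close> in the coordinates \<open>U\<^sub>1 = z + i w\<close> and \<open>U\<^sub>2 = z - i w\<close>; its orbits are separated by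
  \<open>U\<^sub>1 U\<^sub>2\<close> and \<open>cmod U\<^sub>1\<close>, \<open>cmod U\<^sub>2\<close>.\<close>

lemma spirals_cover:
  fixes U\<^sub>1 U\<^sub>2 :: complex
  assumes "k \<noteq> 1" "(cmod U\<^sub>1)\<^sup>2 + (cmod U\<^sub>2)\<^sup>2 = 2"
  obtains t s A C :: real where "A\<^sup>2 + C\<^sup>2 = 1"
    "U\<^sub>1 = cis t * (cis (- (k * A * s)) * (cos s + \<i> * A * sin s - C * sin s))"
    "U\<^sub>2 = cis (- t) * (cis (- (k * A * s)) * (cos s + \<i> * A * sin s + C * sin s))"
proof -
  define d where "d = ((cmod U\<^sub>2)\<^sup>2 - (cmod U\<^sub>1)\<^sup>2) / 2"
  have U: "(cmod U\<^sub>1)\<^sup>2 = 1 - d" "(cmod U\<^sub>2)\<^sup>2 = 1 + d"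
    using assms(2) by (auto simp: d_def field_simps)
  then have d: "\<bar>d\<bar> \<le> 1"
    using zero_le_power2[of "cmod U\<^sub>1"] zero_le_power2[of "cmod U\<^sub>2"] by linarith
  have "(cmod (U\<^sub>1 * U\<^sub>2))\<^sup>2 = (cmod U\<^sub>1)\<^sup>2 * (cmod U\<^sub>2)\<^sup>2"
    by (simp add: norm_mult power_mult_distrib)
  also have "\<dots> = 1 - d\<^sup>2"
    unfolding U by (simp add: power2_eq_square algebra_simps)
  finally have "(cmod (U\<^sub>1 * U\<^sub>2))\<^sup>2 = 1 - d\<^sup>2" .
  then have q: "cmod (U\<^sub>1 * U\<^sub>2) = sqrt (1 - d\<^sup>2)"
    by (metis norm_ge_zero real_sqrt_unique)
  have "\<bar>Arg (U\<^sub>1 * U\<^sub>2)\<bar> \<le> pi"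
    using Arg_bounded[of "U\<^sub>1 * U\<^sub>2"] by auto
  then obtain \<phi> A C where AC: "A\<^sup>2 + C\<^sup>2 = 1" "C * sin \<phi> = d"
    and eq: "cis (- (k * A * \<phi>)) * Complex (cos \<phi>) (A * sin \<phi>) = complex_of_real (sqrt (1 - d\<^sup>2)) * cis (Arg (U\<^sub>1 * U\<^sub>2))"
    using twisted_circle_covers[OF assms(1) d] by blast
  \<comment> \<open>The product of the two coordinates depends on the double angle 2 s, see
    \<open>prod\<close> below.\<close>
  define s where "s = \<phi> / 2"
  define V\<^sub>1 where "V\<^sub>1 = cis (- (k * A * s)) * (cos s + \<i> * A * sin s - C * sin s)"
  define V\<^sub>2 where "V\<^sub>2 = cis (- (k * A * s)) * (cos s + \<i> * A * sin s + C * sin s)"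
  have \<phi>: "sin \<phi> = 2 * sin s * cos s" "cos \<phi> = (cos s)\<^sup>2 - (sin s)\<^sup>2"
    using sin_double[of s] cos_double[of s] by (simp_all add: s_def)
  have A2: "A * A = 1 - C * C"
    using AC(1) by (simp add: power2_eq_square algebra_simps)
  have V: "(cmod V\<^sub>1)\<^sup>2 = 1 - d" "(cmod V\<^sub>2)\<^sup>2 = 1 + d"
  proof -
    have "(cos s - C * sin s)\<^sup>2 + (A * sin s)\<^sup>2 = (cos s)\<^sup>2 + (A\<^sup>2 + C\<^sup>2) * (sin s)\<^sup>2 - C * (2 * sin s * cos s)"
      "(cos s + C * sin s)\<^sup>2 + (A * sin s)\<^sup>2 = (cos s)\<^sup>2 + (A\<^sup>2 + C\<^sup>2) * (sin s)\<^sup>2 + C * (2 * sin s * cos s)"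
      by (simp_all add: power2_eq_square algebra_simps)
    then have "(cos s - C * sin s)\<^sup>2 + (A * sin s)\<^sup>2 = 1 - d" "(cos s + C * sin s)\<^sup>2 + (A * sin s)\<^sup>2 = 1 + d"
      using AC \<phi>(1) by simp_all
    then show "(cmod V\<^sub>1)\<^sup>2 = 1 - d" "(cmod V\<^sub>2)\<^sup>2 = 1 + d"
      by (simp_all add: V\<^sub>1_def V\<^sub>2_def norm_mult cmod_power2)
  qed
  have prod: "U\<^sub>1 * U\<^sub>2 = V\<^sub>1 * V\<^sub>2"
  proof -
    have "V\<^sub>1 * V\<^sub>2 = (cis (- (k * A * s)) * cis (- (k * A * s))) *
        ((cos s + \<i> * A * sin s - C * sin s) * (cos s + \<i> * A * sin s + C * sin s))"
      by (simp add: V\<^sub>1_def V\<^sub>2_def mult_ac)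
    also have "cis (- (k * A * s)) * cis (- (k * A * s)) = cis (- (k * A * \<phi>))"
      by (simp add: cis_mult s_def mult_ac)
    also have "(cos s + \<i> * A * sin s - C * sin s) * (cos s + \<i> * A * sin s + C * sin s) = Complex (cos \<phi>) (A * sin \<phi>)"
    proof -
      have "cos s * cos s - A * A * (sin s * sin s) - C * C * (sin s * sin s) = cos s * cos s - sin s * sin s"
        unfolding A2 by (simp add: algebra_simps)
      then show ?thesis
        by (simp add: complex_eq_iff \<phi> power2_eq_square algebra_simps)
    qed
    finally show ?thesis
      unfolding eq q[symmetric] by (metis rcis_cmod_Arg rcis_def)
  qed
  have cis: "\<exists>t. cis t = z" if "cmod z = 1" for z
    using rcis_cmod_Arg[of z] that by (auto simp: rcis_def)
  have "\<exists>t. U\<^sub>1 = cis t * V\<^sub>1 \<and> U\<^sub>2 = cis (- t) * V\<^sub>2"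
  proof (cases "V\<^sub>1 = 0")
    case True
    then have "d = 1" "U\<^sub>1 = 0"
      using V U by auto
    then have nz: "V\<^sub>2 \<noteq> 0" "cmod U\<^sub>2 = cmod V\<^sub>2"
      using V(2) U(2) by (auto, metis norm_ge_zero power2_eq_imp_eq)
    \<comment> \<open>With the first coordinate zero the phase has to be read off from the second,
      on which the circle acts inversely.\<close>
    then obtain t where "cis t = U\<^sub>2 / V\<^sub>2"
      using cis[of "U\<^sub>2 / V\<^sub>2"] by (auto simp: norm_divide)
    then show ?thesis
      using nz True \<open>U\<^sub>1 = 0\<close> by (intro exI[of _ "- t"]) simp
  next
    case False
    have n: "cmod U\<^sub>1 = cmod V\<^sub>1"
      using V(1) U(1) by (metis norm_ge_zero power2_eq_imp_eq)
    then obtain t where t: "cis t = U\<^sub>1 / V\<^sub>1"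
      using cis[of "U\<^sub>1 / V\<^sub>1"] False by (auto simp: norm_divide)
    then have U1: "U\<^sub>1 = cis t * V\<^sub>1"
      using False by simp
    then have "cis t * U\<^sub>2 = V\<^sub>2"
      using prod False by simp
    then have "U\<^sub>2 = cis (- t) * V\<^sub>2"
      by (auto simp: mult.assoc[symmetric] cis_mult)
    then show ?thesis
      using U1 by blast
  qed
  then show ?thesis
    using that AC(1) unfolding V\<^sub>1_def V\<^sub>2_def by blast
qed

context berger
begin

text \<open>In the complex coordinates z, w of p with respect to a and e, moving a starting point
  along \<gamma> is a real rotation. So \<open>spirals_cover\<close> yields a foot \<gamma> t, a
  direction and a time for which an orthogonal geodesic arrives at p, and
  \<open>geodesic_flip\<close> identifies its opposite point.\<close>

theorem plane_reflection_geodesic_reflection: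
  assumes leg: "legendrian a e"
  obtains \<gamma> where "horizontal_geodesic \<kappa> \<tau> \<gamma>" "geodesic_reflection S3 g \<gamma> (plane_reflection a e)"
proof -
  note [simp] = legendrianD[OF leg]
  define \<gamma> where "\<gamma> = spiral 0 a e"
  have \<gamma>: "\<gamma> t = cos t *\<^sub>R a + sin t *\<^sub>R e" for t
    by (simp add: \<gamma>_def spiral_eq cscale_def prod_eq_iff)
  have "(\<gamma> has_vector_derivative (- sin t) *\<^sub>R a + cos t *\<^sub>R e) (at t)" for t
    unfolding \<gamma>[abs_def] by (auto intro!: derivative_eq_intros)
  then have v: "velocity \<gamma> t = (- sin t) *\<^sub>R a + cos t *\<^sub>R e" for t
    using vector_derivative_at by blast
  have trig: "cos t * cos t + sin t * sin t = 1" for t :: real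
    by (simp add: power2_eq_square[symmetric])
  have trig': "cos t * (cos t * x) + sin t * (sin t * x) = x" for t x :: real
    using trig[of t] by (metis distrib_right mult.assoc mult_1)
  have legt: "legendrian (\<gamma> t) (velocity \<gamma> t)" for t
    by (simp add: legendrian_def \<gamma> v inner_add_left inner_add_right algebra_simps trig)
  have \<gamma>_geo: "geodesic S3 g \<gamma>"
    unfolding \<gamma>_def by (rule spiral_geodesic(1)) simp_all
  then have hor: "horizontal_geodesic \<kappa> \<tau> \<gamma>"
    using legt by (auto simp: horizontal_geodesic_def legendrian_def g_vertical)
  have same: "plane_reflection (\<gamma> t) (velocity \<gamma> t) = plane_reflection a e" for t
  proof
    fix X
    have trig'': "(cos t * (cos t * x)) *\<^sub>R Y + (sin t * (sin t * x)) *\<^sub>R Y = x *\<^sub>R Y" for x and Y :: "complex \<times> complex"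
      by (simp add: scaleR_add_left[symmetric] trig')
    have "(X \<bullet> \<gamma> t) *\<^sub>R \<gamma> t + (X \<bullet> velocity \<gamma> t) *\<^sub>R velocity \<gamma> t
        = ((cos t * (cos t * (X \<bullet> a))) *\<^sub>R a + (sin t * (sin t * (X \<bullet> a))) *\<^sub>R a)
          + ((cos t * (cos t * (X \<bullet> e))) *\<^sub>R e + (sin t * (sin t * (X \<bullet> e))) *\<^sub>R e)"
      by (simp add: \<gamma> v inner_add_right inner_diff_right algebra_simps)
    then have *: "(X \<bullet> \<gamma> t) *\<^sub>R \<gamma> t + (X \<bullet> velocity \<gamma> t) *\<^sub>R velocity \<gamma> t = (X \<bullet> a) *\<^sub>R a + (X \<bullet> e) *\<^sub>R e"
      unfolding trig'' .
    have "plane_reflection f f' X = 2 *\<^sub>R ((X \<bullet> f) *\<^sub>R f + (X \<bullet> f') *\<^sub>R f') - X" for f f'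
      by (simp add: plane_reflection_def scaleR_add_right)
    then show "plane_reflection (\<gamma> t) (velocity \<gamma> t) X = plane_reflection a e X"
      by (simp only: *)
  qed
  \<comment> \<open>The ratio of the rotation speed m to the vertical component A of y in
    \<open>spiral_geodesic\<close>.\<close>
  define k where "k = b / (1 + b)"
  have k: "k \<noteq> 1"
    using b_pos by (simp add: k_def)
  have "\<exists>\<alpha> s\<^sub>0 t. geodesic S3 g \<alpha> \<and> \<alpha> 0 = \<gamma> t \<and> g (\<gamma> t) (velocity \<alpha> 0) (velocity \<gamma> t) = 0 \<and>
        \<alpha> s\<^sub>0 = p \<and> plane_reflection a e p = \<alpha> (- s\<^sub>0)" if "p \<in> S3" for p
  proof -
    define z where "z = Complex (p \<bullet> a) (p \<bullet> hopf_field a)"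
    define w where "w = Complex (p \<bullet> e) (p \<bullet> hopf_field e)"
    have "Complex x y = x + \<i> * y" for x y
      by (simp add: complex_eq_iff)
    then have p: "p = cscale z a + cscale w e"
      using legendrian_expansion[OF leg, of p]
      by (simp add: z_def w_def cscale_def prod_eq_iff hopf_field_def scaleR_conv_of_real algebra_simps)
    have "p \<bullet> p = Re (herm (cscale z a + cscale w e) (cscale z a + cscale w e))"
      by (simp add: p[symmetric] herm_eq)
    also have "\<dots> = (cmod z)\<^sup>2 + (cmod w)\<^sup>2"
    proof -
      have "herm a a = 1" "herm e e = 1" "herm a e = 0" "herm e a = 0"
        by (simp_all add: herm_eq complex_eq_iff)
      then show ?thesis
        by (simp add: herm_simps cmod_power2, simp add: power2_eq_square)
    qed
    finally have norm: "(cmod z)\<^sup>2 + (cmod w)\<^sup>2 = 1"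
      using that by (simp add: dot_square_norm)
    have "(cmod (z + \<i> * w))\<^sup>2 + (cmod (z - \<i> * w))\<^sup>2 = 2 * ((cmod z)\<^sup>2 + (cmod w)\<^sup>2)"
      by (simp add: cmod_power2, simp add: power2_eq_square algebra_simps)
    then have "(cmod (z + \<i> * w))\<^sup>2 + (cmod (z - \<i> * w))\<^sup>2 = 2"
      using norm by simp
    then obtain t s A C :: real where AC: "A\<^sup>2 + C\<^sup>2 = 1"
      and U: "z + \<i> * w = cis t * (cis (- (k * A * s)) * (cos s + \<i> * A * sin s - C * sin s))"
        "z - \<i> * w = cis (- t) * (cis (- (k * A * s)) * (cos s + \<i> * A * sin s + C * sin s))"
      by (rule spirals_cover[OF k])
    define c where "c = cis (- (k * A * s))"
    define E where "E = cos s + \<i> * A * sin s"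
    have ct: "cis t = cos t + \<i> * sin t" "cis (- t) = cos t - \<i> * sin t"
      by (simp_all add: complex_eq_iff)
    have "2 * z = (z + \<i> * w) + (z - \<i> * w)" "2 * w = - \<i> * ((z + \<i> * w) - (z - \<i> * w))"
      by (simp_all add: algebra_simps)
    then have "2 * z = 2 * (c * (E * cos t - \<i> * (C * sin s) * sin t))"
      "2 * w = 2 * (c * (E * sin t + \<i> * (C * sin s) * cos t))"
      unfolding U c_def[symmetric] E_def[symmetric] ct by (simp_all add: algebra_simps)
    then have zw: "z = c * (E * cos t - \<i> * (C * sin s) * sin t)" "w = c * (E * sin t + \<i> * (C * sin s) * cos t)"
      by simp_all
    \<comment> \<open>The unit vectors orthogonal to both \<gamma> t and the velocity there are
      combinations of i times these two vectors, with components A and C.\<close>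
    define y where "y = A *\<^sub>R hopf_field (\<gamma> t) + C *\<^sub>R hopf_field (velocity \<gamma> t)"
    define m where "m = k * A"
    note [simp] = legendrianD[OF legt[of t]]
    have yy: "y \<bullet> y = 1" and Py: "\<gamma> t \<bullet> y = 0" and yA: "y \<bullet> hopf_field (\<gamma> t) = A"
      using AC by (simp_all add: y_def inner_add_left inner_add_right power2_eq_square inner_commute[of "velocity \<gamma> t" "\<gamma> t"])
    note sp = spiral_geodesic[of "\<gamma> t" y m, OF _ yy Py]
    have m: "m = b / (1 + b) * (y \<bullet> hopf_field (\<gamma> t))"
      by (simp add: m_def k_def yA)
    have geo: "geodesic S3 g (spiral m (\<gamma> t) y)" and start: "spiral m (\<gamma> t) y 0 = \<gamma> t"
      and vel: "velocity (spiral m (\<gamma> t) y) 0 = y - m *\<^sub>R hopf_field (\<gamma> t)"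
      using sp(1-3) m by simp_all
    have orth: "velocity (spiral m (\<gamma> t) y) 0 \<bullet> velocity \<gamma> t = 0"
      unfolding vel by (simp add: y_def inner_add_left inner_diff_left)
    have reach: "spiral m (\<gamma> t) y s = p"
      unfolding p zw spiral_eq y_def \<gamma> v m_def c_def[symmetric] E_def
      by (simp add: cscale_def hopf_field_def prod_eq_iff scaleR_conv_of_real algebra_simps)
    have "plane_reflection a e p = spiral m (\<gamma> t) y (- s)"
      using geodesic_flip[OF geo, of "velocity \<gamma> t" s] start legt[of t] orth same[of t] reach by simp
    moreover have "g (\<gamma> t) (velocity (spiral m (\<gamma> t) y) 0) (velocity \<gamma> t) = 0"
      using orth by (simp add: g_eq)
    ultimately show ?thesis
      using geo start reach by blast
  qed
  then have "geodesic_reflection S3 g \<gamma> (plane_reflection a e)"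
    by (simp add: geodesic_reflection_def)
  then show thesis
    using that hor by blast
qed

end

section \<open>Immersions into the Berger sphere and their sisters\<close>

lemma differential_in_tangent_space:
  fixes f :: "'u::real_normed_vector \<Rightarrow> 'e::euclidean_space"
  assumes "open U" "u \<in> U" "f differentiable (at u)" "\<And>x. x \<in> U \<Longrightarrow> f x \<in> Q"
  shows "differential f u v \<in> tangent_space Q (f u)"
proof -
  obtain r where r: "r > 0" "ball u r \<subseteq> U"
    using assms(1,2) openE by blast
  define \<delta> where "\<delta> = r / (norm v + 1)"
  have \<delta>: "\<delta> > 0" "\<delta> * norm v < r"
    using r(1) norm_ge_zero[of v] by (simp_all add: \<delta>_def field_simps add_pos_nonneg)
  \<comment> \<open>The sine keeps the argument of f inside U for all s and leaves its velocity at 0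
    equal to v: \<open>tangent_space\<close> asks for curves defined on the whole line.\<close>
  define c where "c = (\<lambda>s::real. f (u + (\<delta> * sin (s / \<delta>)) *\<^sub>R v))"
  have "c s \<in> Q" for s
  proof -
    have "norm ((\<delta> * sin (s / \<delta>)) *\<^sub>R v) \<le> \<delta> * norm v"
      using \<delta>(1) abs_sin_le_one[of "s / \<delta>"] mult_right_mono[of "\<delta> * \<bar>sin (s / \<delta>)\<bar>" \<delta> "norm v"]
      by (simp add: abs_mult mult_left_le)
    then have "norm ((\<delta> * sin (s / \<delta>)) *\<^sub>R v) < r"
      using \<delta>(2) by linarith
    then have "u + (\<delta> * sin (s / \<delta>)) *\<^sub>R v \<in> ball u r"
      using dist_add_cancel[of u 0 "(\<delta> * sin (s / \<delta>)) *\<^sub>R v"]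
      by (simp only: mem_ball add_0_right dist_0_norm)
    then show ?thesis
      using r(2) assms(4) by (auto simp: c_def)
  qed
  moreover have "c 0 = f u"
    by (simp add: c_def)
  moreover have "(c has_vector_derivative differential f u v) (at 0)"
  proof -
    have 1: "((\<lambda>s. u + (\<delta> * sin (s / \<delta>)) *\<^sub>R v) has_derivative (\<lambda>h. h *\<^sub>R v)) (at 0)"
      using \<delta>(1) by (auto intro!: derivative_eq_intros)
    have 2: "(f has_derivative differential f u) (at (u + (\<delta> * sin (0 / \<delta>)) *\<^sub>R v))"
      using has_derivative_differential[OF assms(3)] by simp
    have "(c has_derivative (\<lambda>h. differential f u (h *\<^sub>R v))) (at 0)"
      unfolding c_def by (rule has_derivative_compose[OF 1 2])
    then show ?thesis
      by (simp add: has_vector_derivative_def linear_scale[OF linear_frechet_derivative[OF assms(3)]])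
  qed
  ultimately show ?thesis
    by (auto simp: tangent_space_def)
qed

lemma shape_operator_pairing:
  assumes "shape_operator Q g f N x u S" "Z \<in> tangent_space Q (f (x u))"
  shows "g (f (x u)) (- differential (f \<circ> x) u (S v)) Z
     = g (f (x u)) (differential (N \<circ> x) u v) Z + christoffel g (f (x u)) (differential (f \<circ> x) u v) (N (x u)) Z"
  using assms unfolding shape_operator_def has_covariant_derivative_def by (simp only: comp_apply)

text \<open>S' is conjugate to - S by L, and the trace is cyclic.\<close>

lemma trace_conjugate_neg:
  fixes L S S' :: "real^2 \<Rightarrow> real^2"
  assumes lin: "linear L" "linear S" "linear S'" and "surj L" and eq: "\<And>v. S' (L v) = - L (S v)"
  shows "trace (matrix S') = - trace (matrix S)"
proof -
  obtain K where K: "linear K" "L \<circ> K = id"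
    using linear_surjective_right_inverse[OF lin(1) assms(4)] by blast
  have "S' v = - L (S (K v))" for v
    using eq[of "K v"] K(2) by (metis comp_apply id_apply)
  then have "S' = (\<lambda>v. - ((L \<circ> (S \<circ> K)) v))"
    by auto
  then have "matrix S' = - matrix (L \<circ> (S \<circ> K))"
    by (simp add: matrix_def vec_eq_iff)
  also have "matrix (L \<circ> (S \<circ> K)) = matrix L ** (matrix S ** matrix K)"
    using lin K by (simp add: matrix_compose linear_compose)
  finally have "trace (matrix S') = - trace (matrix L ** (matrix S ** matrix K))"
    by (simp add: trace_def sum_negf)
  also have "trace (matrix L ** (matrix S ** matrix K)) = trace (matrix S ** (matrix K ** matrix L))"
    by (metis matrix_mul_assoc trace_mul_sym)
  also have "matrix K ** matrix L = mat 1"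
  proof -
    have "matrix L ** matrix K = mat 1"
      using K lin by (metis matrix_compose matrix_id_mat_1)
    then show ?thesis
      by (simp add: matrix_left_right_inverse)
  qed
  finally show ?thesis
    by simp
qed

section \<open>The product metric and its tangent spaces\<close>

lemma M2R_metric_point: "M2R_metric \<epsilon> p = M2R_metric \<epsilon> 0"
  by (simp add: M2R_metric_def fun_eq_iff)

lemma christoffel_M2R: "christoffel (M2R_metric \<epsilon>) p X Y Z = 0"
  by (simp add: christoffel_def M2R_metric_def)

lemma mink_bilinear: "bilinear (mink \<epsilon>)"
  by (auto simp: bilinear_def mink_def linear_iff algebra_simps)

lemma mink_sym: "mink \<epsilon> x y = mink \<epsilon> y x"
  by (simp add: mink_def mult_ac)

lemma M2R_metric_sym: "M2R_metric \<epsilon> p X Y = M2R_metric \<epsilon> p Y X"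
  by (simp add: M2R_metric_def mink_sym[of \<epsilon> "fst X"] mult_ac)

lemma M2R_metric_bilinear: "bilinear (M2R_metric \<epsilon> p)"
  by (auto simp: bilinear_def M2R_metric_def mink_def linear_iff algebra_simps)

lemma M2R_metric_bounded_bilinear: "bounded_bilinear (M2R_metric \<epsilon> p)"
  using M2R_metric_bilinear bilinear_conv_bounded_bilinear by blast

lemma M2R_metric_nondegenerate:
  assumes "\<epsilon> \<noteq> 0" "\<And>Y. M2R_metric \<epsilon> p X Y = 0"
  shows "X = 0"
proof -
  have "M2R_metric \<epsilon> p X (vector [1, 0, 0], 0) = 0" "M2R_metric \<epsilon> p X (vector [0, 1, 0], 0) = 0"
    "M2R_metric \<epsilon> p X (vector [0, 0, 1], 0) = 0" "M2R_metric \<epsilon> p X (0, 1) = 0"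
    by (rule assms(2))+
  then show ?thesis
    using assms(1) by (simp add: M2R_metric_def mink_def vector_3 prod_eq_iff vec_eq_iff forall_3)
qed

lemma tangent_space_M2R:
  assumes "X \<in> tangent_space (M2R \<epsilon>) q"
  shows "mink \<epsilon> (fst X) (fst q) = 0"
proof -
  obtain c where c: "\<And>s::real. c s \<in> M2R \<epsilon>" "c 0 = q" "(c has_vector_derivative X) (at 0)"
    using assms by (auto simp: tangent_space_def)
  interpret mink: bounded_bilinear "mink \<epsilon>"
    using mink_bilinear bilinear_conv_bounded_bilinear by blast
  have d: "((\<lambda>s. fst (c s)) has_derivative (\<lambda>s. s *\<^sub>R fst X)) (at 0)"
    using has_derivative_fst[of c "\<lambda>s. s *\<^sub>R X"] c(3) by (simp add: has_vector_derivative_def)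
  have "((\<lambda>s. mink \<epsilon> (fst (c s)) (fst (c s))) has_derivative
     (\<lambda>s. mink \<epsilon> (fst (c 0)) (s *\<^sub>R fst X) + mink \<epsilon> (s *\<^sub>R fst X) (fst (c 0)))) (at 0)"
    by (rule mink.FDERIV[OF d d])
  moreover have "mink \<epsilon> (fst (c s)) (fst (c s)) = \<epsilon>" for s
    using c(1)[of s] by (auto simp: M2R_def M2_def)
  ultimately have "((\<lambda>s::real. \<epsilon>) has_derivative
     (\<lambda>s. mink \<epsilon> (fst (c 0)) (s *\<^sub>R fst X) + mink \<epsilon> (s *\<^sub>R fst X) (fst (c 0)))) (at 0)"
    by simp
  from has_derivative_unique[OF this has_derivative_const]
  have "mink \<epsilon> (fst (c 0)) (1 *\<^sub>R fst X) + mink \<epsilon> (1 *\<^sub>R fst X) (fst (c 0)) = 0"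
    by (rule fun_cong)
  then show ?thesis
    using c(2) mink_sym[of \<epsilon> "fst X" "fst q"] by simp
qed

text \<open>The map \<pi> of the frame for the product: (p, 0) is normal to the product at (p, t),
  whereas the height is a tangent direction.\<close>

definition horizontal_part :: "(real^3) \<times> real \<Rightarrow> (real^3) \<times> real" where
  "horizontal_part X = (fst X, 0)"

lemma horizontal_part_bounded_linear: "bounded_linear horizontal_part"
  unfolding linear_conv_bounded_linear[symmetric]
  by (rule linearI) (simp_all add: horizontal_part_def)

lemma (in riemannian_surface) frame_isometry:
  assumes F: "surface_isometry M A h F" and c: "(U, x) \<in> A" and d: "(V, y) \<in> A"
    and u: "u \<in> coord_dom (U, x) (V, y) F" and tw: "twice_differentiable_on V (f \<circ> y)"
  shows "frame \<pi> (f \<circ> F) (N \<circ> F) x u (p, n, w)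
    = frame \<pi> f N y (coord_rep (U, x) (V, y) F u) (p, n, differential (coord_rep (U, x) (V, y) F) u w)"
  using twice_differentiable_on_isometry_rep(2)[OF F c d tw u] coord_rep_mem(2)[OF u]
  by (simp add: frame_def)

context berger
begin

lemma g_simps:
  "g p (X + Y) Z = g p X Z + g p Y Z" "g p Z (X + Y) = g p Z X + g p Z Y"
  "g p (r *\<^sub>R X) Z = r * g p X Z" "g p Z (r *\<^sub>R X) = r * g p Z X"
  "g p (- X) Z = - g p X Z" "g p Z (- X) = - g p Z X"
  by (simp_all add: g_eq inner_add_left algebra_simps add_divide_distrib)

lemma inner_eq_g: "X \<bullet> Y = \<kappa> / 4 * g p X Y - b * (X \<bullet> hopf_field p) * (Y \<bullet> hopf_field p)"
  using \<kappa>_nz by (simp add: g_eq field_simps)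

lemma g_sym: "g p X Y = g p Y X"
  by (simp add: g_eq inner_commute[of X Y])

end

section \<open>Frames and data of the two sister immersions\<close>

locale sister_surface = oriented_surface M A h J + berger \<kappa> \<tau>
  for M :: "'a::{t2_space,second_countable_topology} set" and A h J \<kappa> \<tau> +
  fixes \<epsilon> :: real and \<phi> N :: "'a \<Rightarrow> complex \<times> complex" and \<phi>' N' :: "'a \<Rightarrow> (real^3) \<times> real"
  assumes \<epsilon>: "\<epsilon> \<in> {1, -1}"
    and minimal: "minimal_immersion A h \<kappa> \<tau> \<phi> N"
    and sister: "sister_immersion A h J \<epsilon> \<kappa> \<tau> \<phi> N \<phi>' N'"
begin

abbreviation \<beta> :: "(real^3) \<times> real \<Rightarrow> (real^3) \<times> real \<Rightarrow> real" where
  "\<beta> \<equiv> M2R_metric \<epsilon> 0"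

lemma bilinear_\<beta>: "bilinear \<beta>"
  by (rule M2R_metric_bilinear)

lemmas \<beta>_simps = bilinear_ladd[OF bilinear_\<beta>] bilinear_radd[OF bilinear_\<beta>] bilinear_lmul[OF bilinear_\<beta>]
  bilinear_rmul[OF bilinear_\<beta>] bilinear_lneg[OF bilinear_\<beta>] bilinear_rneg[OF bilinear_\<beta>]
  bilinear_lsub[OF bilinear_\<beta>] bilinear_rsub[OF bilinear_\<beta>] bilinear_lzero[OF bilinear_\<beta>]
  bilinear_rzero[OF bilinear_\<beta>]

lemma twice_differentiable:
  assumes "(U, x) \<in> A"
  shows "twice_differentiable_on U (\<phi> \<circ> x)" "twice_differentiable_on U (N \<circ> x)"
    "twice_differentiable_on U (\<phi>' \<circ> x)" "twice_differentiable_on U (N' \<circ> x)"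
proof -
  have "smooth_on U (\<phi> \<circ> x)" "smooth_on U (N \<circ> x)" "smooth_on U (\<phi>' \<circ> x)" "smooth_on U (N' \<circ> x)"
    using minimal sister
    unfolding minimal_immersion_def sister_immersion_def isometric_immersion_def unit_normal_def
    by (auto dest!: bspec[OF _ assms])
  then show "twice_differentiable_on U (\<phi> \<circ> x)" "twice_differentiable_on U (N \<circ> x)"
    "twice_differentiable_on U (\<phi>' \<circ> x)" "twice_differentiable_on U (N' \<circ> x)"
    by (simp_all add: smooth_on_imp_twice_differentiable_on)
qed

text \<open>The data shared by the two immersions, at the point with coordinates \<open>u\<close>; the shape
  operators enter through their second fundamental forms.\<close>

definition shape_data :: "(real^2) set \<Rightarrow> (real^2 \<Rightarrow> 'a) \<Rightarrow> real^2 \<Rightarrow> (real^2 \<Rightarrow> real^2) \<Rightarrow> real^2 \<Rightarrow> real \<Rightarrow> bool" where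
  "shape_data U x u S T \<nu> \<longleftrightarrow> linear S \<and>
     (\<forall>v Z. Z \<bullet> \<phi> (x u) = 0 \<longrightarrow> - g (\<phi> (x u)) (differential (\<phi> \<circ> x) u (S v)) Z
        = g (\<phi> (x u)) (differential (N \<circ> x) u v) Z
          + christoffel g (\<phi> (x u)) (differential (\<phi> \<circ> x) u v) (N (x u)) Z) \<and>
     (\<kappa> / (4 * \<tau>)) *\<^sub>R hopf_field (\<phi> (x u)) = differential (\<phi> \<circ> x) u T + \<nu> *\<^sub>R N (x u) \<and>
     (\<forall>v w. \<beta> (differential (N' \<circ> x) u v) (differential (\<phi>' \<circ> x) u w)
        = h (U, x) u (J (U, x) u (S v) - \<tau> *\<^sub>R v) w) \<and>
     (0, 1) = differential (\<phi>' \<circ> x) u (- J (U, x) u T) + \<nu> *\<^sub>R N' (x u) \<and>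
     trace (matrix (\<lambda>v. - J (U, x) u (S v) + \<tau> *\<^sub>R v)) = 2 * \<tau>"

context
  fixes U x u
  assumes c: "(U, x) \<in> A" and u: "u \<in> U"
begin

lemma chart_open: "open U"
  using smooth_surface_chart(1)[OF smooth c] .

lemma differentiable:
  shows "\<phi> \<circ> x differentiable (at u)" "N \<circ> x differentiable (at u)"
    "\<phi>' \<circ> x differentiable (at u)" "N' \<circ> x differentiable (at u)"
  using twice_differentiable[OF c] u by (auto simp: twice_differentiable_on_def)

lemma differential_linear:
  shows "linear (differential (\<phi> \<circ> x) u)" "linear (differential (N \<circ> x) u)"
    "linear (differential (\<phi>' \<circ> x) u)" "linear (differential (N' \<circ> x) u)"
  using linear_frechet_derivative differentiable by auto

lemma metric_form: "inner_form (h (U, x) u)"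
  using metric_inner_form[OF c u] .

lemma berger_immersion:
  shows "\<phi> (x u) \<in> S3" "\<phi> (x u) \<bullet> \<phi> (x u) = 1"
    "g (\<phi> (x u)) (differential (\<phi> \<circ> x) u v) (differential (\<phi> \<circ> x) u w) = h (U, x) u v w"
    "differential (\<phi> \<circ> x) u v \<bullet> \<phi> (x u) = 0"
proof -
  have iso: "\<phi> (x u) \<in> S3" if "u \<in> U" for u
    using minimal that unfolding minimal_immersion_def isometric_immersion_def by (auto dest!: bspec[OF _ c])
  show S3: "\<phi> (x u) \<in> S3" using iso u .
  then show "\<phi> (x u) \<bullet> \<phi> (x u) = 1"
    by (simp add: dot_square_norm)
  show "g (\<phi> (x u)) (differential (\<phi> \<circ> x) u v) (differential (\<phi> \<circ> x) u w) = h (U, x) u v w"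
    using minimal u unfolding minimal_immersion_def isometric_immersion_def by (auto dest!: bspec[OF _ c])
  have "differential (\<phi> \<circ> x) u v \<in> tangent_space S3 ((\<phi> \<circ> x) u)"
    using iso by (intro differential_in_tangent_space[OF chart_open u differentiable(1)]) (auto simp: o_def)
  then show "differential (\<phi> \<circ> x) u v \<bullet> \<phi> (x u) = 0"
    using tangent_space_S3[OF S3] by simp
qed

lemma berger_normal:
  shows "g (\<phi> (x u)) (N (x u)) (N (x u)) = 1" "g (\<phi> (x u)) (differential (\<phi> \<circ> x) u v) (N (x u)) = 0"
    "g (\<phi> (x u)) (N (x u)) (differential (\<phi> \<circ> x) u v) = 0" "N (x u) \<bullet> \<phi> (x u) = 0"
proof -
  have *: "N (x u) \<in> tangent_space S3 (\<phi> (x u)) \<and> g (\<phi> (x u)) (N (x u)) (N (x u)) = 1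
      \<and> (\<forall>v. g (\<phi> (x u)) (differential (\<phi> \<circ> x) u v) (N (x u)) = 0)"
    using minimal u unfolding minimal_immersion_def unit_normal_def by (auto dest!: bspec[OF _ c])
  then show "g (\<phi> (x u)) (N (x u)) (N (x u)) = 1" "g (\<phi> (x u)) (differential (\<phi> \<circ> x) u v) (N (x u)) = 0"
    "g (\<phi> (x u)) (N (x u)) (differential (\<phi> \<circ> x) u v) = 0"
    using g_sym[of _ "N (x u)" "differential (\<phi> \<circ> x) u v"] by auto
  show "N (x u) \<bullet> \<phi> (x u) = 0"
    using * tangent_space_S3[OF berger_immersion(1)] by simp
qed

lemma product_immersion:
  shows "mink \<epsilon> (fst (\<phi>' (x u))) (fst (\<phi>' (x u))) = \<epsilon>"
    "\<beta> (differential (\<phi>' \<circ> x) u v) (differential (\<phi>' \<circ> x) u w) = h (U, x) u v w"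
    "mink \<epsilon> (fst (differential (\<phi>' \<circ> x) u v)) (fst (\<phi>' (x u))) = 0"
    "differential (\<phi>' \<circ> x) u v \<in> tangent_space (M2R \<epsilon>) (\<phi>' (x u))"
proof -
  have iso: "\<phi>' (x u) \<in> M2R \<epsilon>" if "u \<in> U" for u
    using sister that unfolding sister_immersion_def isometric_immersion_def by (auto dest!: bspec[OF _ c])
  show "mink \<epsilon> (fst (\<phi>' (x u))) (fst (\<phi>' (x u))) = \<epsilon>"
    using iso[OF u] by (auto simp: M2R_def M2_def)
  have "M2R_metric \<epsilon> (\<phi>' (x u)) (differential (\<phi>' \<circ> x) u v) (differential (\<phi>' \<circ> x) u w) = h (U, x) u v w"
    using sister u unfolding sister_immersion_def isometric_immersion_def by (auto dest!: bspec[OF _ c])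
  then show "\<beta> (differential (\<phi>' \<circ> x) u v) (differential (\<phi>' \<circ> x) u w) = h (U, x) u v w"
    by (simp add: M2R_metric_point[of _ "\<phi>' (x u)"])
  have "differential (\<phi>' \<circ> x) u v \<in> tangent_space (M2R \<epsilon>) ((\<phi>' \<circ> x) u)"
    using iso by (intro differential_in_tangent_space[OF chart_open u differentiable(3)]) (auto simp: o_def)
  then show "differential (\<phi>' \<circ> x) u v \<in> tangent_space (M2R \<epsilon>) (\<phi>' (x u))"
    by simp
  then show "mink \<epsilon> (fst (differential (\<phi>' \<circ> x) u v)) (fst (\<phi>' (x u))) = 0"
    by (rule tangent_space_M2R)
qed

lemma product_normal:
  shows "\<beta> (N' (x u)) (N' (x u)) = 1" "\<beta> (differential (\<phi>' \<circ> x) u v) (N' (x u)) = 0"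
    "\<beta> (N' (x u)) (differential (\<phi>' \<circ> x) u v) = 0" "mink \<epsilon> (fst (N' (x u))) (fst (\<phi>' (x u))) = 0"
proof -
  have *: "N' (x u) \<in> tangent_space (M2R \<epsilon>) (\<phi>' (x u)) \<and> M2R_metric \<epsilon> (\<phi>' (x u)) (N' (x u)) (N' (x u)) = 1
      \<and> (\<forall>v. M2R_metric \<epsilon> (\<phi>' (x u)) (differential (\<phi>' \<circ> x) u v) (N' (x u)) = 0)"
    using sister u unfolding sister_immersion_def unit_normal_def by (auto dest!: bspec[OF _ c])
  then show "\<beta> (N' (x u)) (N' (x u)) = 1" "\<beta> (differential (\<phi>' \<circ> x) u v) (N' (x u)) = 0"
    "\<beta> (N' (x u)) (differential (\<phi>' \<circ> x) u v) = 0"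
    using M2R_metric_sym[of \<epsilon> 0 "N' (x u)" "differential (\<phi>' \<circ> x) u v"]
    by (auto simp: M2R_metric_point[of _ "\<phi>' (x u)"])
  show "mink \<epsilon> (fst (N' (x u))) (fst (\<phi>' (x u))) = 0"
    using * tangent_space_M2R by blast
qed

lemma product_shape_operator:
  assumes "shape_operator (M2R \<epsilon>) (M2R_metric \<epsilon>) \<phi>' N' x u S"
  shows "\<beta> (differential (N' \<circ> x) u v) (differential (\<phi>' \<circ> x) u w) = h (U, x) u (- S v) w"
  using shape_operator_pairing[OF assms product_immersion(4), of v w]
  by (simp add: christoffel_M2R M2R_metric_point[of _ "\<phi>' (x u)"] \<beta>_simps product_immersion(2)
      inner_form_simps[OF metric_form])

lemma ex_shape_data: "\<exists>S T \<nu>. shape_data U x u S T \<nu>"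
proof -
  obtain S T \<nu> where S: "shape_operator S3 g \<phi> N x u S"
    and T: "berger_vertical \<kappa> \<tau> (\<phi> (x u)) = differential (\<phi> \<circ> x) u T + \<nu> *\<^sub>R N (x u)"
    and S': "shape_operator (M2R \<epsilon>) (M2R_metric \<epsilon>) \<phi>' N' x u (\<lambda>v. - J (U, x) u (S v) + \<tau> *\<^sub>R v)"
    and T': "(0, 1) = differential (\<phi>' \<circ> x) u (- J (U, x) u T) + \<nu> *\<^sub>R N' (x u)"
    using sister c u unfolding sister_immersion_def by blast
  obtain S'' where S'': "shape_operator (M2R \<epsilon>) (M2R_metric \<epsilon>) \<phi>' N' x u S''" "trace (matrix S'') / 2 = \<tau>"
    using sister c u unfolding sister_immersion_def constant_mean_curvature_def by blast
  have S'_eq: "\<beta> (differential (N' \<circ> x) u v) (differential (\<phi>' \<circ> x) u w)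
      = h (U, x) u (J (U, x) u (S v) - \<tau> *\<^sub>R v) w" for v w
    using product_shape_operator[OF S', of v w] by simp
  \<comment> \<open>The mean curvature condition supplies its own shape operator S''. Pairings with
    tangent vectors determine a shape operator, so S'' is - J S + \<tau> and the trace condition
    passes to that form.\<close>
  have "- S'' v = J (U, x) u (S v) - \<tau> *\<^sub>R v" for v
    by (rule inner_form_eqI[OF metric_form]) (simp only: product_shape_operator[OF S''(1), symmetric] S'_eq)
  then have "S'' = (\<lambda>v. - J (U, x) u (S v) + \<tau> *\<^sub>R v)"
    by (metis (no_types, opaque_lifting) add.commute minus_diff_eq minus_minus uminus_add_conv_diff)
  moreover have "- g (\<phi> (x u)) (differential (\<phi> \<circ> x) u (S v)) Z = g (\<phi> (x u)) (differential (N \<circ> x) u v) Z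
          + christoffel g (\<phi> (x u)) (differential (\<phi> \<circ> x) u v) (N (x u)) Z" if "Z \<bullet> \<phi> (x u) = 0" for v Z
    using shape_operator_pairing[OF S, of Z v] that
    by (simp add: tangent_space_S3[OF berger_immersion(1)] g_simps)
  ultimately have "shape_data U x u S T \<nu>"
    using S T S'_eq T' S''(2) by (auto simp: shape_data_def shape_operator_def berger_vertical_def)
  then show ?thesis
    by blast
qed

lemma berger_tangent_product:
  "g (\<phi> (x u)) (n *\<^sub>R N (x u) + differential (\<phi> \<circ> x) u w) (n' *\<^sub>R N (x u) + differential (\<phi> \<circ> x) u w')
    = n * n' + h (U, x) u w w'"
  by (simp add: g_simps berger_normal berger_immersion)

text \<open>Horizontal position, normal and tangent plane are mutually orthogonal, with the position
  of square \<epsilon>. The frame therefore stays nondegenerate for \<epsilon> = -1, when \<beta> is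
  indefinite.\<close>

lemma product_frame_product:
  "\<beta> (frame horizontal_part \<phi>' N' x u (p, n, w)) (frame horizontal_part \<phi>' N' x u (p', n', w'))
    = \<epsilon> * p * p' + n * n' + h (U, x) u w w'"
proof -
  have "\<beta> (horizontal_part (\<phi>' (x u))) X = mink \<epsilon> (fst X) (fst (\<phi>' (x u)))" for X
    by (simp add: M2R_metric_def horizontal_part_def mink_sym[of _ "fst X"])
  moreover have "\<beta> X (horizontal_part (\<phi>' (x u))) = mink \<epsilon> (fst X) (fst (\<phi>' (x u)))" for X
    by (simp add: M2R_metric_def horizontal_part_def)
  ultimately show ?thesis
    by (simp add: frame_def \<beta>_simps product_immersion product_normal algebra_simps)
       (simp add: horizontal_part_def product_immersion product_normal bilinear_ladd[OF mink_bilinear]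
          bilinear_lmul[OF mink_bilinear])
qed

lemma product_frame_inj:
  assumes "frame horizontal_part \<phi>' N' x u k = 0"
  shows "k = 0"
proof -
  obtain p n w where k: "k = (p, n, w)"
    by (metis prod.exhaust)
  have *: "\<epsilon> * p * p' + n * n' + h (U, x) u w w' = 0" for p' n' w'
    using product_frame_product[of p n w p' n' w'] assms by (simp add: k \<beta>_simps)
  have "p = 0"
    using *[of 1 0 0] \<epsilon> by (auto simp: inner_form_simps[OF metric_form])
  moreover have "n = 0"
    using *[of 0 1 0] by (simp add: inner_form_simps[OF metric_form])
  moreover have "w = 0"
    using *[of 0 0 w] inner_form_eq_0_iff[OF metric_form] by simp
  ultimately show ?thesis
    by (simp add: k zero_prod_def)
qed

lemma berger_frame_position: "frame (\<lambda>z. z) \<phi> N x u (p, n, w) \<bullet> \<phi> (x u) = p"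
  by (simp add: frame_def inner_add_left berger_immersion berger_normal)

lemma berger_frame_inj:
  assumes "frame (\<lambda>z. z) \<phi> N x u k = 0"
  shows "k = 0"
proof -
  obtain p n w where k: "k = (p, n, w)"
    by (metis prod.exhaust)
  have p: "p = 0"
    using berger_frame_position[of p n w] assms by (simp add: k)
  then have "n *\<^sub>R N (x u) + differential (\<phi> \<circ> x) u w = 0"
    using assms by (simp add: k frame_def)
  then have *: "n * n' + h (U, x) u w w' = 0" for n' w'
    using berger_tangent_product[of n w n' w'] g_simps(3)[of "\<phi> (x u)" 0 0] by simp
  have "n = 0"
    using *[of 1 0] by (simp add: inner_form_simps[OF metric_form])
  moreover have "w = 0"
    using *[of 0 w] inner_form_eq_0_iff[OF metric_form] by simp
  ultimately show ?thesis
    using p by (simp add: k zero_prod_def)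
qed

lemma berger_frame_surj: "\<exists>p n w. frame (\<lambda>z. z) \<phi> N x u (p, n, w) = X"
proof -
  have "linear (frame (\<lambda>z. z) \<phi> N x u)"
    by (rule linear_frame) (simp add: differentiable)
  then have "surj (frame (\<lambda>z. z) \<phi> N x u)"
    using berger_frame_inj linear_injective_0 by (intro linear_inj_imp_surj_DIM) (blast, blast, simp)
  then show ?thesis
    by (metis prod.exhaust surjD)
qed

lemma product_frame_surj: "\<exists>p n w. frame horizontal_part \<phi>' N' x u (p, n, w) = X"
proof -
  have "linear (frame horizontal_part \<phi>' N' x u)"
    using horizontal_part_bounded_linear
    by (intro linearI) (simp_all add: frame_def linear_add[OF differential_linear(3)] linear_scale[OF differential_linear(3)] algebra_simps)
  then have "surj (frame horizontal_part \<phi>' N' x u)"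
    using product_frame_inj linear_injective_0 by (intro linear_inj_imp_surj_DIM) (blast, blast, simp)
  then show ?thesis
    by (metis prod.exhaust surjD)
qed

context
  fixes S T \<nu>
  assumes data: "shape_data U x u S T \<nu>"
begin

text \<open>Pairing with the vertical field (0, 1) gives the height of a vector, and the
  decomposition of this field into tangent and normal part evaluates the pairing.\<close>

lemma product_height:
  "snd (differential (\<phi>' \<circ> x) u v) = h (U, x) u (- J (U, x) u T) v" "snd (N' (x u)) = \<nu>"
proof -
  have eq: "(0, 1) = differential (\<phi>' \<circ> x) u (- J (U, x) u T) + \<nu> *\<^sub>R N' (x u)"
    using data by (simp add: shape_data_def)
  have *: "snd X = \<beta> (0, 1) X" for X
    by (simp add: M2R_metric_def mink_def)
  show "snd (differential (\<phi>' \<circ> x) u v) = h (U, x) u (- J (U, x) u T) v"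
    unfolding * eq by (simp add: \<beta>_simps product_immersion product_normal)
  show "snd (N' (x u)) = \<nu>"
    unfolding * eq by (simp add: \<beta>_simps product_normal)
qed

text \<open>Subtracting the product of the heights from the full product leaves an expression in the
  metric, - J T and \<nu> alone. It serves the hypothesis \<open>proj\<close> of
  \<open>congruent_immersions\<close>.\<close>

lemma product_frame_projection:
  "\<beta> (horizontal_part (differential (\<phi>' \<circ> x) u v)) (frame horizontal_part \<phi>' N' x u (p, n, w))
    = h (U, x) u v w - h (U, x) u (- J (U, x) u T) v * (n * \<nu> + h (U, x) u (- J (U, x) u T) w)"
proof -
  have "\<beta> (horizontal_part X) Y = \<beta> X Y - snd X * snd Y" for X Y
    by (simp add: M2R_metric_def horizontal_part_def)
  moreover have "\<beta> (differential (\<phi>' \<circ> x) u v) (frame horizontal_part \<phi>' N' x u (p, n, w)) = h (U, x) u v w"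
    using product_frame_product[of 0 0 v p n w] by (simp add: frame_def)
  moreover have "snd (frame horizontal_part \<phi>' N' x u (p, n, w)) = n * \<nu> + h (U, x) u (- J (U, x) u T) w"
    using product_height by (simp add: frame_def horizontal_part_def)
  ultimately show ?thesis
    using product_height by simp
qed

text \<open>Here \<open>\<kappa> / (4 * \<tau>)\<close> converts pairings with \<open>\<xi>\<close> in the Berger metric into Euclidean pairings
  with the Hopf field.\<close>

lemma berger_vertical_pairing:
  "(n *\<^sub>R N (x u) + differential (\<phi> \<circ> x) u w) \<bullet> hopf_field (\<phi> (x u)) = \<kappa> / (4 * \<tau>) * (n * \<nu> + h (U, x) u T w)"
proof -
  let ?X = "n *\<^sub>R N (x u) + differential (\<phi> \<circ> x) u w"
  have V: "(\<kappa> / (4 * \<tau>)) *\<^sub>R hopf_field (\<phi> (x u)) = \<nu> *\<^sub>R N (x u) + differential (\<phi> \<circ> x) u T"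
    using data by (simp add: shape_data_def)
  have "\<kappa> / (4 * \<tau>) * (4 / \<kappa> * (1 + b) * (?X \<bullet> hopf_field (\<phi> (x u))))
      = g (\<phi> (x u)) ?X ((\<kappa> / (4 * \<tau>)) *\<^sub>R hopf_field (\<phi> (x u)))"
    by (simp only: g_simps(4) g_vertical[OF berger_immersion(2)])
  also have "\<dots> = n * \<nu> + h (U, x) u T w"
    unfolding V berger_tangent_product by (simp add: inner_form_sym[OF metric_form])
  finally have *: "\<kappa> / (4 * \<tau>) * (4 / \<kappa> * (1 + b) * (?X \<bullet> hopf_field (\<phi> (x u)))) = n * \<nu> + h (U, x) u T w" .
  have "1 + b = 4 * \<tau>\<^sup>2 / \<kappa>"
    by (simp add: b_def)
  then have c2: "\<kappa> / (4 * \<tau>) * (\<kappa> / (4 * \<tau>)) * (4 / \<kappa>) * (1 + b) = 1"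
    using \<kappa>_nz \<tau>_nz by (simp add: power2_eq_square)
  then show ?thesis
    unfolding *[symmetric] by (simp only: mult.assoc[symmetric] c2 mult_1_left)
qed

text \<open>The Euclidean product is \<kappa> / 4 times the Berger metric minus b times a product of
  vertical components; this is how T and \<nu> enter the Gram matrix.\<close>

lemma berger_frame_product:
  "frame (\<lambda>z. z) \<phi> N x u (p, n, w) \<bullet> frame (\<lambda>z. z) \<phi> N x u (p', n', w')
    = p * p' + \<kappa> / 4 * (n * n' + h (U, x) u w w')
      - b * (\<kappa> / (4 * \<tau>))\<^sup>2 * (n * \<nu> + h (U, x) u T w) * (n' * \<nu> + h (U, x) u T w')"
proof -
  let ?X = "n *\<^sub>R N (x u) + differential (\<phi> \<circ> x) u w" and ?Y = "n' *\<^sub>R N (x u) + differential (\<phi> \<circ> x) u w'"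
  have "?X \<bullet> \<phi> (x u) = 0" "?Y \<bullet> \<phi> (x u) = 0"
    by (simp_all add: inner_add_left berger_immersion berger_normal)
  moreover have "(p *\<^sub>R q + X) \<bullet> (p' *\<^sub>R q + Y) = p * p' + X \<bullet> Y"
    if "X \<bullet> q = 0" "Y \<bullet> q = 0" "q \<bullet> q = 1" for X Y q :: "complex \<times> complex"
    using that by (simp add: inner_add_left inner_add_right inner_commute[of q Y])
  moreover have "frame (\<lambda>z. z) \<phi> N x u (p, n, w) = p *\<^sub>R \<phi> (x u) + (n *\<^sub>R N (x u) + differential (\<phi> \<circ> x) u w)" for p n w
    by (simp add: frame_def)
  ultimately have "frame (\<lambda>z. z) \<phi> N x u (p, n, w) \<bullet> frame (\<lambda>z. z) \<phi> N x u (p', n', w') = p * p' + ?X \<bullet> ?Y"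
    using berger_immersion(2) by simp
  moreover have "?X \<bullet> ?Y = \<kappa> / 4 * g (\<phi> (x u)) ?X ?Y
      - b * (?X \<bullet> hopf_field (\<phi> (x u))) * (?Y \<bullet> hopf_field (\<phi> (x u)))"
    by (rule inner_eq_g)
  ultimately show ?thesis
    unfolding berger_tangent_product berger_vertical_pairing
    by (simp only: power2_eq_square mult_ac add_diff_eq)
qed

text \<open>The flat derivative of N differs from the covariant one by Christoffel terms. They leave
  pairings of tangent vectors with i times tangent vectors and i times N, which the data determine
  only up to the sign in \<open>reflected_hopf_sign\<close>.\<close>

lemma berger_second_form:
  "differential (N \<circ> x) u v \<bullet> differential (\<phi> \<circ> x) u w = - \<kappa> / 4 * h (U, x) u (S v) w
     + b * (\<kappa> / (4 * \<tau>))\<^sup>2 * h (U, x) u T (S v) * h (U, x) u T w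
     - b * (\<kappa> / (4 * \<tau>)) * (\<nu> * (differential (\<phi> \<circ> x) u w \<bullet> hopf_field (differential (\<phi> \<circ> x) u v))
         + h (U, x) u T v * (differential (\<phi> \<circ> x) u w \<bullet> hopf_field (N (x u))))"
proof -
  let ?p = "\<phi> (x u)" and ?d = "differential (\<phi> \<circ> x) u" and ?dN = "differential (N \<circ> x) u v"
  have pair: "- g ?p (?d (S v)) Z = g ?p ?dN Z + christoffel g ?p (?d v) (N (x u)) Z" if "Z \<bullet> ?p = 0" for Z
    using data that unfolding shape_data_def by blast
  have vert: "?d w \<bullet> hopf_field ?p = \<kappa> / (4 * \<tau>) * h (U, x) u T w" for w
    using berger_vertical_pairing[of 0 w] by simp
  have vertN: "N (x u) \<bullet> hopf_field ?p = \<kappa> / (4 * \<tau>) * \<nu>"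
    using berger_vertical_pairing[of 1 0] linear_0[OF differential_linear(1)]
    by (simp add: inner_form_simps[OF metric_form])
  have "hopf_field ?p \<bullet> hopf_field (?d v) = 0" "hopf_field ?p \<bullet> hopf_field (N (x u)) = 0"
    by (simp_all add: inner_commute[of ?p] berger_immersion berger_normal)
  \<comment> \<open>Testing in the Hopf direction isolates the vertical component of the derivative
    of N, because the Christoffel term vanishes there.\<close>
  then have "christoffel g ?p (?d v) (N (x u)) (hopf_field ?p) = 0"
    by (simp add: christoffel_g)
  then have "- g ?p (?d (S v)) (hopf_field ?p) = g ?p ?dN (hopf_field ?p)"
    using pair[of "hopf_field ?p"] by simp
  then have "4 / \<kappa> * (1 + b) * (?dN \<bullet> hopf_field ?p + ?d (S v) \<bullet> hopf_field ?p) = 0"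
    unfolding g_vertical[OF berger_immersion(2)] distrib_left by linarith
  then have "?dN \<bullet> hopf_field ?p = - (?d (S v) \<bullet> hopf_field ?p)"
    using \<kappa>_nz b_pos by simp
  then have dNV: "?dN \<bullet> hopf_field ?p = - (\<kappa> / (4 * \<tau>) * h (U, x) u T (S v))"
    using vert[of "S v"] by simp
  have "- h (U, x) u (S v) w = g ?p ?dN (?d w) + christoffel g ?p (?d v) (N (x u)) (?d w)"
    using pair[OF berger_immersion(4)[of w]] by (simp add: berger_immersion)
  also have "\<dots> = 4 / \<kappa> * (?dN \<bullet> ?d w + b * (?dN \<bullet> hopf_field ?p) * (?d w \<bullet> hopf_field ?p)
      + b * ((N (x u) \<bullet> hopf_field ?p) * (?d w \<bullet> hopf_field (?d v)) + (?d v \<bullet> hopf_field ?p) * (?d w \<bullet> hopf_field (N (x u)))))"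
    by (simp add: g_eq christoffel_g algebra_simps add_divide_distrib)
  finally have "- \<kappa> / 4 * h (U, x) u (S v) w = ?dN \<bullet> ?d w + b * (?dN \<bullet> hopf_field ?p) * (?d w \<bullet> hopf_field ?p)
      + b * ((N (x u) \<bullet> hopf_field ?p) * (?d w \<bullet> hopf_field (?d v)) + (?d v \<bullet> hopf_field ?p) * (?d w \<bullet> hopf_field (N (x u))))"
    using \<kappa>_nz by (simp add: field_simps)
  then show ?thesis
    unfolding dNV vert vertN by (simp add: power2_eq_square algebra_simps)
qed

end

end

end

section \<open>Orthogonal maps reversing the Hopf field\<close>

lemma ex_legendrian:
  assumes "p \<bullet> p = 1"
  obtains e where "legendrian p e"
proof -
  \<comment> \<open>Up to convention this is the quaternionic multiple of p by j, which is Hermitian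
    orthogonal to p.\<close>
  define e where "e = (- cnj (snd p), cnj (fst p))"
  have "legendrian p e"
    using assms by (simp add: legendrian_def e_def hopf_field_def inner_prod_def inner_complex_def algebra_simps)
  then show thesis
    by (rule that)
qed

text \<open>On vectors orthogonal to p the form \<open>X \<bullet> hopf_field Y\<close> does not see
  the Hopf direction and lives on the complex line of e. B maps this line isometrically onto the
  corresponding line at B p, so it is complex linear or antilinear there; s records which.\<close>

lemma orthogonal_hopf_sign:
  fixes B :: "complex \<times> complex \<Rightarrow> complex \<times> complex"
  assumes B: "linear B" "\<And>X Y. B X \<bullet> B Y = X \<bullet> Y" and p: "p \<bullet> p = 1"
    and V: "B (hopf_field p) = - hopf_field (B p)"
  obtains s where "s = 1 \<or> s = -1"
    "\<And>X Y. X \<bullet> p = 0 \<Longrightarrow> Y \<bullet> p = 0 \<Longrightarrow> B X \<bullet> hopf_field (B Y) = s * (X \<bullet> hopf_field Y)"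
proof -
  obtain e where e: "legendrian p e"
    using ex_legendrian[OF p] .
  note [simp] = legendrianD[OF e]
  define q where "q = B p"
  define f where "f = B e"
  have f: "legendrian q f"
    using B(2)[of e "hopf_field p"] by (simp add: legendrian_def q_def f_def B(2) V)
  note F = legendrianD[OF f]
  have V: "B (hopf_field p) = - hopf_field q"
    using V by (simp add: q_def)
  define s where "s = B (hopf_field e) \<bullet> hopf_field f"
  have "B (hopf_field e) \<bullet> q = 0" "B (hopf_field e) \<bullet> hopf_field q = 0" "B (hopf_field e) \<bullet> f = 0"
    using B(2)[of "hopf_field e" p] B(2)[of "hopf_field e" e] B(2)[of "hopf_field e" "hopf_field p"]
    by (simp_all add: q_def[symmetric] f_def[symmetric] V)
  then have he: "B (hopf_field e) = s *\<^sub>R hopf_field f"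
    using legendrian_expansion[OF f, of "B (hopf_field e)"] by (simp add: s_def)
  then have "s * s = 1"
    using B(2)[of "hopf_field e" "hopf_field e"] F by simp
  then have s: "s = 1 \<or> s = -1"
    by (simp add: square_eq_1_iff)
  have "B X \<bullet> hopf_field (B Y) = s * (X \<bullet> hopf_field Y)" if "X \<bullet> p = 0" "Y \<bullet> p = 0" for X Y
  proof -
    have tangent: "\<exists>z t r. Z = z *\<^sub>R hopf_field p + t *\<^sub>R e + r *\<^sub>R hopf_field e" if "Z \<bullet> p = 0" for Z
      using legendrian_expansion[OF e, of Z] that by auto
    obtain z t r where X: "X = z *\<^sub>R hopf_field p + t *\<^sub>R e + r *\<^sub>R hopf_field e"
      using tangent \<open>X \<bullet> p = 0\<close> by blast
    obtain z' t' r' where Y: "Y = z' *\<^sub>R hopf_field p + t' *\<^sub>R e + r' *\<^sub>R hopf_field e"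
      using tangent \<open>Y \<bullet> p = 0\<close> by blast
    have BX: "B X = (- z) *\<^sub>R hopf_field q + t *\<^sub>R f + (r * s) *\<^sub>R hopf_field f"
      and BY: "B Y = (- z') *\<^sub>R hopf_field q + t' *\<^sub>R f + (r' * s) *\<^sub>R hopf_field f"
      by (simp_all add: X Y linear_add[OF B(1)] linear_scale[OF B(1)] V he f_def)
    have "B X \<bullet> hopf_field (B Y) = s * (r * t' - t * r')"
      unfolding BX BY by (simp add: inner_add_left inner_add_right inner_diff_left inner_diff_right F algebra_simps)
    moreover have "X \<bullet> hopf_field Y = r * t' - t * r'"
      unfolding X Y by (simp add: inner_add_left inner_add_right inner_diff_left inner_diff_right algebra_simps)
    ultimately show ?thesis
      by simp
  qed
  then show thesis
    using that s by blast
qed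

text \<open>The fixed plane has real dimension 2 and contains p, which leaves a single dimension
  orthogonal to p. In the Berger sphere this count decides the signs at a fixed point of
  \<sigma>.\<close>

lemma plane_reflection_fixed_dependent:
  assumes p: "plane_reflection a e p = p" "p \<noteq> 0"
    and X: "plane_reflection a e X = X" "X \<bullet> p = 0" and Y: "plane_reflection a e Y = Y" "Y \<bullet> p = 0"
    and leg: "legendrian a e"
  obtains c d where "c \<noteq> 0 \<or> d \<noteq> 0" "c *\<^sub>R X + d *\<^sub>R Y = 0"
proof -
  note [simp] = legendrianD[OF leg]
  define p1 p2 x1 x2 y1 y2 where defs: "p1 = p \<bullet> a" "p2 = p \<bullet> e" "x1 = X \<bullet> a" "x2 = X \<bullet> e" "y1 = Y \<bullet> a" "y2 = Y \<bullet> e"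
  have eqs: "p = p1 *\<^sub>R a + p2 *\<^sub>R e" "X = x1 *\<^sub>R a + x2 *\<^sub>R e" "Y = y1 *\<^sub>R a + y2 *\<^sub>R e"
    using plane_reflection_fixed p(1) X(1) Y(1) unfolding defs by blast+
  have orth: "x1 * p1 + x2 * p2 = 0" "y1 * p1 + y2 * p2 = 0"
    using X(2) Y(2) unfolding eqs by (simp_all add: inner_add_left inner_add_right mult_ac)
  have "p1 * (x1 * y2 - x2 * y1) = 0" "p2 * (x1 * y2 - x2 * y1) = 0"
    using orth by algebra+
  moreover have "p1 \<noteq> 0 \<or> p2 \<noteq> 0"
    using p(2) eqs(1) by auto
  ultimately have det: "x1 * y2 = x2 * y1"
    by auto
  show thesis
  proof (cases "x1 = 0 \<and> x2 = 0")
    case True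
    then show thesis
      using that[of 1 0] eqs by simp
  next
    case False
    have "y1 *\<^sub>R X + (- x1) *\<^sub>R Y = 0" "y2 *\<^sub>R X + (- x2) *\<^sub>R Y = 0"
      using det unfolding eqs by (simp_all add: algebra_simps)
    then show thesis
      using that False by (metis neg_equal_0_iff_equal)
  qed
qed

lemma vertical_reflection_linear: "linear (vertical_reflection \<epsilon> v)"
  by (rule linearI) (simp_all add: vertical_reflection_def mink_def prod_eq_iff algebra_simps)

lemma vertical_reflection_bounded_linear: "bounded_linear (vertical_reflection \<epsilon> v)"
  using vertical_reflection_linear by (simp add: linear_conv_bounded_linear)

section \<open>Reflections of sister surfaces\<close>

context sister_surface
begin

lemma shape_dataD:
  assumes "shape_data U x u S T \<nu>"
  shows "linear S"
    "Z \<bullet> \<phi> (x u) = 0 \<Longrightarrow> g (\<phi> (x u)) (differential (N \<circ> x) u v) Z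
      + christoffel g (\<phi> (x u)) (differential (\<phi> \<circ> x) u v) (N (x u)) Z
      = - g (\<phi> (x u)) (differential (\<phi> \<circ> x) u (S v)) Z"
    "(\<kappa> / (4 * \<tau>)) *\<^sub>R hopf_field (\<phi> (x u)) = differential (\<phi> \<circ> x) u T + \<nu> *\<^sub>R N (x u)"
    "\<beta> (differential (N' \<circ> x) u v) (differential (\<phi>' \<circ> x) u w) = h (U, x) u (J (U, x) u (S v) - \<tau> *\<^sub>R v) w"
    "(0, 1) = differential (\<phi>' \<circ> x) u (- J (U, x) u T) + \<nu> *\<^sub>R N' (x u)"
    "trace (matrix (\<lambda>v. - J (U, x) u (S v) + \<tau> *\<^sub>R v)) = 2 * \<tau>"
proof -
  note d = assms[unfolded shape_data_def]
  show "linear S" by (rule d[THEN conjunct1])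
  show "g (\<phi> (x u)) (differential (N \<circ> x) u v) Z
      + christoffel g (\<phi> (x u)) (differential (\<phi> \<circ> x) u v) (N (x u)) Z
      = - g (\<phi> (x u)) (differential (\<phi> \<circ> x) u (S v)) Z" if "Z \<bullet> \<phi> (x u) = 0"
    by (rule d[THEN conjunct2, THEN conjunct1, rule_format, OF that, symmetric])
  show "(\<kappa> / (4 * \<tau>)) *\<^sub>R hopf_field (\<phi> (x u)) = differential (\<phi> \<circ> x) u T + \<nu> *\<^sub>R N (x u)"
    by (rule d[THEN conjunct2, THEN conjunct2, THEN conjunct1])
  show "\<beta> (differential (N' \<circ> x) u v) (differential (\<phi>' \<circ> x) u w) = h (U, x) u (J (U, x) u (S v) - \<tau> *\<^sub>R v) w"
    by (rule d[THEN conjunct2, THEN conjunct2, THEN conjunct2, THEN conjunct1, rule_format])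
  show "(0, 1) = differential (\<phi>' \<circ> x) u (- J (U, x) u T) + \<nu> *\<^sub>R N' (x u)"
    by (rule d[THEN conjunct2, THEN conjunct2, THEN conjunct2, THEN conjunct2, THEN conjunct1])
  show "trace (matrix (\<lambda>v. - J (U, x) u (S v) + \<tau> *\<^sub>R v)) = 2 * \<tau>"
    by (rule d[THEN conjunct2, THEN conjunct2, THEN conjunct2, THEN conjunct2, THEN conjunct2])
qed

lemma berger_normal_unique:
  assumes c: "(U, x) \<in> A" and u: "u \<in> U" and X: "X \<bullet> \<phi> (x u) = 0" "g (\<phi> (x u)) X X = 1"
    "\<And>v. g (\<phi> (x u)) (differential (\<phi> \<circ> x) u v) X = 0"
  shows "N (x u) = X \<or> N (x u) = - X"
proof -
  note form = metric_form[OF c u]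
  obtain p n w where f: "frame (\<lambda>z. z) \<phi> N x u (p, n, w) = X"
    using berger_frame_surj[OF c u] by blast
  have "p = 0"
    using berger_frame_position[OF c u, of p n w] f X(1) by simp
  then have f: "X = n *\<^sub>R N (x u) + differential (\<phi> \<circ> x) u w"
    using f by (simp add: frame_def)
  have "h (U, x) u w w = 0"
    using X(3)[of w] berger_tangent_product[OF c u, of 0 w n w] by (simp add: f)
  then have w: "w = 0"
    using inner_form_eq_0_iff[OF form] by simp
  then have "n * n = 1"
    using X(2) berger_tangent_product[OF c u, of n w n w] by (simp add: f inner_form_simps[OF form])
  then show ?thesis
    using f w linear_0[OF differential_linear(1)[OF c u]] by (auto simp: square_eq_1_iff)
qed

lemma product_normal_unique:
  assumes c: "(U, x) \<in> A" and u: "u \<in> U" and X: "mink \<epsilon> (fst X) (fst (\<phi>' (x u))) = 0" "\<beta> X X = 1"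
    "\<And>v. \<beta> (differential (\<phi>' \<circ> x) u v) X = 0"
  shows "N' (x u) = X \<or> N' (x u) = - X"
proof -
  note form = metric_form[OF c u]
  obtain p n w where f: "frame horizontal_part \<phi>' N' x u (p, n, w) = X"
    using product_frame_surj[OF c u] by blast
  have "\<beta> (frame horizontal_part \<phi>' N' x u (1, 0, 0)) X = mink \<epsilon> (fst X) (fst (\<phi>' (x u)))"
    using linear_0[OF differential_linear(3)[OF c u]]
    by (simp add: frame_def M2R_metric_def horizontal_part_def mink_sym[of _ "fst X"])
  then have p: "p = 0"
    using product_frame_product[OF c u, of 1 0 0 p n w] f X(1) \<epsilon> by (auto simp: inner_form_simps[OF form])
  have "h (U, x) u w w = 0"
    using X(3)[of w] product_frame_product[OF c u, of 0 0 w p n w] f by (simp add: frame_def)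
  then have w: "w = 0"
    using inner_form_eq_0_iff[OF form] by simp
  then have "n * n = 1"
    using X(2) product_frame_product[OF c u, of p n w p n w] p f by (simp add: inner_form_simps[OF form])
  then show ?thesis
    using f p w linear_0[OF differential_linear(3)[OF c u]] by (auto simp: square_eq_1_iff frame_def)
qed

text \<open>The behaviour of the data under an isometry of the surface that is induced by a reflection
  around a horizontal geodesic, which reverses \<open>\<xi>\<close> and, as it also reverses the tangent
  planes, maps \<open>N\<close> to \<open>- N\<close>.\<close>

definition reflects_data :: "('a \<Rightarrow> 'a) \<Rightarrow> bool" where
  "reflects_data F \<longleftrightarrow> (\<forall>U x V y u S T \<nu> S' T' \<nu>'. (U, x) \<in> A \<longrightarrow> (V, y) \<in> A \<longrightarrow>
     u \<in> coord_dom (U, x) (V, y) F \<longrightarrow> shape_data U x u S T \<nu> \<longrightarrow>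
     shape_data V y (coord_rep (U, x) (V, y) F u) S' T' \<nu>' \<longrightarrow>
     \<nu>' = \<nu> \<and> T' = - differential (coord_rep (U, x) (V, y) F) u T \<and>
     (\<forall>v. S' (differential (coord_rep (U, x) (V, y) F) u v) = - differential (coord_rep (U, x) (V, y) F) u (S v)))"

lemma reflects_dataD:
  assumes "reflects_data F" "(U, x) \<in> A" "(V, y) \<in> A" "u \<in> coord_dom (U, x) (V, y) F" "shape_data U x u S T \<nu>"
    "shape_data V y (coord_rep (U, x) (V, y) F u) S' T' \<nu>'"
  shows "\<nu>' = \<nu>" "T' = - differential (coord_rep (U, x) (V, y) F) u T"
    "S' (differential (coord_rep (U, x) (V, y) F) u v) = - differential (coord_rep (U, x) (V, y) F) u (S v)"
  using assms unfolding reflects_data_def by blast+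

end

section \<open>Isometries of the surface with a fixed curve\<close>

locale reflected_sister_surface = sister_surface +
  fixes \<sigma> :: "'a \<Rightarrow> 'a"
  assumes reflection: "surface_reflection M A h \<sigma>"
begin

lemma isometry: "surface_isometry M A h \<sigma>"
  using reflection by (simp add: surface_reflection_def)

abbreviation rep where "rep U x V y \<equiv> coord_rep (U, x) (V, y) \<sigma>"
abbreviation drep where "drep U x V y \<equiv> differential (coord_rep (U, x) (V, y) \<sigma>)"

definition fixed_direction :: "(real^2) set \<Rightarrow> (real^2 \<Rightarrow> 'a) \<Rightarrow> real^2 \<Rightarrow> real^2 \<Rightarrow> bool" where
  "fixed_direction U x u w \<longleftrightarrow> (U, x) \<in> A \<and> u \<in> coord_dom (U, x) (U, x) \<sigma> \<and> \<sigma> (x u) = x u \<and> w \<noteq> 0 \<and>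
     rep U x U x u = u \<and> drep U x U x u w = w"

lemma ex_fixed_direction: "\<exists>U x u w. fixed_direction U x u w"
  using reflection_fixed_direction[OF reflection] unfolding fixed_direction_def by metis

lemma fixed_directionD:
  assumes "fixed_direction U x u w"
  shows "(U, x) \<in> A" "u \<in> coord_dom (U, x) (U, x) \<sigma>" "\<sigma> (x u) = x u" "w \<noteq> 0" "rep U x U x u = u"
    "drep U x U x u w = w" "u \<in> U" "x u \<in> M"
  using assms smooth_surface_chart(4)[OF smooth, of U x] unfolding fixed_direction_def coord_dom_def by auto

text \<open>The differential fixes w, and if it commutes with J it fixes J w too.\<close>

lemma reverses_or_fixes_plane:
  assumes fx: "fixed_direction U x u w" and "\<not> reverses_at \<sigma> (x u)"
  shows "drep U x U x u v = v"
proof -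
  note f = fixed_directionD[OF fx]
  have form: "inner_form (h (U, x) u)" and rot: "rotation_of (h (U, x) u) (J (U, x) u)"
    using metric_inner_form rotation_of_field f by auto
  have lin: "linear (drep U x U x u)"
    using isometry_rep_linear[OF isometry f(1,1,2)] .
  have "\<exists>s. (s = 1 \<or> s = -1) \<and> (\<forall>v. drep U x U x u (J (U, x) u v) = s *\<^sub>R J (U, x) u (drep U x U x u v))"
    using isometry_rep_metric[OF isometry f(1,1,2)] f(5)
    by (intro isometry_rotation_sign[OF form rot form rot lin]) simp
  then obtain s where s: "s = 1 \<or> s = -1"
    "\<And>v. drep U x U x u (J (U, x) u v) = s *\<^sub>R J (U, x) u (drep U x U x u v)"
    by blast
  have "s \<noteq> -1"
  proof
    assume "s = -1"
    then have "reverses_at \<sigma> (x u)"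
      using s(2) f(5) by (intro reverses_atI[OF isometry f(1,1,2)]) simp
    then show False
      using assms(2) by simp
  qed
  then have Jw: "drep U x U x u (J (U, x) u w) = J (U, x) u w"
    using s f(6) by simp
  obtain a b where "v = a *\<^sub>R w + b *\<^sub>R J (U, x) u w"
    using rotation_of_basis[OF form rot f(4)] by blast
  then show ?thesis
    using Jw f(6) by (simp add: linear_add[OF lin] linear_scale[OF lin])
qed

lemma reflected_rotation:
  assumes "\<And>p. p \<in> M \<Longrightarrow> reverses_at \<sigma> p" "(U, x) \<in> A" "(V, y) \<in> A" "u \<in> coord_dom (U, x) (V, y) \<sigma>"
  shows "drep U x V y u (J (U, x) u v) = - J (V, y) (rep U x V y u) (drep U x V y u v)"
proof -
  have "x u \<in> M"
    using smooth_surface_chart(4)[OF smooth assms(2)] coord_rep_mem(3)[OF assms(4)] by blast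
  then have "reverses_at \<sigma> (x u)"
    by (rule assms(1))
  then show ?thesis
    using assms(2-4) unfolding reverses_at_def by blast
qed

lemma intertwine:
  fixes f k :: "'a \<Rightarrow> 'e::euclidean_space"
  assumes f: "\<And>U x. (U, x) \<in> A \<Longrightarrow> twice_differentiable_on U (f \<circ> x)"
    and L: "bounded_linear L" "\<And>p. p \<in> M \<Longrightarrow> f (\<sigma> p) = L (f p)"
    and c: "(U, x) \<in> A" and d: "(V, y) \<in> A" and u: "u \<in> coord_dom (U, x) (V, y) \<sigma>"
  shows "differential (f \<circ> y) (rep U x V y u) (drep U x V y u v) = L (differential (f \<circ> x) u v)"
proof -
  have uU: "u \<in> U"
    using coord_rep_mem(3)[OF u] .
  have "differential (f \<circ> \<sigma> \<circ> x) u = differential (\<lambda>u. L ((f \<circ> x) u)) u"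
  proof (rule differential_cong_open[OF smooth_surface_chart(1)[OF smooth c] uU])
    show "(f \<circ> \<sigma> \<circ> x) z = L ((f \<circ> x) z)" if "z \<in> U" for z
      using L(2)[of "x z"] smooth_surface_chart(4)[OF smooth c] that by auto
  qed
  also have "\<dots> = (\<lambda>v. L (differential (f \<circ> x) u v))"
    using f[OF c] uU by (intro differential_linear_compose(2)[OF L(1)]) (auto simp: twice_differentiable_on_def o_def)
  finally show ?thesis
    using twice_differentiable_on_isometry_rep(2)[OF isometry c d f[OF d] u, of v] by simp
qed

text \<open>For r = 1 and r = -1 these are the functions whose zeros tell with which sign L relates
  the values of f at p and \<sigma> p.\<close>

lemma continuous_normal:
  fixes f :: "'a \<Rightarrow> 'e::euclidean_space"
  assumes f: "\<And>U x. (U, x) \<in> A \<Longrightarrow> twice_differentiable_on U (f \<circ> x)"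
    and L: "bounded_linear L" and c: "(U, x) \<in> A" and u: "u \<in> U"
  shows "isCont (\<lambda>u. f (\<sigma> (x u)) + r *\<^sub>R L (f (x u))) u"
proof -
  have "f \<circ> \<sigma> \<circ> x differentiable (at u)" "f \<circ> x differentiable (at u)"
    using twice_differentiable_on_isometry[OF isometry f c] f[OF c] u by (auto simp: twice_differentiable_on_def)
  then have "isCont (f \<circ> \<sigma> \<circ> x) u" "isCont (f \<circ> x) u"
    using differentiable_imp_continuous_within by blast+
  then have "isCont (\<lambda>u. f (\<sigma> (x u))) u" "isCont (\<lambda>u. f (x u)) u"
    by (simp_all add: o_def)
  then show ?thesis
    by (intro continuous_intros bounded_linear.isCont[OF L])
qed

section \<open>The effect of a reflection of the Berger sphere on the data\<close>

context
  fixes a e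
  assumes leg: "legendrian a e" and sym: "\<And>p. p \<in> M \<Longrightarrow> \<phi> (\<sigma> p) = plane_reflection a e (\<phi> p)"
begin

lemma berger_intertwine:
  assumes c: "(U, x) \<in> A" and d: "(V, y) \<in> A" and u: "u \<in> coord_dom (U, x) (V, y) \<sigma>"
  shows "differential (\<phi> \<circ> y) (rep U x V y u) (drep U x V y u v) = plane_reflection a e (differential (\<phi> \<circ> x) u v)"
  using intertwine[OF twice_differentiable(1) plane_reflection_bounded_linear sym c d u] .

lemma berger_normal_sign:
  assumes "p \<in> M"
  shows "N (\<sigma> p) = plane_reflection a e (N p) \<or> N (\<sigma> p) = - plane_reflection a e (N p)"
proof -
  obtain U x u where c: "(U, x) \<in> A" and u: "u \<in> U" "x u = p"
    using smooth_surface_cover[OF smooth assms] .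
  obtain V y where d: "(V, y) \<in> A" and uD: "u \<in> coord_dom (U, x) (V, y) \<sigma>"
    using ex_target_chart[OF isometry c u(1)] .
  note mem = coord_rep_mem[OF uD]
  have \<phi>: "\<phi> (y (rep U x V y u)) = plane_reflection a e (\<phi> (x u))"
    using mem(2) sym[OF assms] u(2) by simp
  have "N (y (rep U x V y u)) = plane_reflection a e (N (x u)) \<or> N (y (rep U x V y u)) = - plane_reflection a e (N (x u))"
  proof (rule berger_normal_unique[OF d mem(1)])
    show "plane_reflection a e (N (x u)) \<bullet> \<phi> (y (rep U x V y u)) = 0"
      by (simp add: \<phi> plane_reflection_isometry[OF leg] berger_normal[OF c u(1)])
    show "g (\<phi> (y (rep U x V y u))) (plane_reflection a e (N (x u))) (plane_reflection a e (N (x u))) = 1"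
      by (simp add: \<phi> g_plane_reflection[OF leg] berger_normal[OF c u(1)])
    fix v
    obtain w where w: "v = drep U x V y u w"
      using isometry_rep_surj[OF isometry c d uD] by metis
    show "g (\<phi> (y (rep U x V y u))) (differential (\<phi> \<circ> y) (rep U x V y u) v) (plane_reflection a e (N (x u))) = 0"
      by (simp add: w berger_intertwine[OF c d uD] \<phi> g_plane_reflection[OF leg] berger_normal[OF c u(1)])
  qed
  then show ?thesis
    using mem(2) u(2) by simp
qed

text \<open>At a fixed point of \<sigma> the reflection fixes the position and the image of w. Were
  N fixed as well, three independent vectors would lie in the fixed plane. Connectedness spreads the
  sign found there.\<close>

lemma berger_normal_reversed:
  assumes "p \<in> M"
  shows "N (\<sigma> p) = - plane_reflection a e (N p)"
proof -
  obtain U\<^sub>0 x\<^sub>0 u\<^sub>0 w where fx: "fixed_direction U\<^sub>0 x\<^sub>0 u\<^sub>0 w"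
    using ex_fixed_direction by blast
  note f = fixed_directionD[OF fx]
  note lin = differential_linear(1)[OF f(1,7)]
  have base: "N (\<sigma> (x\<^sub>0 u\<^sub>0)) = - plane_reflection a e (N (x\<^sub>0 u\<^sub>0))"
  proof (rule ccontr)
    assume "N (\<sigma> (x\<^sub>0 u\<^sub>0)) \<noteq> - plane_reflection a e (N (x\<^sub>0 u\<^sub>0))"
    then have N: "plane_reflection a e (N (x\<^sub>0 u\<^sub>0)) = N (x\<^sub>0 u\<^sub>0)"
      using berger_normal_sign[OF f(8)] f(3) by auto
    have w: "plane_reflection a e (differential (\<phi> \<circ> x\<^sub>0) u\<^sub>0 w) = differential (\<phi> \<circ> x\<^sub>0) u\<^sub>0 w"
      using berger_intertwine[OF f(1,1,2), of w] f(5,6) by simp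
    have \<phi>: "plane_reflection a e (\<phi> (x\<^sub>0 u\<^sub>0)) = \<phi> (x\<^sub>0 u\<^sub>0)" "\<phi> (x\<^sub>0 u\<^sub>0) \<noteq> 0"
      using sym[OF f(8)] f(3) berger_immersion(2)[OF f(1,7)] by auto
    obtain r t where rt: "r \<noteq> 0 \<or> t \<noteq> 0" "r *\<^sub>R N (x\<^sub>0 u\<^sub>0) + t *\<^sub>R differential (\<phi> \<circ> x\<^sub>0) u\<^sub>0 w = 0"
      by (rule plane_reflection_fixed_dependent[OF \<phi> N berger_normal(4)[OF f(1,7)] w berger_immersion(4)[OF f(1,7)] leg])
    then have "frame (\<lambda>z. z) \<phi> N x\<^sub>0 u\<^sub>0 (0, r, t *\<^sub>R w) = 0"
      by (simp add: frame_def linear_scale[OF lin])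
    from berger_frame_inj[OF f(1,7) this] show False
      using rt(1) f(4) by (simp add: zero_prod_def)
  qed
  show ?thesis
  proof (rule locally_constant_on_connected[where P = "\<lambda>p. N (\<sigma> p) = - plane_reflection a e (N p)",
        OF smooth connected _ f(8) base assms])
    fix U x u assume c: "(U, x) \<in> A" and u: "u \<in> U"
    define k where "k = (\<lambda>r u. N (\<sigma> (x u)) + r *\<^sub>R plane_reflection a e (N (x u)))"
    show "\<exists>W. open W \<and> u \<in> W \<and> W \<subseteq> U \<and>
      (\<forall>u'\<in>W. (N (\<sigma> (x u')) = - plane_reflection a e (N (x u'))) \<longleftrightarrow> (N (\<sigma> (x u)) = - plane_reflection a e (N (x u))))"
    proof (rule locally_constant_dichotomy[OF chart_open[OF c u] u, of "k 1" "k (-1)"])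
      have "isCont (k r) u" for r
        unfolding k_def
        by (rule continuous_normal[OF twice_differentiable(2) plane_reflection_bounded_linear c u])
      from this[of 1] this[of "- 1"] show "isCont (k 1) u" "isCont (k (-1)) u" .
      fix z assume z: "z \<in> U"
      show "N (\<sigma> (x z)) = - plane_reflection a e (N (x z)) \<longleftrightarrow> k 1 z = 0"
        by (simp add: k_def eq_neg_iff_add_eq_0)
      have "N (x z) \<bullet> N (x z) \<noteq> 0"
        using berger_normal(1)[OF c z] by (auto simp: g_eq)
      then have "plane_reflection a e (N (x z)) \<noteq> 0"
        using plane_reflection_isometry[OF leg, of "N (x z)" "N (x z)"] by auto
      then have "plane_reflection a e (N (x z)) + plane_reflection a e (N (x z)) \<noteq> 0"
        by (simp add: scaleR_2[symmetric])
      moreover have "x z \<in> M"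
        using smooth_surface_chart(4)[OF smooth c] z by blast
      ultimately show "k 1 z = 0 \<longleftrightarrow> k (-1) z \<noteq> 0"
        using berger_normal_sign[of "x z"] by (auto simp: k_def)
    qed
  qed
qed

text \<open>If \<sigma> kept the orientation, its differential at a fixed point would be the
  identity, and the position together with two tangent directions would lie in the fixed plane of
  the reflection.\<close>

lemma berger_reverses:
  assumes "p \<in> M"
  shows "reverses_at \<sigma> p"
proof -
  obtain U x u w where fx: "fixed_direction U x u w"
    using ex_fixed_direction by blast
  note f = fixed_directionD[OF fx]
  note lin = differential_linear(1)[OF f(1,7)]
  note form = metric_form[OF f(1,7)]
  have "reverses_at \<sigma> (x u)"
  proof (rule ccontr)
    assume "\<not> reverses_at \<sigma> (x u)"
    then have v: "plane_reflection a e (differential (\<phi> \<circ> x) u v) = differential (\<phi> \<circ> x) u v" for v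
      using reverses_or_fixes_plane[OF fx] berger_intertwine[OF f(1,1,2), of v] f(5) by simp
    have \<phi>: "plane_reflection a e (\<phi> (x u)) = \<phi> (x u)" "\<phi> (x u) \<noteq> 0"
      using sym[OF f(8)] f(3) berger_immersion(2)[OF f(1,7)] by auto
    define w' where "w' = J (U, x) u w"
    obtain r t where rt: "r \<noteq> 0 \<or> t \<noteq> 0"
      "r *\<^sub>R differential (\<phi> \<circ> x) u w + t *\<^sub>R differential (\<phi> \<circ> x) u w' = 0"
      by (rule plane_reflection_fixed_dependent[OF \<phi> v berger_immersion(4)[OF f(1,7)] v berger_immersion(4)[OF f(1,7)] leg])
    then have "frame (\<lambda>z. z) \<phi> N x u (0, 0, r *\<^sub>R w + t *\<^sub>R w') = 0"
      by (simp add: frame_def linear_scale[OF lin] linear_add[OF lin])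
    from berger_frame_inj[OF f(1,7) this] have 0: "r *\<^sub>R w + t *\<^sub>R w' = 0"
      by (simp add: zero_prod_def)
    have w': "h (U, x) u w' w' = h (U, x) u w w" "h (U, x) u w' w = 0" "h (U, x) u w w' = 0"
      using rotation_of_field[OF f(1,7)] inner_form_sym[OF form, of w w'] by (auto simp: rotation_of_def w'_def)
    have "h (U, x) u (r *\<^sub>R w + t *\<^sub>R w') w = 0" "h (U, x) u (r *\<^sub>R w + t *\<^sub>R w') w' = 0"
      unfolding 0 by (simp_all add: inner_form_simps[OF form])
    then show False
      using rt(1) f(4) w' inner_form_eq_0_iff[OF form] by (simp add: inner_form_simps[OF form])
  qed
  then show ?thesis
    using reverses_at_everywhere[OF isometry f(8) _ assms] by blast
qed

text \<open>The reflection preserves the metric and the Christoffel terms and negates the Hopf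
  field. Since it carries N to minus the normal at the image point, comparing the decompositions of
  the vertical field keeps \<nu> and reverses T, and the reversed normal changes the sign of
  S.\<close>

lemma berger_reflects_data: "reflects_data \<sigma>"
  unfolding reflects_data_def
proof (intro allI impI)
  fix U x V y u S T \<nu> S' T' \<nu>'
  assume c: "(U, x) \<in> A" and d: "(V, y) \<in> A" and uD: "u \<in> coord_dom (U, x) (V, y) \<sigma>"
    and data: "shape_data U x u S T \<nu>" and data': "shape_data V y (rep U x V y u) S' T' \<nu>'"
  note mem = coord_rep_mem[OF uD]
  let ?L = "plane_reflection a e" and ?s = "rep U x V y u" and ?ds = "drep U x V y u"
  have M: "x u \<in> M"
    using smooth_surface_chart(4)[OF smooth c] mem(3) by blast
  note lin = differential_linear[OF d mem(1)] and linL = plane_reflection_linear[of a e]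
  have \<phi>: "\<phi> (y ?s) = ?L (\<phi> (x u))" and N: "N (y ?s) = - ?L (N (x u))"
    using sym[OF M] berger_normal_reversed[OF M] mem(2) by simp_all
  have d\<phi>: "differential (\<phi> \<circ> y) ?s (?ds v) = ?L (differential (\<phi> \<circ> x) u v)" for v
    by (rule berger_intertwine[OF c d uD])
  have bl: "bounded_linear (\<lambda>X. - ?L X)"
    by (rule bounded_linear_minus[OF plane_reflection_bounded_linear])
  have dN: "differential (N \<circ> y) ?s (?ds v) = - ?L (differential (N \<circ> x) u v)" for v
    using intertwine[OF twice_differentiable(2) bl berger_normal_reversed c d uD] .
  have form: "inner_form (h (V, y) ?s)"
    by (rule metric_form[OF d mem(1)])
  have "differential (\<phi> \<circ> y) ?s T' + \<nu>' *\<^sub>R N (y ?s) = (\<kappa> / (4 * \<tau>)) *\<^sub>R hopf_field (?L (\<phi> (x u)))"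
    using shape_dataD(3)[OF data'] \<phi> by simp
  also have "\<dots> = - ?L ((\<kappa> / (4 * \<tau>)) *\<^sub>R hopf_field (\<phi> (x u)))"
    by (simp add: plane_reflection_hopf[OF leg] linear_scale[OF linL])
  also have "\<dots> = - ?L (differential (\<phi> \<circ> x) u T + \<nu> *\<^sub>R N (x u))"
    using shape_dataD(3,5)[OF data] by simp
  also have "\<dots> = differential (\<phi> \<circ> y) ?s (- ?ds T) + \<nu> *\<^sub>R N (y ?s)"
    by (simp add: linear_add[OF linL] linear_scale[OF linL] linear_neg[OF lin(1)] d\<phi> N)
  finally have "frame (\<lambda>z. z) \<phi> N y ?s (0, \<nu>' - \<nu>, T' - (- ?ds T)) = 0"
    by (simp add: frame_def linear_diff[OF lin(1)] linear_add[OF lin(1)] linear_neg[OF lin(1)] algebra_simps)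
  from berger_frame_inj[OF d mem(1) this] have "\<nu>' = \<nu>" "T' = - ?ds T"
    by (simp_all add: zero_prod_def add_eq_0_iff)
  moreover have "S' (?ds v) = - ?ds (S v)" for v
  proof (rule inner_form_eqI[OF form])
    fix z
    obtain w where z: "z = ?ds w"
      using isometry_rep_surj[OF isometry c d uD] by metis
    have "- g (\<phi> (y ?s)) (differential (\<phi> \<circ> y) ?s (S' (?ds v))) (differential (\<phi> \<circ> y) ?s (?ds w))
        = g (\<phi> (y ?s)) (differential (N \<circ> y) ?s (?ds v)) (differential (\<phi> \<circ> y) ?s (?ds w))
          + christoffel g (\<phi> (y ?s)) (differential (\<phi> \<circ> y) ?s (?ds v)) (N (y ?s)) (differential (\<phi> \<circ> y) ?s (?ds w))"
      by (rule shape_dataD(2)[OF data' berger_immersion(4)[OF d mem(1)], symmetric])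
    also have "\<dots> = - (g (\<phi> (x u)) (differential (N \<circ> x) u v) (differential (\<phi> \<circ> x) u w)
          + christoffel g (\<phi> (x u)) (differential (\<phi> \<circ> x) u v) (N (x u)) (differential (\<phi> \<circ> x) u w))"
    proof -
      have "christoffel g p X (- Y) Z = - christoffel g p X Y Z" for p X Y Z
        unfolding christoffel_g by (simp only: hopf_simps inner_minus_left inner_minus_right) algebra
      then show ?thesis
        by (simp add: dN d\<phi> \<phi> N g_simps g_plane_reflection[OF leg])
    qed
    also have "\<dots> = g (\<phi> (x u)) (differential (\<phi> \<circ> x) u (S v)) (differential (\<phi> \<circ> x) u w)"
      using shape_dataD(2)[OF data berger_immersion(4)[OF c mem(3), of w], of v] by simp
    also have "\<dots> = h (V, y) ?s (?ds (S v)) (?ds w)"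
      by (simp add: berger_immersion(3)[OF c mem(3)] isometry_rep_metric[OF isometry c d uD])
    finally show "h (V, y) ?s (S' (?ds v)) z = h (V, y) ?s (- ?ds (S v)) z"
      by (simp add: berger_immersion(3)[OF d mem(1)] z inner_form_simps[OF form])
  qed
  ultimately show "\<nu>' = \<nu> \<and> T' = - ?ds T \<and> (\<forall>v. S' (?ds v) = - ?ds (S v))"
    by blast
qed

end

section \<open>The effect of a reflection in a vertical plane on the data\<close>

context
  fixes v\<^sub>0
  assumes unit: "mink \<epsilon> v\<^sub>0 v\<^sub>0 = 1" and sym: "\<And>p. p \<in> M \<Longrightarrow> \<phi>' (\<sigma> p) = vertical_reflection \<epsilon> v\<^sub>0 (\<phi>' p)"
begin

lemma product_intertwine:
  assumes c: "(U, x) \<in> A" and d: "(V, y) \<in> A" and u: "u \<in> coord_dom (U, x) (V, y) \<sigma>"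
  shows "differential (\<phi>' \<circ> y) (rep U x V y u) (drep U x V y u v) = vertical_reflection \<epsilon> v\<^sub>0 (differential (\<phi>' \<circ> x) u v)"
  using intertwine[OF twice_differentiable(3) vertical_reflection_bounded_linear sym c d u] .

lemma \<beta>_reflection: "\<beta> (vertical_reflection \<epsilon> v\<^sub>0 X) (vertical_reflection \<epsilon> v\<^sub>0 Y) = \<beta> X Y"
  by (rule vertical_reflection_isometry[OF unit])

lemma mink_reflection:
  "mink \<epsilon> (fst (vertical_reflection \<epsilon> v\<^sub>0 X)) (fst (vertical_reflection \<epsilon> v\<^sub>0 Y)) = mink \<epsilon> (fst X) (fst Y)"
  using \<beta>_reflection[of X Y] by (simp add: M2R_metric_def vertical_reflection_def)

lemma product_normal_sign:
  assumes "p \<in> M"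
  shows "N' (\<sigma> p) = vertical_reflection \<epsilon> v\<^sub>0 (N' p) \<or> N' (\<sigma> p) = - vertical_reflection \<epsilon> v\<^sub>0 (N' p)"
proof -
  obtain U x u where c: "(U, x) \<in> A" and u: "u \<in> U" "x u = p"
    using smooth_surface_cover[OF smooth assms] .
  obtain V y where d: "(V, y) \<in> A" and uD: "u \<in> coord_dom (U, x) (V, y) \<sigma>"
    using ex_target_chart[OF isometry c u(1)] .
  note mem = coord_rep_mem[OF uD]
  have \<phi>: "\<phi>' (y (rep U x V y u)) = vertical_reflection \<epsilon> v\<^sub>0 (\<phi>' (x u))"
    using mem(2) sym[OF assms] u(2) by simp
  have "N' (y (rep U x V y u)) = vertical_reflection \<epsilon> v\<^sub>0 (N' (x u)) \<or> N' (y (rep U x V y u)) = - vertical_reflection \<epsilon> v\<^sub>0 (N' (x u))"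
  proof (rule product_normal_unique[OF d mem(1)])
    show "mink \<epsilon> (fst (vertical_reflection \<epsilon> v\<^sub>0 (N' (x u)))) (fst (\<phi>' (y (rep U x V y u)))) = 0"
      by (simp add: \<phi> mink_reflection product_normal[OF c u(1)])
    show "\<beta> (vertical_reflection \<epsilon> v\<^sub>0 (N' (x u))) (vertical_reflection \<epsilon> v\<^sub>0 (N' (x u))) = 1"
      by (simp add: \<beta>_reflection product_normal[OF c u(1)])
    fix v
    obtain w where w: "v = drep U x V y u w"
      using isometry_rep_surj[OF isometry c d uD] by metis
    show "\<beta> (differential (\<phi>' \<circ> y) (rep U x V y u) v) (vertical_reflection \<epsilon> v\<^sub>0 (N' (x u))) = 0"
      by (simp add: w product_intertwine[OF c d uD] \<beta>_reflection product_normal[OF c u(1)])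
  qed
  then show ?thesis
    using mem(2) u(2) by simp
qed

text \<open>The other sign would make the mean curvature \<open>\<tau>\<close> equal to \<open>- \<tau>\<close>.\<close>

lemma product_normal_preserved:
  assumes "p \<in> M"
  shows "N' (\<sigma> p) = vertical_reflection \<epsilon> v\<^sub>0 (N' p)"
proof (rule ccontr)
  let ?R = "vertical_reflection \<epsilon> v\<^sub>0"
  assume ne: "N' (\<sigma> p) \<noteq> ?R (N' p)"
  obtain U x u where c: "(U, x) \<in> A" and u: "u \<in> U" "x u = p"
    using smooth_surface_cover[OF smooth assms] .
  obtain V y where d: "(V, y) \<in> A" and uD: "u \<in> coord_dom (U, x) (V, y) \<sigma>"
    using ex_target_chart[OF isometry c u(1)] .
  note mem = coord_rep_mem[OF uD]
  let ?s = "rep U x V y u" and ?ds = "drep U x V y u"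
  \<comment> \<open>As k does not vanish at p, the other sign holds in a whole neighbourhood and may
    be differentiated there.\<close>
  define k where "k = (\<lambda>u. N' (\<sigma> (x u)) + (-1) *\<^sub>R ?R (N' (x u)))"
  have k: "isCont k u"
    unfolding k_def by (rule continuous_normal[OF twice_differentiable(4) vertical_reflection_bounded_linear c u(1)])
  have "(k \<longlongrightarrow> k u) (nhds u)"
    using k by (simp add: isCont_def tendsto_at_iff_tendsto_nhds)
  moreover have "k u \<noteq> 0"
    using ne u(2) by (simp add: k_def)
  ultimately have "\<forall>\<^sub>F z in nhds u. k z \<noteq> 0"
    by (rule tendsto_imp_eventually_ne)
  then obtain W where W: "open W" "u \<in> W" "\<And>z. z \<in> W \<Longrightarrow> k z \<noteq> 0"
    unfolding eventually_nhds by blast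
  have WU: "open (W \<inter> U)" "u \<in> W \<inter> U"
    using W chart_open[OF c u(1)] u by auto
  have dN: "differential (N' \<circ> y) ?s (?ds v) = - ?R (differential (N' \<circ> x) u v)" for v
  proof -
    have "(N' \<circ> \<sigma> \<circ> x) z = - ?R ((N' \<circ> x) z)" if "z \<in> W \<inter> U" for z
    proof -
      have "x z \<in> M"
        using smooth_surface_chart(4)[OF smooth c] that by blast
      then show ?thesis
        using product_normal_sign[of "x z"] W(3)[of z] that by (auto simp: k_def)
    qed
    then have "differential (N' \<circ> \<sigma> \<circ> x) u = differential (\<lambda>z. - ?R ((N' \<circ> x) z)) u"
      by (rule differential_cong_open[OF WU])
    also have "\<dots> = (\<lambda>v. - ?R (differential (N' \<circ> x) u v))"
      by (rule differential_linear_compose(2)[OF bounded_linear_minus[OF vertical_reflection_bounded_linear]])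
         (rule differentiable(4)[OF c u(1)])
    finally show ?thesis
      using twice_differentiable_on_isometry_rep(2)[OF isometry c d twice_differentiable(4)[OF d] uD, of v] by simp
  qed
  obtain S T \<nu> where data: "shape_data U x u S T \<nu>"
    using ex_shape_data[OF c u(1)] by blast
  obtain S' T' \<nu>' where data': "shape_data V y ?s S' T' \<nu>'"
    using ex_shape_data[OF d mem(1)] by blast
  have form: "inner_form (h (V, y) ?s)"
    by (rule metric_form[OF d mem(1)])
  have lds: "linear ?ds"
    by (rule isometry_rep_linear[OF isometry c d uD])
  define K where "K = (\<lambda>v. - J (U, x) u (S v) + \<tau> *\<^sub>R v)"
  define K' where "K' = (\<lambda>v. - J (V, y) ?s (S' v) + \<tau> *\<^sub>R v)"
  have "K' (?ds v) = - ?ds (K v)" for v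
  proof (rule inner_form_eqI[OF form])
    fix z
    obtain w where z: "z = ?ds w"
      using isometry_rep_surj[OF isometry c d uD] by metis
    have "h (V, y) ?s (- K' (?ds v)) (?ds w) = \<beta> (differential (N' \<circ> y) ?s (?ds v)) (differential (\<phi>' \<circ> y) ?s (?ds w))"
      using shape_dataD(4)[OF data', of "?ds v" "?ds w"] by (simp add: K'_def)
    also have "\<dots> = - \<beta> (differential (N' \<circ> x) u v) (differential (\<phi>' \<circ> x) u w)"
      by (simp add: dN product_intertwine[OF c d uD] \<beta>_simps \<beta>_reflection)
    also have "\<dots> = - h (U, x) u (- K v) w"
      using shape_dataD(4)[OF data, of v w] by (simp add: K_def)
    also have "\<dots> = h (V, y) ?s (?ds (K v)) (?ds w)"
      by (simp add: inner_form_simps[OF metric_form[OF c u(1)]] isometry_rep_metric[OF isometry c d uD])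
    finally show "h (V, y) ?s (K' (?ds v)) z = h (V, y) ?s (- ?ds (K v)) z"
      by (simp add: z inner_form_simps[OF form])
  qed
  moreover have "linear K" "linear K'"
    using data data' rotation_of_field[OF c u(1)] rotation_of_field[OF d mem(1)]
    unfolding K_def K'_def shape_data_def rotation_of_def
    by (auto intro!: linearI simp: linear_add linear_scale algebra_simps)
  \<comment> \<open>K and K' represent the shape operator of the sister at corresponding points. The
    other sign makes K' conjugate to - K, although both have trace 2 \<tau>.\<close>
  ultimately have "trace (matrix K') = - trace (matrix K)"
    using isometry_rep_surj[OF isometry c d uD] by (intro trace_conjugate_neg[OF lds]) (auto simp: surj_def, metis)
  moreover have "trace (matrix K) = 2 * \<tau>" "trace (matrix K') = 2 * \<tau>"
    using data data' by (auto simp: shape_data_def K_def K'_def)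
  ultimately show False
    using \<tau>_nz by simp
qed

text \<open>If \<sigma> kept the orientation, the reflection would fix the whole frame at a fixed
  point and so be the identity, yet it negates \<open>(v\<^sub>0, 0)\<close>.\<close>

lemma product_reverses:
  assumes "p \<in> M"
  shows "reverses_at \<sigma> p"
proof -
  obtain U x u w where fx: "fixed_direction U x u w"
    using ex_fixed_direction by blast
  note f = fixed_directionD[OF fx]
  let ?R = "vertical_reflection \<epsilon> v\<^sub>0"
  have "reverses_at \<sigma> (x u)"
  proof (rule ccontr)
    assume "\<not> reverses_at \<sigma> (x u)"
    then have v: "?R (differential (\<phi>' \<circ> x) u v) = differential (\<phi>' \<circ> x) u v" for v
      using reverses_or_fixes_plane[OF fx] product_intertwine[OF f(1,1,2), of v] f(5) by simp
    have "?R (\<phi>' (x u)) = \<phi>' (x u)" "?R (N' (x u)) = N' (x u)"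
      using sym[OF f(8)] product_normal_preserved[OF f(8)] f(3) by auto
    then have R: "?R (horizontal_part (\<phi>' (x u))) = horizontal_part (\<phi>' (x u))" "?R (N' (x u)) = N' (x u)"
      by (auto simp: vertical_reflection_def horizontal_part_def prod_eq_iff)
    obtain p n z where f0: "frame horizontal_part \<phi>' N' x u (p, n, z) = (v\<^sub>0, 0)"
      using product_frame_surj[OF f(1,7)] by blast
    have "?R (frame horizontal_part \<phi>' N' x u (p, n, z)) = frame horizontal_part \<phi>' N' x u (p, n, z)"
      by (simp add: frame_def linear_add[OF vertical_reflection_linear] linear_scale[OF vertical_reflection_linear] R v)
    then have "?R (v\<^sub>0, 0) = (v\<^sub>0, 0)"
      by (simp only: f0)
    then have "v\<^sub>0 = 0"
      using unit by (simp add: vertical_reflection_def)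
    then show False
      using unit by (simp add: mink_def)
  qed
  then show ?thesis
    using reverses_at_everywhere[OF isometry f(8) _ assms] by blast
qed

text \<open>The reflection fixes the vertical field and carries the normal to the normal, so the
  differential of \<sigma> preserves \<nu>, J T and J S - \<tau>. As it anticommutes with J, it must
  reverse T and S.\<close>

lemma product_reflects_data: "reflects_data \<sigma>"
  unfolding reflects_data_def
proof (intro allI impI)
  fix U x V y u S T \<nu> S' T' \<nu>'
  assume c: "(U, x) \<in> A" and d: "(V, y) \<in> A" and uD: "u \<in> coord_dom (U, x) (V, y) \<sigma>"
    and data: "shape_data U x u S T \<nu>" and data': "shape_data V y (rep U x V y u) S' T' \<nu>'"
  note mem = coord_rep_mem[OF uD]
  let ?R = "vertical_reflection \<epsilon> v\<^sub>0" and ?s = "rep U x V y u" and ?ds = "drep U x V y u"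
  have M: "x u \<in> M"
    using smooth_surface_chart(4)[OF smooth c] mem(3) by blast
  note lin = differential_linear(3)[OF d mem(1)] and linR = vertical_reflection_linear[of \<epsilon> v\<^sub>0]
  have N: "N' (y ?s) = ?R (N' (x u))"
    using product_normal_preserved[OF M] mem(2) by simp
  have d\<phi>: "differential (\<phi>' \<circ> y) ?s (?ds v) = ?R (differential (\<phi>' \<circ> x) u v)" for v
    by (rule product_intertwine[OF c d uD])
  have dN: "differential (N' \<circ> y) ?s (?ds v) = ?R (differential (N' \<circ> x) u v)" for v
    using intertwine[OF twice_differentiable(4) vertical_reflection_bounded_linear product_normal_preserved c d uD] .
  have form: "inner_form (h (V, y) ?s)" and rot: "rotation_of (h (V, y) ?s) (J (V, y) ?s)"
    using metric_form[OF d mem(1)] rotation_of_field[OF d mem(1)] by auto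
  note rev = reflected_rotation[OF product_reverses c d uD]
  have lds: "linear ?ds" and linJ: "linear (J (V, y) ?s)"
    using isometry_rep_linear[OF isometry c d uD] rot by (auto simp: rotation_of_def)
  have Jinj: "a = b" if "J (V, y) ?s a = J (V, y) ?s b" for a b
    using rotation_of_square[OF form rot] that by (metis neg_equal_iff_equal)
  have "differential (\<phi>' \<circ> y) ?s (- J (V, y) ?s T') + \<nu>' *\<^sub>R N' (y ?s) = (0, 1)"
    using shape_dataD(5)[OF data'] by simp
  also have "\<dots> = ?R (0, 1)"
    by (simp add: vertical_reflection_def mink_def)
  also have "(0, 1) = differential (\<phi>' \<circ> x) u (- J (U, x) u T) + \<nu> *\<^sub>R N' (x u)"
    using shape_dataD(3,5)[OF data] by simp
  also have "?R (differential (\<phi>' \<circ> x) u (- J (U, x) u T) + \<nu> *\<^sub>R N' (x u))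
      = differential (\<phi>' \<circ> y) ?s (J (V, y) ?s (?ds T)) + \<nu> *\<^sub>R N' (y ?s)"
    by (simp add: linear_add[OF linR] linear_scale[OF linR] N d\<phi>[symmetric] rev linear_neg[OF lds])
  finally have eq: "differential (\<phi>' \<circ> y) ?s (- J (V, y) ?s T') + \<nu>' *\<^sub>R N' (y ?s)
      = differential (\<phi>' \<circ> y) ?s (J (V, y) ?s (?ds T)) + \<nu> *\<^sub>R N' (y ?s)" .
  have "frame horizontal_part \<phi>' N' y ?s (0, \<nu>' - \<nu>, - J (V, y) ?s T' - J (V, y) ?s (?ds T))
      = (differential (\<phi>' \<circ> y) ?s (- J (V, y) ?s T') + \<nu>' *\<^sub>R N' (y ?s))
        - (differential (\<phi>' \<circ> y) ?s (J (V, y) ?s (?ds T)) + \<nu> *\<^sub>R N' (y ?s))"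
    by (simp add: frame_def linear_diff[OF lin] scaleR_diff_left)
  also have "\<dots> = 0"
    by (simp only: eq diff_self)
  finally have "frame horizontal_part \<phi>' N' y ?s (0, \<nu>' - \<nu>, - J (V, y) ?s T' - J (V, y) ?s (?ds T)) = 0" .
  from product_frame_inj[OF d mem(1) this] have \<nu>: "\<nu>' = \<nu>" and JT: "J (V, y) ?s T' = J (V, y) ?s (- ?ds T)"
    by (simp_all add: zero_prod_def linear_neg[OF linJ] neg_eq_iff_add_eq_0 eq_neg_iff_add_eq_0)
  have "S' (?ds v) = - ?ds (S v)" for v
  proof -
    have "J (V, y) ?s (S' (?ds v)) - \<tau> *\<^sub>R ?ds v = ?ds (J (U, x) u (S v) - \<tau> *\<^sub>R v)"
    proof (rule inner_form_eqI[OF form])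
      fix z
      obtain w where z: "z = ?ds w"
        using isometry_rep_surj[OF isometry c d uD] by metis
      have "h (V, y) ?s (J (V, y) ?s (S' (?ds v)) - \<tau> *\<^sub>R ?ds v) (?ds w)
          = \<beta> (differential (N' \<circ> y) ?s (?ds v)) (differential (\<phi>' \<circ> y) ?s (?ds w))"
        using shape_dataD(4)[OF data', of "?ds v" "?ds w"] by simp
      also have "\<dots> = \<beta> (differential (N' \<circ> x) u v) (differential (\<phi>' \<circ> x) u w)"
        by (simp add: dN d\<phi> \<beta>_reflection)
      also have "\<dots> = h (U, x) u (J (U, x) u (S v) - \<tau> *\<^sub>R v) w"
        by (rule shape_dataD(4)[OF data])
      finally show "h (V, y) ?s (J (V, y) ?s (S' (?ds v)) - \<tau> *\<^sub>R ?ds v) z = h (V, y) ?s (?ds (J (U, x) u (S v) - \<tau> *\<^sub>R v)) z"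
        by (simp add: z isometry_rep_metric[OF isometry c d uD])
    qed
    then have "J (V, y) ?s (S' (?ds v)) = J (V, y) ?s (- ?ds (S v))"
      by (simp add: linear_diff[OF lds] linear_scale[OF lds] rev linear_neg[OF linJ])
    then show ?thesis
      by (rule Jinj)
  qed
  then show "\<nu>' = \<nu> \<and> T' = - ?ds T \<and> (\<forall>v. S' (?ds v) = - ?ds (S v))"
    using \<nu> Jinj[OF JT] by blast
qed

end

end

section \<open>From the data to a vertical plane\<close>

context reflected_sister_surface
begin

context
  assumes reflects: "reflects_data \<sigma>" and reverses: "\<And>p. p \<in> M \<Longrightarrow> reverses_at \<sigma> p"
begin

lemma reflected_chart:
  assumes c: "(U, x) \<in> A" and u: "u \<in> U"
  obtains V y S T \<nu> S' where "(V, y) \<in> A" "u \<in> coord_dom (U, x) (V, y) \<sigma>" "shape_data U x u S T \<nu>"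
    "shape_data V y (rep U x V y u) S' (- drep U x V y u T) \<nu>" "\<And>v. S' (drep U x V y u v) = - drep U x V y u (S v)"
proof -
  obtain V y where d: "(V, y) \<in> A" and uD: "u \<in> coord_dom (U, x) (V, y) \<sigma>"
    using ex_target_chart[OF isometry c u] .
  obtain S T \<nu> where data: "shape_data U x u S T \<nu>"
    using ex_shape_data[OF c u] by blast
  obtain S' T' \<nu>' where data': "shape_data V y (rep U x V y u) S' T' \<nu>'"
    using ex_shape_data[OF d coord_rep_mem(1)[OF uD]] by blast
  note r = reflects_dataD[OF reflects c d uD data data']
  show thesis
    using that[OF d uD data, of S'] data' r(3) unfolding r(1,2) by blast
qed

lemma fixed_direction_data:
  assumes fx: "fixed_direction U x u w"
  obtains S T \<nu> where "shape_data U x u S T \<nu>" "drep U x U x u T = - T"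
proof -
  note f = fixed_directionD[OF fx]
  obtain S T \<nu> where data: "shape_data U x u S T \<nu>"
    using ex_shape_data[OF f(1,7)] by blast
  have "T = - drep U x U x u T"
    using reflects_dataD(2)[OF reflects f(1,1,2) data] data f(5) by simp
  then have "drep U x U x u T = - T"
    by (metis minus_minus)
  then show thesis
    using that[OF data] by blast
qed

lemma fixed_direction_basis:
  assumes fx: "fixed_direction U x u w" and "linear f\<^sub>1" "linear f\<^sub>2"
    and "f\<^sub>1 w = f\<^sub>2 w" "f\<^sub>1 (J (U, x) u w) = f\<^sub>2 (J (U, x) u w)"
  shows "f\<^sub>1 v = f\<^sub>2 v"
proof -
  note f = fixed_directionD[OF fx]
  obtain a b where "v = a *\<^sub>R w + b *\<^sub>R J (U, x) u w"
    using rotation_of_basis[OF metric_form[OF f(1,7)] rotation_of_field[OF f(1,7)] f(4)] by blast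
  then show ?thesis
    using assms(2-) by (simp add: linear_add linear_scale)
qed

lemma fixed_direction_differential:
  assumes fx: "fixed_direction U x u w" and tw: "twice_differentiable_on U (f \<circ> x)"
  shows "differential (f \<circ> \<sigma> \<circ> x) u v = differential (f \<circ> x) u (drep U x U x u v)"
  using twice_differentiable_on_isometry_rep(2)[OF isometry _ _ tw] fixed_directionD[OF fx] by simp

lemma fixed_direction_metric:
  assumes fx: "fixed_direction U x u w"
  shows "h (U, x) u (drep U x U x u v) (drep U x U x u z) = h (U, x) u v z"
  using isometry_rep_metric[OF isometry, of U x U x u v z] fixed_directionD[OF fx] by simp

text \<open>The vector v is read off at a fixed point: it is the unit vector along the image of t =
  J w, the tangent direction that \<sigma> reverses. The reflection that negates it acts on the
  frame there as \<sigma> does, and \<open>congruent_immersions\<close> extends this to the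
  surface.\<close>

theorem product_symmetric:
  "symmetry_in_vertical_plane M \<epsilon> \<phi>' \<sigma>"
proof -
  obtain U\<^sub>0 x\<^sub>0 u\<^sub>0 w where fx: "fixed_direction U\<^sub>0 x\<^sub>0 u\<^sub>0 w"
    using ex_fixed_direction by blast
  note f = fixed_directionD[OF fx]
  let ?h = "h (U\<^sub>0, x\<^sub>0) u\<^sub>0" and ?J = "J (U\<^sub>0, x\<^sub>0) u\<^sub>0" and ?d = "differential (\<phi>' \<circ> x\<^sub>0) u\<^sub>0" and ?ds = "drep U\<^sub>0 x\<^sub>0 U\<^sub>0 x\<^sub>0 u\<^sub>0"
  note form = metric_form[OF f(1,7)]
  have rot: "rotation_of ?h ?J"
    using rotation_of_field[OF f(1,7)] .
  then have linJ: "linear ?J"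
    by (simp add: rotation_of_def)
  note lin = differential_linear(3)[OF f(1,7)]
  obtain S T \<nu> where data: "shape_data U\<^sub>0 x\<^sub>0 u\<^sub>0 S T \<nu>" and T: "?ds T = - T"
    using fixed_direction_data[OF fx] by blast
  have dsJ: "?ds (?J v) = - ?J (?ds v)" for v
    using reflected_rotation[OF reverses f(1,1,2), of v] f(5) by simp
  have lds: "linear ?ds"
    using isometry_rep_linear[OF isometry f(1,1,2)] .
  define t where "t = ?J w"
  have dst: "?ds t = - t"
    using dsJ[of w] f(6) by (simp add: t_def)
  have tt: "?h t t = ?h w w" "?h w t = 0"
    using rot inner_form_sym[OF form, of w t] by (simp_all add: t_def rotation_of_def)
  have ww: "?h w w > 0"
    using form f(4) by (simp add: inner_form_def)
  have "?ds (?J T) = ?J T"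
    using dsJ[of T] T by (simp add: linear_neg[OF linJ])
  \<comment> \<open>The differential of \<sigma> fixes J T and reverses t, so the two are
    orthogonal. By \<open>product_height\<close> the image of t is then horizontal, as a normal of a
    vertical plane has to be.\<close>
  then have "?h (?J T) t = - ?h (?J T) t"
    using fixed_direction_metric[OF fx, of "?J T" t] dst by (simp add: inner_form_simps[OF form])
  then have "snd (?d t) = 0"
    using product_height(1)[OF f(1,7) data, of t] by (simp add: inner_form_simps[OF form])
  then have dt: "?d t = (fst (?d t), 0)"
    by (simp add: prod_eq_iff)
  define r where "r = sqrt (?h w w)"
  have r: "r > 0" "r * r = ?h w w"
    using ww by (simp_all add: r_def)
  define v where "v = (1 / r) *\<^sub>R fst (?d t)"
  have mink_v: "mink \<epsilon> (fst X) v = (1 / r) * \<beta> X (?d t)" for X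
    by (subst dt) (simp add: v_def M2R_metric_def bilinear_rmul[OF mink_bilinear])
  have dt_v: "?d t = r *\<^sub>R (v, 0)"
    using r(1) by (subst dt) (simp add: v_def)
  have unit: "mink \<epsilon> v v = 1"
  proof -
    have "\<beta> (?d t) (?d t) = r * \<beta> (v, 0) (?d t)"
      by (subst (1) dt_v) (simp only: bilinear_lmul[OF bilinear_\<beta>] real_scaleR_def)
    then have "\<beta> (v, 0) (?d t) = (1 / r) * \<beta> (?d t) (?d t)"
      using r(1) by simp
    then show ?thesis
      using mink_v[of "(v, 0)"] r ww by (simp add: product_immersion(2)[OF f(1,7)] tt)
  qed
  let ?R = "vertical_reflection \<epsilon> v"
  have R: "?R X = X - (2 / r * \<beta> X (?d t)) *\<^sub>R (v, 0)" for X
    using mink_v[of X] by (simp add: vertical_reflection_def prod_eq_iff)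
  have linR: "linear ?R"
    by (rule vertical_reflection_linear)
  have "(\<phi>' \<circ> \<sigma>) p = ?R (\<phi>' p)" if "p \<in> M" for p
  proof (rule congruent_immersions[where \<beta> = \<beta> and \<pi> = horizontal_part and f\<^sub>1 = \<phi>' and f\<^sub>2 = "\<phi>' \<circ> \<sigma>"
        and N\<^sub>1 = N' and N\<^sub>2 = "N' \<circ> \<sigma>" and R = ?R and U\<^sub>0 = U\<^sub>0 and x\<^sub>0 = x\<^sub>0 and u\<^sub>0 = u\<^sub>0])
    show "bounded_bilinear \<beta>"
      by (rule M2R_metric_bounded_bilinear)
    show "\<beta> X Y = \<beta> Y X" for X Y
      by (rule M2R_metric_sym)
    show "z = 0" if "\<And>w. \<beta> z w = 0" for z
      using M2R_metric_nondegenerate[OF _ that] \<epsilon> by auto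
    show "DIM((real^3) \<times> real) = 4"
      by simp
    show "bounded_linear horizontal_part"
      by (rule horizontal_part_bounded_linear)
    show "linear ?R"
      by (rule linR)
    show "horizontal_part (?R z) = ?R (horizontal_part z)" for z
      by (simp add: horizontal_part_def vertical_reflection_def)
    show "(U\<^sub>0, x\<^sub>0) \<in> A" "u\<^sub>0 \<in> U\<^sub>0" "p \<in> M"
      using f that by auto
    have "\<beta> (N' (x\<^sub>0 u\<^sub>0)) (?d t) = 0"
      by (rule product_normal(3)[OF f(1,7)])
    then show "(N' \<circ> \<sigma>) (x\<^sub>0 u\<^sub>0) = ?R (N' (x\<^sub>0 u\<^sub>0))"
      using f(3) by (simp add: R zero_prod_def[symmetric])
    have "mink \<epsilon> (fst (\<phi>' (x\<^sub>0 u\<^sub>0))) v = (1 / r) * mink \<epsilon> (fst (?d t)) (fst (\<phi>' (x\<^sub>0 u\<^sub>0)))"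
      by (simp add: v_def bilinear_rmul[OF mink_bilinear] mink_sym[of _ "fst (?d t)"])
    then show "(\<phi>' \<circ> \<sigma>) (x\<^sub>0 u\<^sub>0) = ?R (\<phi>' (x\<^sub>0 u\<^sub>0))"
      using f(3) product_immersion(3)[OF f(1,7)] by (simp add: vertical_reflection_def)
    show "differential (\<phi>' \<circ> \<sigma> \<circ> x\<^sub>0) u\<^sub>0 z = ?R (?d z)" for z
      unfolding fixed_direction_differential[OF fx twice_differentiable(3)[OF f(1)]]
    proof (rule fixed_direction_basis[OF fx, where f\<^sub>1 = "\<lambda>z. ?d (?ds z)" and f\<^sub>2 = "\<lambda>z. ?R (?d z)"])
      show "linear (\<lambda>z. ?d (?ds z))"
        using linear_compose[OF lds lin] by (simp add: o_def)
      show "linear (\<lambda>z. ?R (?d z))"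
        using linear_compose[OF lin linR] by (simp add: o_def)
      show "?d (?ds w) = ?R (?d w)"
        by (simp add: f(6) R product_immersion(2)[OF f(1,7)] tt(2) zero_prod_def[symmetric])
      have "?R (?d t) = ?d t - (2 / r * (r * r)) *\<^sub>R (v, 0)"
        by (simp only: R product_immersion(2)[OF f(1,7)] tt(1) r(2))
      also have "\<dots> = ?d t - 2 *\<^sub>R ?d t"
        using r(1) unfolding dt_v by simp
      also have "\<dots> = ?d (?ds t)"
        by (simp add: dst linear_neg[OF lin] scaleR_2)
      finally show "?d (?ds (?J w)) = ?R (?d (?J w))"
        by (simp add: t_def)
    qed
  next
    fix U x assume c: "(U, x) \<in> A"
    show "twice_differentiable_on U (\<phi>' \<circ> x)"
      by (rule twice_differentiable(3)[OF c])
    show "twice_differentiable_on U (\<phi>' \<circ> \<sigma> \<circ> x)"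
      by (rule twice_differentiable_on_isometry[OF isometry twice_differentiable(3) c])
    fix u assume u: "u \<in> U"
    show "N' \<circ> x differentiable (at u)"
      by (rule differentiable(4)[OF c u])
    show "N' \<circ> \<sigma> \<circ> x differentiable (at u)"
      using twice_differentiable_on_isometry[OF isometry twice_differentiable(4) c] u
      by (auto simp: twice_differentiable_on_def)
    obtain V y S T \<nu> S' where d: "(V, y) \<in> A" and uD: "u \<in> coord_dom (U, x) (V, y) \<sigma>"
      and data: "shape_data U x u S T \<nu>" and data': "shape_data V y (rep U x V y u) S' (- drep U x V y u T) \<nu>"
      and S': "\<And>v. S' (drep U x V y u v) = - drep U x V y u (S v)"
      by (rule reflected_chart[OF c u]) blast
    let ?s = "rep U x V y u" and ?ds = "drep U x V y u"
    note s = coord_rep_mem(1)[OF uD]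
    note iso = isometry_rep_metric[OF isometry c d uD] and lds = isometry_rep_linear[OF isometry c d uD]
    note rev = reflected_rotation[OF reverses c d uD]
    have linJ: "linear (J (V, y) ?s)"
      using rotation_of_field[OF d s] by (simp add: rotation_of_def)
    note formV = inner_form_simps[OF metric_form[OF d s]]
    have fr: "frame horizontal_part (\<phi>' \<circ> \<sigma>) (N' \<circ> \<sigma>) x u (p, n, w) = frame horizontal_part \<phi>' N' y ?s (p, n, ?ds w)"
      for p n w by (rule frame_isometry[OF isometry c d uD twice_differentiable(3)[OF d]])
    have d\<phi>: "differential (\<phi>' \<circ> \<sigma> \<circ> x) u v = differential (\<phi>' \<circ> y) ?s (?ds v)" for v
      by (rule twice_differentiable_on_isometry_rep(2)[OF isometry c d twice_differentiable(3)[OF d] uD])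
    have dN: "differential (N' \<circ> \<sigma> \<circ> x) u v = differential (N' \<circ> y) ?s (?ds v)" for v
      by (rule twice_differentiable_on_isometry_rep(2)[OF isometry c d twice_differentiable(4)[OF d] uD])
    have rotT: "- J (V, y) ?s (- ?ds T) = ?ds (- J (U, x) u T)"
      by (simp add: linear_neg[OF linJ] linear_neg[OF lds] rev)
    fix k l :: "real \<times> real \<times> (real^2)"
    show "frame horizontal_part \<phi>' N' x u k = 0 \<Longrightarrow> k = 0"
      by (rule product_frame_inj[OF c u])
    obtain p n w where k: "k = (p, n, w)"
      by (metis prod.exhaust)
    show "k = 0" if "frame horizontal_part (\<phi>' \<circ> \<sigma>) (N' \<circ> \<sigma>) x u k = 0"
    proof -
      have "(p, n, ?ds w) = 0"
        using that product_frame_inj[OF d s] unfolding k fr by blast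
      then have "p = 0" "n = 0" "?ds w = 0"
        by (simp_all add: zero_prod_def)
      moreover have "w = 0"
        using iso[of w w] \<open>?ds w = 0\<close> inner_form_eq_0_iff[OF metric_form[OF c u]] by (simp add: formV)
      ultimately show ?thesis
        by (simp add: k zero_prod_def)
    qed
    show "\<beta> (horizontal_part (differential (\<phi>' \<circ> x) u v)) (frame horizontal_part \<phi>' N' x u k)
        = \<beta> (horizontal_part (differential (\<phi>' \<circ> \<sigma> \<circ> x) u v)) (frame horizontal_part (\<phi>' \<circ> \<sigma>) (N' \<circ> \<sigma>) x u k)" for v
      unfolding k fr d\<phi> product_frame_projection[OF c u data] product_frame_projection[OF d s data'] rotT iso ..
    show "\<beta> (differential (N' \<circ> x) u v) (differential (\<phi>' \<circ> x) u w)
        = \<beta> (differential (N' \<circ> \<sigma> \<circ> x) u v) (differential (\<phi>' \<circ> \<sigma> \<circ> x) u w)" for v w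
    proof -
      have "J (V, y) ?s (S' (?ds v)) - \<tau> *\<^sub>R ?ds v = ?ds (J (U, x) u (S v) - \<tau> *\<^sub>R v)"
        by (simp add: S' rev linear_neg[OF linJ] linear_diff[OF lds] linear_scale[OF lds])
      then show ?thesis
        unfolding d\<phi> dN shape_dataD(4)[OF data] shape_dataD(4)[OF data'] by (simp only: iso)
    qed
    obtain p' n' w' where l: "l = (p', n', w')"
      by (metis prod.exhaust)
    show "\<beta> (frame horizontal_part \<phi>' N' x u k) (frame horizontal_part \<phi>' N' x u l)
        = \<beta> (frame horizontal_part (\<phi>' \<circ> \<sigma>) (N' \<circ> \<sigma>) x u k) (frame horizontal_part (\<phi>' \<circ> \<sigma>) (N' \<circ> \<sigma>) x u l)"
      unfolding k l fr product_frame_product[OF c u] product_frame_product[OF d s] iso ..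
  qed
  then show ?thesis
    using unit by (auto simp: symmetry_in_vertical_plane_def)
qed

section \<open>From the data to a reflection of the Berger sphere\<close>

definition reflected_normal :: "'a \<Rightarrow> complex \<times> complex" where
  "reflected_normal p = - N (\<sigma> p)"

abbreviation frame\<^sub>1 where "frame\<^sub>1 \<equiv> frame (\<lambda>z. z) \<phi> N"
abbreviation frame\<^sub>2 where "frame\<^sub>2 \<equiv> frame (\<lambda>z. z) (\<phi> \<circ> \<sigma>) reflected_normal"

lemma reflected_twice_differentiable:
  assumes c: "(U, x) \<in> A"
  shows "twice_differentiable_on U (\<phi> \<circ> \<sigma> \<circ> x)" "twice_differentiable_on U (reflected_normal \<circ> x)"
proof -
  show "twice_differentiable_on U (\<phi> \<circ> \<sigma> \<circ> x)"
    by (rule twice_differentiable_on_isometry[OF isometry twice_differentiable(1) c])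
  have "twice_differentiable_on U (\<lambda>u. - ((N \<circ> \<sigma> \<circ> x) u))"
    by (rule twice_differentiable_on_linear_compose[OF smooth_surface_chart(1)[OF smooth c]
          bounded_linear_minus[OF bounded_linear_ident]
          twice_differentiable_on_isometry[OF isometry twice_differentiable(2) c]])
  then show "twice_differentiable_on U (reflected_normal \<circ> x)"
    by (simp add: reflected_normal_def o_def)
qed

context
  fixes U x V y u
  assumes c: "(U, x) \<in> A" and d: "(V, y) \<in> A" and uD: "u \<in> coord_dom (U, x) (V, y) \<sigma>"
begin

lemma frame\<^sub>2_eq: "frame\<^sub>2 x u (p, n, w) = frame\<^sub>1 y (rep U x V y u) (p, - n, drep U x V y u w)"
  using twice_differentiable_on_isometry_rep(2)[OF isometry c d twice_differentiable(1)[OF d] uD] coord_rep_mem(2)[OF uD]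
  by (simp add: frame_def reflected_normal_def)

lemma reflected_differential:
  "differential (\<phi> \<circ> \<sigma> \<circ> x) u v = differential (\<phi> \<circ> y) (rep U x V y u) (drep U x V y u v)"
  "differential (reflected_normal \<circ> x) u v = - differential (N \<circ> y) (rep U x V y u) (drep U x V y u v)"
proof -
  show "differential (\<phi> \<circ> \<sigma> \<circ> x) u v = differential (\<phi> \<circ> y) (rep U x V y u) (drep U x V y u v)"
    by (rule twice_differentiable_on_isometry_rep(2)[OF isometry c d twice_differentiable(1)[OF d] uD])
  have "differential (\<lambda>u. - ((N \<circ> \<sigma> \<circ> x) u)) u = (\<lambda>v. - differential (N \<circ> \<sigma> \<circ> x) u v)"
  proof (rule differential_linear_compose(2))
    show "bounded_linear (\<lambda>X. - X :: complex \<times> complex)"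
      by (intro bounded_linear_minus bounded_linear_ident)
    show "N \<circ> \<sigma> \<circ> x differentiable (at u)"
      using twice_differentiable_on_isometry[OF isometry twice_differentiable(2) c] coord_rep_mem(3)[OF uD]
      unfolding twice_differentiable_on_def by blast
  qed
  moreover have "reflected_normal \<circ> x = (\<lambda>u. - ((N \<circ> \<sigma> \<circ> x) u))"
    by (simp add: reflected_normal_def fun_eq_iff)
  ultimately show "differential (reflected_normal \<circ> x) u v = - differential (N \<circ> y) (rep U x V y u) (drep U x V y u v)"
    using twice_differentiable_on_isometry_rep(2)[OF isometry c d twice_differentiable(2)[OF d] uD, of v] by simp
qed

end

text \<open>In \<open>berger_frame_product\<close> the vertical data occur through n \<nu> + h(T,
  w), and only in products of two such terms. This term changes sign under \<sigma>: T does by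
  \<open>reflects_data\<close>, and n through the minus sign in \<open>reflected_normal\<close>,
  which anticipates that the reflection carries N to minus the normal at the image point.\<close>

lemma reflected_frame_product:
  assumes c: "(U, x) \<in> A" and u: "u \<in> U"
  shows "frame\<^sub>2 x u k \<bullet> frame\<^sub>2 x u l = frame\<^sub>1 x u k \<bullet> frame\<^sub>1 x u l"
proof -
  obtain V y S T \<nu> S' where d: "(V, y) \<in> A" and uD: "u \<in> coord_dom (U, x) (V, y) \<sigma>"
    and data: "shape_data U x u S T \<nu>" and data': "shape_data V y (rep U x V y u) S' (- drep U x V y u T) \<nu>"
    by (rule reflected_chart[OF c u]) blast
  note s = coord_rep_mem(1)[OF uD]
  note iso = isometry_rep_metric[OF isometry c d uD]
  obtain p n w p' n' w' where kl: "k = (p, n, w)" "l = (p', n', w')"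
    by (metis prod.exhaust)
  have *: "- n * \<nu> + h (V, y) (rep U x V y u) (- drep U x V y u T) (drep U x V y u w) = - (n * \<nu> + h (U, x) u T w)" for n w
    by (simp add: inner_form_simps[OF metric_form[OF d s]] iso)
  show ?thesis
    unfolding kl frame\<^sub>2_eq[OF c d uD] berger_frame_product[OF c u data] berger_frame_product[OF d s data'] * iso
    by (simp only: mult_minus_left mult_minus_right minus_minus)
qed

text \<open>The transition map B between the frames is orthogonal because their Gram matrices agree,
  and it reverses the Hopf vector of the position because \<nu> is kept while T and the normal are
  reversed. So \<open>orthogonal_hopf_sign\<close> applies.\<close>

lemma reflected_hopf_sign:
  assumes c: "(U, x) \<in> A" and u: "u \<in> U"
  shows "\<exists>s. (s = 1 \<or> s = -1) \<and> (\<forall>n w n' w'. frame\<^sub>2 x u (0, n, w) \<bullet> hopf_field (frame\<^sub>2 x u (0, n', w'))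
    = s * (frame\<^sub>1 x u (0, n, w) \<bullet> hopf_field (frame\<^sub>1 x u (0, n', w'))))"
proof -
  obtain V y S T \<nu> S' where d: "(V, y) \<in> A" and uD: "u \<in> coord_dom (U, x) (V, y) \<sigma>"
    and data: "shape_data U x u S T \<nu>" and data': "shape_data V y (rep U x V y u) S' (- drep U x V y u T) \<nu>"
    by (rule reflected_chart[OF c u]) blast
  note s = coord_rep_mem(1)[OF uD]
  have lin1: "linear (frame\<^sub>1 x u)"
    by (rule linear_frame) (rule differentiable(1)[OF c u])
  have lin2: "linear (frame\<^sub>2 x u)"
    using reflected_twice_differentiable(1)[OF c] u by (intro linear_frame) (auto simp: twice_differentiable_on_def)
  have "inj (frame\<^sub>1 x u)"
    using berger_frame_inj[OF c u] lin1 linear_injective_0 by blast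
  then obtain k where k: "linear k" "\<And>z. k (frame\<^sub>1 x u z) = z"
    using linear_injective_left_inverse[OF lin1] by (auto simp: fun_eq_iff)
  define B where "B = (\<lambda>X. frame\<^sub>2 x u (k X))"
  have B1: "B (frame\<^sub>1 x u z) = frame\<^sub>2 x u z" for z
    by (simp add: B_def k)
  have linB: "linear B"
    using linear_compose[OF k(1) lin2] by (simp add: B_def o_def)
  have "B X \<bullet> B Y = X \<bullet> Y" for X Y
    using berger_frame_surj[OF c u] reflected_frame_product[OF c u] B1 by metis
  moreover have B\<phi>: "B (\<phi> (x u)) = \<phi> (\<sigma> (x u))"
  proof -
    have "frame\<^sub>1 x u (1, 0, 0) = \<phi> (x u)"
      using linear_0[OF differential_linear(1)[OF c u]] by (simp add: frame_def)
    moreover have "frame\<^sub>2 x u (1, 0, 0) = \<phi> (\<sigma> (x u))"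
      using linear_0[OF differential_linear(1)[OF d s]] coord_rep_mem(2)[OF uD] unfolding frame\<^sub>2_eq[OF c d uD]
      by (simp add: frame_def linear_0[OF isometry_rep_linear[OF isometry c d uD]])
    ultimately show ?thesis
      using B1 by metis
  qed
  moreover have "B (hopf_field (\<phi> (x u))) = - hopf_field (B (\<phi> (x u)))"
  proof -
    have cc: "(\<kappa> / (4 * \<tau>)) \<noteq> 0"
      using \<kappa>_nz \<tau>_nz by simp
    have "(\<kappa> / (4 * \<tau>)) *\<^sub>R B (hopf_field (\<phi> (x u))) = B (frame\<^sub>1 x u (0, \<nu>, T))"
      using shape_dataD(3)[OF data] by (simp add: linear_scale[OF linB, symmetric] frame_def add.commute)
    also have "\<dots> = frame\<^sub>1 y (rep U x V y u) (0, - \<nu>, drep U x V y u T)"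
      unfolding B1 frame\<^sub>2_eq[OF c d uD] ..
    also have "\<dots> = - ((\<kappa> / (4 * \<tau>)) *\<^sub>R hopf_field (\<phi> (y (rep U x V y u))))"
      using shape_dataD(3)[OF data'] by (simp add: frame_def linear_neg[OF differential_linear(1)[OF d s]])
    also have "\<dots> = (\<kappa> / (4 * \<tau>)) *\<^sub>R (- hopf_field (B (\<phi> (x u))))"
      using coord_rep_mem(2)[OF uD] by (simp add: B\<phi>)
    finally show ?thesis
      using cc by (simp only: scaleR_cancel_left) simp
  qed
  ultimately obtain r where r: "r = 1 \<or> r = -1"
    "\<And>X Y. X \<bullet> \<phi> (x u) = 0 \<Longrightarrow> Y \<bullet> \<phi> (x u) = 0 \<Longrightarrow> B X \<bullet> hopf_field (B Y) = r * (X \<bullet> hopf_field Y)"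
    using orthogonal_hopf_sign[OF linB _ berger_immersion(2)[OF c u]] by metis
  then show ?thesis
    using B1 berger_frame_position[OF c u] by metis
qed

text \<open>The case s = -1 of \<open>reflected_hopf_sign\<close>, stated in all charts at once to
  make it a property of the point.\<close>

definition hopf_reversed :: "'a \<Rightarrow> bool" where
  "hopf_reversed p \<longleftrightarrow> (\<forall>(U, x)\<in>A. \<forall>u\<in>U. x u = p \<longrightarrow> (\<forall>n w n' w'.
     frame\<^sub>2 x u (0, n, w) \<bullet> hopf_field (frame\<^sub>2 x u (0, n', w'))
       = - (frame\<^sub>1 x u (0, n, w) \<bullet> hopf_field (frame\<^sub>1 x u (0, n', w')))))"

lemma hopf_reversedI:
  assumes c: "(U, x) \<in> A" and u: "u \<in> U"
    and rev: "\<And>n w n' w'. frame\<^sub>2 x u (0, n, w) \<bullet> hopf_field (frame\<^sub>2 x u (0, n', w'))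
       = - (frame\<^sub>1 x u (0, n, w) \<bullet> hopf_field (frame\<^sub>1 x u (0, n', w')))"
  shows "hopf_reversed (x u)"
  unfolding hopf_reversed_def
proof (clarify)
  fix U' x' u' n w n' w' assume c': "(U', x') \<in> A" and u': "u' \<in> U'" "x' u' = x u"
  note id = surface_isometry_id
  have k: "u' \<in> coord_dom (U', x') (U, x) id" "coord_rep (U', x') (U, x) id u' = u"
    using u u' by (auto intro: coord_domI coord_rep_eqI[OF smooth c])
  have "frame\<^sub>1 x' u' (p, n, w) = frame\<^sub>1 x u (p, n, differential (coord_rep (U', x') (U, x) id) u' w)" for p n w
    using frame_isometry[OF id c' c k(1) twice_differentiable(1)[OF c], of "\<lambda>z. z" N p n w] k(2) by simp
  moreover have "frame\<^sub>2 x' u' (p, n, w) = frame\<^sub>2 x u (p, n, differential (coord_rep (U', x') (U, x) id) u' w)" for p n w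
    using frame_isometry[OF id c' c k(1) reflected_twice_differentiable(1)[OF c], of "\<lambda>z. z" reflected_normal p n w] k(2) by simp
  ultimately show "frame\<^sub>2 x' u' (0, n, w) \<bullet> hopf_field (frame\<^sub>2 x' u' (0, n', w'))
       = - (frame\<^sub>1 x' u' (0, n, w) \<bullet> hopf_field (frame\<^sub>1 x' u' (0, n', w')))"
    using rev by simp
qed

lemma hopf_reversed_everywhere:
  assumes "p \<in> M" "hopf_reversed p" "q \<in> M"
  shows "hopf_reversed q"
proof (rule locally_constant_on_connected[where P = hopf_reversed, OF smooth connected _ assms])
  fix U x u assume c: "(U, x) \<in> A" and u: "u \<in> U"
  obtain e where e: "legendrian (\<phi> (x u)) e"
    using ex_legendrian[OF berger_immersion(2)[OF c u]] .
  have tangent: "\<exists>n w. frame\<^sub>1 x u (0, n, w) = X" if "X \<bullet> \<phi> (x u) = 0" for X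
    using berger_frame_surj[OF c u, of X] berger_frame_position[OF c u] that by metis
  obtain n w where 1: "frame\<^sub>1 x u (0, n, w) = e"
    using tangent[of e] legendrianD[OF e] by blast
  obtain n' w' where 2: "frame\<^sub>1 x u (0, n', w') = hopf_field e"
    using tangent[of "hopf_field e"] legendrianD[OF e] by blast
  define \<omega>\<^sub>1 where "\<omega>\<^sub>1 = (\<lambda>u. frame\<^sub>1 x u (0, n, w) \<bullet> hopf_field (frame\<^sub>1 x u (0, n', w')))"
  define \<omega>\<^sub>2 where "\<omega>\<^sub>2 = (\<lambda>u. frame\<^sub>2 x u (0, n, w) \<bullet> hopf_field (frame\<^sub>2 x u (0, n', w')))"
  have ne: "\<omega>\<^sub>1 u \<noteq> 0"
    using legendrianD[OF e] by (simp add: \<omega>\<^sub>1_def 1 2)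
  have c1: "isCont (\<lambda>u. frame\<^sub>1 x u k) z" if "z \<in> U" for k z
    using frame_has_derivative[OF bounded_linear_ident twice_differentiable(1)[OF c] differentiable(2)[OF c that] that]
      has_derivative_continuous by blast
  have c2: "isCont (\<lambda>u. frame\<^sub>2 x u k) z" if "z \<in> U" for k z
  proof -
    have "reflected_normal \<circ> x differentiable (at z)"
      using reflected_twice_differentiable(2)[OF c] that by (simp add: twice_differentiable_on_def)
    then show ?thesis
      using frame_has_derivative[OF bounded_linear_ident reflected_twice_differentiable(1)[OF c] _ that]
        has_derivative_continuous by blast
  qed
  have cont: "isCont \<omega>\<^sub>1 z" "isCont \<omega>\<^sub>2 z" if "z \<in> U" for z
    unfolding \<omega>\<^sub>1_def \<omega>\<^sub>2_def using c1[OF that] c2[OF that]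
    by (intro continuous_intros bounded_linear.isCont[OF hopf_bounded_linear]; blast)+
  \<comment> \<open>Where the pairing for the first frame is nonzero, the sign is the quotient of
    the two pairings. It is nonzero at u because the test vectors there are e and i e.\<close>
  define D where "D = U \<inter> \<omega>\<^sub>1 -` (- {0})"
  have D: "open D"
    unfolding D_def using cont(1) chart_open[OF c u]
    by (intro continuous_open_preimage) (auto intro: continuous_at_imp_continuous_on)
  have "\<exists>W. open W \<and> u \<in> W \<and> W \<subseteq> D \<and> (\<forall>u'\<in>W. hopf_reversed (x u') \<longleftrightarrow> hopf_reversed (x u))"
  proof (rule locally_constant_dichotomy[OF D, of u "\<lambda>u. \<omega>\<^sub>2 u + \<omega>\<^sub>1 u" "\<lambda>u. \<omega>\<^sub>2 u - \<omega>\<^sub>1 u"])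
    show "u \<in> D"
      using u ne by (simp add: D_def)
    show "isCont (\<lambda>u. \<omega>\<^sub>2 u + \<omega>\<^sub>1 u) u" "isCont (\<lambda>u. \<omega>\<^sub>2 u - \<omega>\<^sub>1 u) u"
      using cont[OF u] by (auto intro: continuous_intros)
    fix z assume "z \<in> D"
    then have z: "z \<in> U" "\<omega>\<^sub>1 z \<noteq> 0"
      by (auto simp: D_def)
    obtain s where s: "s = 1 \<or> s = -1" "\<And>n w n' w'. frame\<^sub>2 x z (0, n, w) \<bullet> hopf_field (frame\<^sub>2 x z (0, n', w'))
      = s * (frame\<^sub>1 x z (0, n, w) \<bullet> hopf_field (frame\<^sub>1 x z (0, n', w')))"
      using reflected_hopf_sign[OF c z(1)] by blast
    then have \<omega>: "\<omega>\<^sub>2 z = s * \<omega>\<^sub>1 z"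
      by (simp add: \<omega>\<^sub>1_def \<omega>\<^sub>2_def)
    show "\<omega>\<^sub>2 z + \<omega>\<^sub>1 z = 0 \<longleftrightarrow> \<omega>\<^sub>2 z - \<omega>\<^sub>1 z \<noteq> 0"
      using s(1) z(2) by (auto simp: \<omega>)
    show "hopf_reversed (x z) \<longleftrightarrow> \<omega>\<^sub>2 z + \<omega>\<^sub>1 z = 0"
    proof
      assume "hopf_reversed (x z)"
      then show "\<omega>\<^sub>2 z + \<omega>\<^sub>1 z = 0"
        using c z(1) by (auto simp: hopf_reversed_def \<omega>\<^sub>1_def \<omega>\<^sub>2_def)
    next
      assume "\<omega>\<^sub>2 z + \<omega>\<^sub>1 z = 0"
      then have "s = -1"
        using s(1) z(2) by (auto simp: \<omega>)
      then show "hopf_reversed (x z)"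
        using s(2) by (intro hopf_reversedI[OF c z(1)]) simp
    qed
  qed
  then show "\<exists>W. open W \<and> u \<in> W \<and> W \<subseteq> U \<and> (\<forall>u'\<in>W. hopf_reversed (x u') \<longleftrightarrow> hopf_reversed (x u))"
    unfolding D_def by blast
qed

text \<open>At a fixed point a is the position and e the unit vector along the image of the fixed
  direction w. The reflection in their plane negates N and the image of J w, so it acts as \<sigma>
  does on the frame with \<open>reflected_normal\<close>.\<close>

theorem berger_symmetric:
  "symmetry_around_horizontal_geodesic M \<kappa> \<tau> \<phi> \<sigma>"
proof -
  obtain U\<^sub>0 x\<^sub>0 u\<^sub>0 w where fx: "fixed_direction U\<^sub>0 x\<^sub>0 u\<^sub>0 w"
    using ex_fixed_direction by blast
  note f = fixed_directionD[OF fx]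
  let ?h = "h (U\<^sub>0, x\<^sub>0) u\<^sub>0" and ?J = "J (U\<^sub>0, x\<^sub>0) u\<^sub>0" and ?d = "differential (\<phi> \<circ> x\<^sub>0) u\<^sub>0" and ?ds = "drep U\<^sub>0 x\<^sub>0 U\<^sub>0 x\<^sub>0 u\<^sub>0"
  note form = metric_form[OF f(1,7)]
  have rot: "rotation_of ?h ?J"
    using rotation_of_field[OF f(1,7)] .
  note lin = differential_linear(1)[OF f(1,7)]
  obtain S T \<nu> where data: "shape_data U\<^sub>0 x\<^sub>0 u\<^sub>0 S T \<nu>" and T: "?ds T = - T"
    using fixed_direction_data[OF fx] by blast
  have lds: "linear ?ds"
    using isometry_rep_linear[OF isometry f(1,1,2)] .
  have dsJ: "?ds (?J w) = - ?J w"
    using reflected_rotation[OF reverses f(1,1,2), of w] f(5,6) by simp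
  \<comment> \<open>The differential of \<sigma> reverses T and fixes w, so w is orthogonal to T and
    its image is horizontal, as \<open>legendrian\<close> requires.\<close>
  have "?h T w = - ?h T w"
    using fixed_direction_metric[OF fx, of T w] T f(6) by (simp add: inner_form_simps[OF form])
  then have hor: "?d w \<bullet> hopf_field (\<phi> (x\<^sub>0 u\<^sub>0)) = 0"
    using berger_vertical_pairing[OF f(1,7) data, of 0 w] by simp
  have "?h w w \<noteq> 0"
    using f(4) inner_form_eq_0_iff[OF form] by simp
  then have "?d w \<noteq> 0"
    using berger_immersion(3)[OF f(1,7), of w w] by (auto simp: g_eq)
  define a where "a = \<phi> (x\<^sub>0 u\<^sub>0)"
  define e where "e = (1 / norm (?d w)) *\<^sub>R ?d w"
  have dw: "?d w = norm (?d w) *\<^sub>R e"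
    using \<open>?d w \<noteq> 0\<close> by (simp add: e_def)
  have leg: "legendrian a e"
    using berger_immersion(2,4)[OF f(1,7)] hor \<open>?d w \<noteq> 0\<close>
    by (simp add: legendrian_def a_def e_def inner_commute[of "\<phi> (x\<^sub>0 u\<^sub>0)"] dot_square_norm power2_eq_square)
  let ?L = "plane_reflection a e"
  note linL = plane_reflection_linear[of a e]
  have flip: "?L X = - X" if "X \<bullet> \<phi> (x\<^sub>0 u\<^sub>0) = 0" "g (\<phi> (x\<^sub>0 u\<^sub>0)) X (?d w) = 0" for X
  proof -
    have "X \<bullet> ?d w = 0"
      using inner_eq_g[of X "?d w" "\<phi> (x\<^sub>0 u\<^sub>0)"] that(2) hor by simp
    then show ?thesis
      using that(1) by (simp add: plane_reflection_def a_def e_def)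
  qed
  have base_\<phi>: "(\<phi> \<circ> \<sigma>) (x\<^sub>0 u\<^sub>0) = ?L (\<phi> (x\<^sub>0 u\<^sub>0))"
    using f(3) plane_reflection_fixes(1)[OF leg] by (simp add: a_def)
  have base_N: "reflected_normal (x\<^sub>0 u\<^sub>0) = ?L (N (x\<^sub>0 u\<^sub>0))"
    using f(3) flip[of "N (x\<^sub>0 u\<^sub>0)"] berger_normal[OF f(1,7)] by (simp add: reflected_normal_def)
  have base_d: "differential (\<phi> \<circ> \<sigma> \<circ> x\<^sub>0) u\<^sub>0 z = ?L (?d z)" for z
    unfolding fixed_direction_differential[OF fx twice_differentiable(1)[OF f(1)]]
  proof (rule fixed_direction_basis[OF fx, where f\<^sub>1 = "\<lambda>z. ?d (?ds z)" and f\<^sub>2 = "\<lambda>z. ?L (?d z)"])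
    show "linear (\<lambda>z. ?d (?ds z))"
      using linear_compose[OF lds lin] by (simp add: o_def)
    show "linear (\<lambda>z. ?L (?d z))"
      using linear_compose[OF lin linL] by (simp add: o_def)
    have "?L (?d w) = ?d w"
      by (subst (1 2) dw) (simp only: linear_scale[OF linL] plane_reflection_fixes(2)[OF leg])
    then show "?d (?ds w) = ?L (?d w)"
      by (simp add: f(6))
    have "?h (?J w) w = 0"
      using rot by (simp add: rotation_of_def)
    then show "?d (?ds (?J w)) = ?L (?d (?J w))"
      using flip[of "?d (?J w)"] berger_immersion(3,4)[OF f(1,7)] by (simp add: dsJ linear_neg[OF lin])
  qed
  have "frame\<^sub>2 x\<^sub>0 u\<^sub>0 k = ?L (frame\<^sub>1 x\<^sub>0 u\<^sub>0 k)" for k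
    using base_\<phi> base_N base_d by (simp add: frame_def linear_add[OF linL] linear_scale[OF linL])
  \<comment> \<open>At the base point the reflection is itself the transition map of the frames;
    being antilinear, it settles the open sign as -1.\<close>
  moreover have "?L X \<bullet> hopf_field (?L Y) = - (X \<bullet> hopf_field Y)" for X Y
    using plane_reflection_hopf[OF leg, of Y] plane_reflection_isometry[OF leg, of X "hopf_field Y"]
    by (metis add.inverse_inverse inner_minus_right)
  ultimately have hx0: "hopf_reversed (x\<^sub>0 u\<^sub>0)"
    by (intro hopf_reversedI[OF f(1,7)]) simp
  have hopf: "frame\<^sub>2 x u (0, n, w) \<bullet> hopf_field (frame\<^sub>2 x u (0, n', w'))
       = - (frame\<^sub>1 x u (0, n, w) \<bullet> hopf_field (frame\<^sub>1 x u (0, n', w')))"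
    if "(U, x) \<in> A" "u \<in> U" for U x u n w n' w'
  proof -
    have "x u \<in> M"
      using smooth_surface_chart(4)[OF smooth that(1)] that(2) by blast
    from hopf_reversed_everywhere[OF f(8) hx0 this] show ?thesis
      unfolding hopf_reversed_def using that by (auto dest!: bspec[OF _ that(1)])
  qed
  have "(\<phi> \<circ> \<sigma>) p = ?L (\<phi> p)" if "p \<in> M" for p
  proof (rule congruent_immersions[where \<beta> = inner and \<pi> = "\<lambda>z. z" and f\<^sub>1 = \<phi> and f\<^sub>2 = "\<phi> \<circ> \<sigma>"
        and N\<^sub>1 = N and N\<^sub>2 = reflected_normal and R = ?L and U\<^sub>0 = U\<^sub>0 and x\<^sub>0 = x\<^sub>0 and u\<^sub>0 = u\<^sub>0])
    show "bounded_bilinear (inner :: complex \<times> complex \<Rightarrow> _)"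
      by (rule bounded_bilinear_inner)
    show "X \<bullet> Y = Y \<bullet> X" for X Y :: "complex \<times> complex"
      by (rule inner_commute)
    show "z = 0" if "\<And>w. z \<bullet> w = 0" for z :: "complex \<times> complex"
      using that[of z] by simp
    show "DIM(complex \<times> complex) = 4"
      by simp
    show "bounded_linear (\<lambda>z. z :: complex \<times> complex)"
      by (rule bounded_linear_ident)
    show "linear ?L" "(U\<^sub>0, x\<^sub>0) \<in> A" "u\<^sub>0 \<in> U\<^sub>0" "p \<in> M"
      using linL f that by auto
    show "(\<phi> \<circ> \<sigma>) (x\<^sub>0 u\<^sub>0) = ?L (\<phi> (x\<^sub>0 u\<^sub>0))" "reflected_normal (x\<^sub>0 u\<^sub>0) = ?L (N (x\<^sub>0 u\<^sub>0))"
      "differential (\<phi> \<circ> \<sigma> \<circ> x\<^sub>0) u\<^sub>0 z = ?L (?d z)" for z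
      by (rule base_\<phi> base_N base_d)+
  next
    fix U x assume c: "(U, x) \<in> A"
    show "twice_differentiable_on U (\<phi> \<circ> x)"
      by (rule twice_differentiable(1)[OF c])
    show "twice_differentiable_on U (\<phi> \<circ> \<sigma> \<circ> x)"
      by (rule reflected_twice_differentiable(1)[OF c])
    fix u assume u: "u \<in> U"
    show "N \<circ> x differentiable (at u)"
      by (rule differentiable(2)[OF c u])
    show "reflected_normal \<circ> x differentiable (at u)"
      using reflected_twice_differentiable(2)[OF c] u by (simp add: twice_differentiable_on_def)
    obtain V y S T \<nu> S' where d: "(V, y) \<in> A" and uD: "u \<in> coord_dom (U, x) (V, y) \<sigma>"
      and data: "shape_data U x u S T \<nu>" and data': "shape_data V y (rep U x V y u) S' (- drep U x V y u T) \<nu>"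
      and S': "\<And>v. S' (drep U x V y u v) = - drep U x V y u (S v)"
      by (rule reflected_chart[OF c u]) blast
    let ?s = "rep U x V y u" and ?ds = "drep U x V y u"
    note s = coord_rep_mem(1)[OF uD]
    note iso = isometry_rep_metric[OF isometry c d uD] and lds = isometry_rep_linear[OF isometry c d uD]
    note formV = inner_form_simps[OF metric_form[OF d s]]
    note fr = frame\<^sub>2_eq[OF c d uD]
    note diff = reflected_differential[OF c d uD]
    note prod = reflected_frame_product[OF c u]
    fix k l :: "real \<times> real \<times> (real^2)"
    show "frame\<^sub>1 x u k = 0 \<Longrightarrow> k = 0"
      by (rule berger_frame_inj[OF c u])
    then show "k = 0" if "frame\<^sub>2 x u k = 0"
      using prod[of k k] that by simp
    have d\<^sub>1: "differential (\<phi> \<circ> x) u v = frame\<^sub>1 x u (0, 0, v)" for v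
      by (simp add: frame_def)
    have d\<^sub>2: "differential (\<phi> \<circ> \<sigma> \<circ> x) u v = frame\<^sub>2 x u (0, 0, v)" for v
      by (simp add: frame_def)
    show "differential (\<phi> \<circ> x) u v \<bullet> frame\<^sub>1 x u k = differential (\<phi> \<circ> \<sigma> \<circ> x) u v \<bullet> frame\<^sub>2 x u k" for v
      unfolding d\<^sub>1 d\<^sub>2 prod ..
    show "frame\<^sub>1 x u k \<bullet> frame\<^sub>1 x u l = frame\<^sub>2 x u k \<bullet> frame\<^sub>2 x u l" for l
      unfolding prod ..
    show "differential (N \<circ> x) u v \<bullet> differential (\<phi> \<circ> x) u w
        = differential (reflected_normal \<circ> x) u v \<bullet> differential (\<phi> \<circ> \<sigma> \<circ> x) u w" for v w
    proof -
      have N\<^sub>1: "N (x u) = frame\<^sub>1 x u (0, 1, 0)"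
        using linear_0[OF differential_linear(1)[OF c u]] by (simp add: frame_def)
      have N\<^sub>2: "- N (y ?s) = frame\<^sub>2 x u (0, 1, 0)"
        unfolding fr using linear_0[OF differential_linear(1)[OF d s]] by (simp add: frame_def linear_0[OF lds])
      have \<omega>: "differential (\<phi> \<circ> y) ?s (?ds w) \<bullet> hopf_field (differential (\<phi> \<circ> y) ?s (?ds v))
          = - (differential (\<phi> \<circ> x) u w \<bullet> hopf_field (differential (\<phi> \<circ> x) u v))"
        unfolding diff(1)[symmetric] d\<^sub>1 d\<^sub>2 by (rule hopf[OF c u])
      have "differential (\<phi> \<circ> y) ?s (?ds w) \<bullet> hopf_field (- N (y ?s))
          = - (differential (\<phi> \<circ> x) u w \<bullet> hopf_field (N (x u)))"
        unfolding diff(1)[symmetric] d\<^sub>1 d\<^sub>2 N\<^sub>1 N\<^sub>2 by (rule hopf[OF c u])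
      then have \<omega>N: "differential (\<phi> \<circ> y) ?s (?ds w) \<bullet> hopf_field (N (y ?s))
          = differential (\<phi> \<circ> x) u w \<bullet> hopf_field (N (x u))"
        by simp
      \<comment> \<open>Every term of \<open>berger_second_form\<close> changes sign: the first
        through S, the second through S and two factors T, the third through \<omega> and the last
        through T. The minus sign in \<open>reflected_normal\<close> restores equality.\<close>
      have "- (differential (N \<circ> y) ?s (?ds v) \<bullet> differential (\<phi> \<circ> y) ?s (?ds w))
          = differential (N \<circ> x) u v \<bullet> differential (\<phi> \<circ> x) u w"
        unfolding berger_second_form[OF c u data] berger_second_form[OF d s data'] S' \<omega> \<omega>N
        by (simp add: formV iso algebra_simps)
      then show ?thesis
        unfolding diff by simp
    qed
  qed simp
  then have *: "\<phi> (\<sigma> p) = ?L (\<phi> p)" if "p \<in> M" for p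
    using that by simp
  obtain \<gamma> where "horizontal_geodesic \<kappa> \<tau> \<gamma>" "geodesic_reflection S3 g \<gamma> ?L"
    by (rule plane_reflection_geodesic_reflection[OF leg])
  then show ?thesis
    unfolding symmetry_around_horizontal_geodesic_def using * by blast
qed

end

lemma image_in_S3:
  assumes "p \<in> M"
  shows "\<phi> p \<in> S3"
  using smooth_surface_cover[OF smooth assms] berger_immersion(1) by metis

theorem symmetries_correspond:
  "symmetry_around_horizontal_geodesic M \<kappa> \<tau> \<phi> \<sigma> \<longleftrightarrow> symmetry_in_vertical_plane M \<epsilon> \<phi>' \<sigma>"
proof
  assume "symmetry_around_horizontal_geodesic M \<kappa> \<tau> \<phi> \<sigma>"
  then obtain \<gamma> \<rho> where \<gamma>: "horizontal_geodesic \<kappa> \<tau> \<gamma>" "geodesic_reflection S3 g \<gamma> \<rho>"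
    and \<rho>: "\<And>p. p \<in> M \<Longrightarrow> \<phi> (\<sigma> p) = \<rho> (\<phi> p)"
    unfolding symmetry_around_horizontal_geodesic_def by blast
  obtain a e where leg: "legendrian a e" and L: "\<And>p. p \<in> S3 \<Longrightarrow> \<rho> p = plane_reflection a e p"
    by (rule geodesic_reflection_eq_plane_reflection[OF \<gamma>]) blast
  have sym: "\<phi> (\<sigma> p) = plane_reflection a e (\<phi> p)" if "p \<in> M" for p
    using \<rho>[OF that] L[OF image_in_S3[OF that]] by simp
  show "symmetry_in_vertical_plane M \<epsilon> \<phi>' \<sigma>"
    using product_symmetric[OF berger_reflects_data[OF leg sym] berger_reverses[OF leg sym]] .
next
  assume "symmetry_in_vertical_plane M \<epsilon> \<phi>' \<sigma>"
  then obtain v where v: "mink \<epsilon> v v = 1" "\<And>p. p \<in> M \<Longrightarrow> \<phi>' (\<sigma> p) = vertical_reflection \<epsilon> v (\<phi>' p)"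
    unfolding symmetry_in_vertical_plane_def by blast
  show "symmetry_around_horizontal_geodesic M \<kappa> \<tau> \<phi> \<sigma>"
    using berger_symmetric[OF product_reflects_data[OF v] product_reverses[OF v]] .
qed

end

text \<open>Two constant loops are homotopic through loops, and during the homotopy the value at
  parameter 0 runs along a path from one point to the other.\<close>

lemma simply_connected_imp_connected_space:
  fixes S :: "'a::topological_space set"
  assumes "simply_connected S"
  shows "connected S"
proof (rule path_connected_imp_connected)
  show "path_connected S"
    unfolding path_connected_component
  proof (intro ballI)
    fix a b assume "a \<in> S" "b \<in> S"
    then have "homotopic_loops S (\<lambda>_. a) (\<lambda>_. b)"
      by (intro assms[unfolded simply_connected_def, rule_format])
         (auto simp: path_def path_image_def pathstart_def pathfinish_def)
    then show "path_component S a b"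
      using homotopic_loops_imp_path_component_value[of S "\<lambda>_. a" "\<lambda>_. b" 0] by simp
  qed
qed

theorem lemma3:
  fixes \<epsilon> \<tau> \<kappa> :: real
    and M :: "'a::{t2_space,second_countable_topology} set"
    and A :: "'a chart set" and h :: "'a surface_metric" and J :: "'a endomorphism_field"
    and \<phi> N :: "'a \<Rightarrow> complex \<times> complex"
    and \<phi>' N' :: "'a \<Rightarrow> (real^3) \<times> real"
    and \<sigma> :: "'a \<Rightarrow> 'a"
  assumes "\<epsilon> \<in> {1, -1}" and "\<tau> \<noteq> 0" and "\<kappa> = 4 * \<tau>\<^sup>2 + \<epsilon>" and "\<kappa> > 0"
    and "smooth_surface M A" and "simply_connected M"
    and "riemannian_metric A h" and "rotation_field A h J"
    and "minimal_immersion A h \<kappa> \<tau> \<phi> N"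
    and "sister_immersion A h J \<epsilon> \<kappa> \<tau> \<phi> N \<phi>' N'"
    and "surface_reflection M A h \<sigma>"
  shows "symmetry_around_horizontal_geodesic M \<kappa> \<tau> \<phi> \<sigma> \<longleftrightarrow> symmetry_in_vertical_plane M \<epsilon> \<phi>' \<sigma>"
proof -
  interpret reflected_sister_surface M A h J \<kappa> \<tau> \<epsilon> \<phi> N \<phi>' N' \<sigma>
    using assms simply_connected_imp_connected_space by unfold_locales auto
  show ?thesis
    by (rule symmetries_correspond)
qed

end
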